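(* Let $d\ge1$ and $\ell\ge0$ be integers, let $s\in\{+1,-1\}$, and let $\mathfrak{r}(\ell)\in\{0,1\}$ be such that $\mathfrak{r}(\ell)\equiv\ell\pmod 2$. Let $P:\mathbb{R}^{d+2\ell}\to\mathbb{R}$ be a radial function, $P(x)=P_0(|x|)$, satisfying properties (P1), (P2) and (P3) (in dimension $d+2\ell$; see context). Let $\widetilde P:\mathbb{R}^d\to\mathbb{R}$ be a function satisfying properties (P1) and (P2) (in dimension $d$) of the form $$\widetilde P(x)=H(x)\,P_0(|x|)\,Q(x),$$ where $H:\mathbb{R}^d\to\mathbb{R}$ is a non-zero homogeneous and harmonic polynomial of degree $\ell$ and $Q:\mathbb{R}^d\to\mathbb{R}$ is an even non-negative function, homogeneous of degree $0$. If $\mathcal{A}^*_s(P;d+2\ell)$ is non-empty, then $\mathcal{A}^*_{s(-1)^{(\mathfrak{r}(\ell)+\ell)/2}}(\widetilde P;d)$ is also non-empty and $$\mathbb{A}^*_s(P;d+2\ell)\ \ge\ \mathbb{A}^*_{s(-1)^{(\mathfrak{r}(\ell)+\ell)/2}}(\widetilde P;d).$$ If, in addition, the sub-level set $\{x\in\mathbb{R}^{d+2\ell}:|P(x)|\le\lambda\}$ is bounded for some $\lambda>0$, $Q=\mathbf{1}$, $0\le\ell\le d$, and $H\in(x_1x_2\cdots x_\ell)\circ O(d)$, then the converse holds: $\mathcal{A}^*_s(P;d+2\ell)$ is non-empty if and only if $\mathcal{A}^*_{s(-1)^{(\mathfrak{r}(\ell)+\ell)/2}}(\widetilde P;d)$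 is non-empty, and $$\mathbb{A}^*_s(P;d+2\ell)=\mathbb{A}^*_{s(-1)^{(\mathfrak{r}(\ell)+\ell)/2}}(\widetilde P;d).$$
   Context: The Fourier transform of $f\in L^1(\mathbb{R}^n)$ is $\widehat f(\xi)=\int_{\mathbb{R}^n}e^{-2\pi i x\cdot\xi}f(x)\,dx$. A measurable function $f:\mathbb{R}^n\to\mathbb{R}$ is eventually non-negative (resp. eventually zero) if $f(x)\ge0$ (resp. $f(x)=0$) for all (not merely almost all) $x$ with $|x|$ sufficiently large; in the first case $r(f):=\inf\{r>0:f(x)\ge0\text{ for all }|x|\ge r\}$. Standing assumption: each weight function considered ($P$ on $\mathbb{R}^{d+2\ell}$ and $\widetilde P$ on $\mathbb{R}^d$) is measurable and not identically zero on the complement of the origin. Properties of a weight $W:\mathbb{R}^n\to\mathbb{R}$: (P1) $W\in L^1_{\rm loc}(\mathbb{R}^n)$. (P2) $W$ is even or odd: $W(-x)=(-1)^{\mathfrak{r}}W(x)$ for all $x\in\mathbb{R}^n$, where $\mathfrak{r}=\mathfrak{r}_W\in\{0,1\}$. (P3) If $f\in L^1(\mathbb{R}^n)$ is a continuous eigenfunction of the Fourier transform such that $Wf$ is eventually zero, then $f=\mathbf{0}$. For a weight $W:\mathbb{R}^n\to\mathbb{R}$ satisfying (P1) and (P2), with parity $\mathfrak{r}=\mathfrak{r}_W$, and a sign $\sigma\in\{+1,-1\}$, $\mathcal{A}^*_\sigma(W;n)$ is the set of continuous real-valued $f\in L^1(\mathbb{R}^n)\setminus\{\mathbf{0}\}$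 such that $\widehat f=\sigma\,i^{\mathfrak{r}}f$, $Wf\in L^1(\mathbb{R}^n)$, $\int_{\mathbb{R}^n}Wf\le0$, and $Wf$ is eventually non-negative. Define $\mathbb{A}^*_\sigma(W;n)=\inf_{f\in\mathcal{A}^*_\sigma(W;n)}r(Wf)$. $O(d)$ is the group of linear orthogonal transformations of $\mathbb{R}^d$, and for $H:\mathbb{R}^d\to\mathbb{R}$, $H\circ O(d)=\{H\circ R: R\in O(d)\}$. The product $x_1x_2\cdots x_\ell$ is the function on $\mathbb{R}^d$ given by the product of the first $\ell$ coordinates (equal to $1$ if $\ell=0$). $\mathbf{1}$ is the function identically equal to $1$. $Q$ homogeneous of degree $0$ means $Q(\delta x)=Q(x)$ for all $\delta>0$ and $x\in\mathbb{R}^d$. *)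

theory Defs
  imports "HOL-Analysis.Analysis"
begin

definition fourier :: "('a::euclidean_space \<Rightarrow> complex) \<Rightarrow> 'a \<Rightarrow> complex" where
  "fourier f \<xi> = (LINT x|lebesgue. exp (- 2 * of_real pi * \<i> * of_real (x \<bullet> \<xi>)) * f x)"

definition eventually_nonneg :: "('a::real_normed_vector \<Rightarrow> real) \<Rightarrow> bool" where
  "eventually_nonneg f \<longleftrightarrow> (\<exists>R. \<forall>x. norm x \<ge> R \<longrightarrow> f x \<ge> 0)"

definition eventually_zero :: "('a::real_normed_vector \<Rightarrow> 'b::zero) \<Rightarrow> bool" where
  "eventually_zero f \<longleftrightarrow> (\<exists>R. \<forall>x. norm x \<ge> R \<longrightarrow> f x = 0)"

definition last_sign_radius :: "('a::real_normed_vector \<Rightarrow> real) \<Rightarrow> real" where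
  "last_sign_radius f = Inf {r. r > 0 \<and> (\<forall>x. norm x \<ge> r \<longrightarrow> f x \<ge> 0)}"

definition weight :: "('a::euclidean_space \<Rightarrow> real) \<Rightarrow> bool" where
  "weight W \<longleftrightarrow> W \<in> borel_measurable lebesgue \<and> (\<exists>x. x \<noteq> 0 \<and> W x \<noteq> 0)"

definition P1 :: "('a::euclidean_space \<Rightarrow> real) \<Rightarrow> bool" where
  "P1 W \<longleftrightarrow> (\<forall>K. compact K \<longrightarrow> set_integrable lebesgue K W)"

definition has_parity :: "('a::real_vector \<Rightarrow> real) \<Rightarrow> nat \<Rightarrow> bool" where
  "has_parity W r \<longleftrightarrow> r \<in> {0, 1} \<and> (\<forall>x. W (- x) = (-1) ^ r * W x)"

definition P2 :: "('a::real_vector \<Rightarrow> real) \<Rightarrow> bool" where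
  "P2 W \<longleftrightarrow> (\<exists>r. has_parity W r)"

text \<open>Well defined for every weight satisfying \<^const>\<open>P2\<close>: the parity is unique because a
  weight is not identically zero.\<close>

definition weight_parity :: "('a::real_vector \<Rightarrow> real) \<Rightarrow> nat" where
  "weight_parity W = (THE r. has_parity W r)"

definition P3 :: "('a::euclidean_space \<Rightarrow> real) \<Rightarrow> bool" where
  "P3 W \<longleftrightarrow>
    (\<forall>f :: 'a \<Rightarrow> complex.
       integrable lebesgue f \<and> continuous_on UNIV f \<and>
       (\<exists>c. \<forall>\<xi>. fourier f \<xi> = c * f \<xi>) \<and>
       eventually_zero (\<lambda>x. of_real (W x) * f x)
       \<longrightarrow> f = (\<lambda>x. 0))"

definition A_star :: "real \<Rightarrow> ('a::euclidean_space \<Rightarrow> real) \<Rightarrow> ('a \<Rightarrow> real) set" where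
  "A_star \<sigma> W =
    {f. continuous_on UNIV f \<and> integrable lebesgue f \<and> f \<noteq> (\<lambda>x. 0) \<and>
        (\<forall>\<xi>. fourier (\<lambda>x. of_real (f x)) \<xi>
              = of_real \<sigma> * \<i> ^ weight_parity W * of_real (f \<xi>)) \<and>
        integrable lebesgue (\<lambda>x. W x * f x) \<and>
        (LINT x|lebesgue. W x * f x) \<le> 0 \<and>
        eventually_nonneg (\<lambda>x. W x * f x)}"

text \<open>Extended-real valued, so that the infimum over the empty class is \<open>\<infinity>\<close>.\<close>

definition A_inf :: "real \<Rightarrow> ('a::euclidean_space \<Rightarrow> real) \<Rightarrow> ereal" where
  "A_inf \<sigma> W = (INF f \<in> A_star \<sigma> W. ereal (last_sign_radius (\<lambda>x. W x * f x)))"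

text \<open>Iterated partial derivatives along the standard basis; only applied to polynomials, where
  no differentiability issue arises.\<close>

definition laplacian :: "('a::euclidean_space \<Rightarrow> real) \<Rightarrow> 'a \<Rightarrow> real" where
  "laplacian f x = (\<Sum>b\<in>Basis. (deriv ^^ 2) (\<lambda>t. f (x + t *\<^sub>R b)) 0)"

definition homogeneous_harmonic_polynomial :: "nat \<Rightarrow> ('a::euclidean_space \<Rightarrow> real) \<Rightarrow> bool" where
  "homogeneous_harmonic_polynomial l H \<longleftrightarrow>
    real_polynomial_function H \<and>
    (\<forall>c x. H (c *\<^sub>R x) = c ^ l * H x) \<and>
    (\<forall>x. laplacian H x = 0)"

definition orthogonal_orbit :: "('a::real_inner \<Rightarrow> real) \<Rightarrow> ('a \<Rightarrow> real) set" where
  "orthogonal_orbit H = {H \<circ> R | R. orthogonal_transformation R}"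

end

theory Submission
  imports Defs "HOL-Probability.Probability" "HOL-Complex_Analysis.Complex_Analysis"
begin

text \<open>
The theorem compares eigenfunctions of the Fourier transform in dimension \<open>n\<close> that are multiples of a
harmonic polynomial \<open>H\<close> of degree \<open>l\<close> with radial eigenfunctions in dimension \<open>m = n + 2 * l\<close>. The
bridge is Bochner's relation: if \<open>F y = f0 (norm y)\<close> on the larger space, then the transform of
\<open>H x * f0 (norm x)\<close> is \<open>(- \<i>) ^ l * H \<xi>\<close> times the transform of \<open>F\<close> at radius \<open>norm \<xi>\<close>
(\<open>fourier_harmonic_times_radial\<close>).

Bochner's relation follows from a Funk-Hecke formula (\<open>funk_hecke\<close>): integrating \<open>H\<close> against a plane wave
over the sphere gives \<open>H\<close> times the spherical mean of a plane wave in dimension \<open>m\<close>. Both sides are power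
series in the radius, and their coefficients are moments over spheres. These are obtained from Gaussian moments
by polar coordinates, and the Gaussian moments from the generating function of \<open>H\<close>, which the mean value
property of harmonic polynomials evaluates (\<open>gaussian_mean_value\<close>). Polar coordinates also show that a
factor \<open>norm x ^ (2 * l)\<close> in dimension \<open>n\<close> acts on radial functions like \<open>2 * l\<close> further dimensions
(\<open>radial_shift\<close>).

From \<open>m\<close> to \<open>n\<close> (\<open>A_star_lift\<close>): take the spherical mean of an admissible function, which is nonzero by
\<^const>\<open>P3\<close>, and multiply its profile by \<open>H\<close>. The new weighted function is the old one times the angular factor
\<open>H * H * Q\<close>, which is non-negative, so signs and the sign of the integral are kept.

From \<open>n\<close> to \<open>m\<close> (\<open>A_star_projection\<close>): integrate \<open>g\<close> against \<open>H\<close> over spheres and divide by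
\<open>norm x ^ l\<close> (\<open>harmonic_profile\<close>). The Funk-Hecke formula shows that the resulting radial function is again
an eigenfunction (\<open>harmonic_projection\<close>). It is continuous also at the origin because, being an eigenfunction, it
agrees with a multiple of its own transform. With \<open>Q = 1\<close> the weighted function of the projection is
a spherical average of the given one, and it cannot vanish identically since a compactly supported eigenfunction
is zero. Spherical mean and projection are the same construction, once with \<open>H = 1\<close> and once with \<open>H\<close>.
\<close>

section \<open>Polar coordinates and change of dimension\<close>

text \<open>The normalised surface measure of the unit sphere, obtained by projecting the uniform distribution
of the unit ball radially. The centre, where \<open>sgn 0 = 0\<close>, carries no mass.\<close>

definition sphere_measure :: "'a::euclidean_space measure" where
  "sphere_measure = distr (uniform_measure lborel (cball 0 1)) borel sgn"

lemma sets_sphere_measure [simp, measurable_cong]: "sets sphere_measure = sets borel"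
  by (simp add: sphere_measure_def)

lemma space_sphere_measure [simp]: "space sphere_measure = UNIV"
  by (simp add: sphere_measure_def)

lemma borel_measurable_sgn_euclidean [measurable]:
  "(sgn :: 'a::euclidean_space \<Rightarrow> 'a) \<in> borel_measurable borel"
  unfolding sgn_div_norm[abs_def] by measurable

lemma unit_ball_vol_neq_0 [simp]: "n \<ge> 0 \<Longrightarrow> unit_ball_vol n \<noteq> 0"
  using unit_ball_vol_pos[of n] by (simp del: unit_ball_vol_pos)

lemma emeasure_unit_ball_pos_finite:
  "emeasure lborel (cball (0::'a::euclidean_space) 1) \<noteq> 0"
  "emeasure lborel (cball (0::'a::euclidean_space) 1) \<noteq> \<infinity>"
  by (auto simp: emeasure_cball)

interpretation sphere: prob_space "sphere_measure :: 'a::euclidean_space measure"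
proof -
  interpret U: prob_space "uniform_measure lborel (cball (0::'a) 1)"
    by (rule prob_space_uniform_measure) (use emeasure_unit_ball_pos_finite in auto)
  show "prob_space (sphere_measure :: 'a measure)"
    unfolding sphere_measure_def by (rule U.prob_space_distr) simp
qed

lemma emeasure_sphere_measure:
  assumes [measurable]: "A \<in> sets borel"
  shows "emeasure (sphere_measure :: 'a::euclidean_space measure) A =
    emeasure lborel {x::'a. sgn x \<in> A \<and> norm x \<le> 1} / ennreal (unit_ball_vol DIM('a))"
proof -
  have *: "{x::'a. sgn x \<in> A} \<in> sets lborel"
    by measurable
  have "cball 0 1 \<inter> {x::'a. sgn x \<in> A} = {x. sgn x \<in> A \<and> norm x \<le> 1}"
    by auto
  then show ?thesis
    unfolding sphere_measure_def using *
    by (subst emeasure_distr) (auto simp: emeasure_cball vimage_def)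
qed

lemma emeasure_lborel_scaleR:
  fixes S :: "'a::euclidean_space set"
  assumes [measurable]: "S \<in> sets borel" and t: "t > 0"
  shows "emeasure lborel S = ennreal (t ^ DIM('a)) * emeasure lborel {x. t *\<^sub>R x \<in> S}"
proof -
  have "emeasure lborel S = emeasure (density (distr lborel borel (\<lambda>x::'a. 0 + t *\<^sub>R x)) (\<lambda>_. ennreal (\<bar>t\<bar>^DIM('a)))) S"
    using t by (subst lborel_affine[of t 0]) auto
  also have "\<dots> = ennreal (t ^ DIM('a)) * emeasure lborel {x. t *\<^sub>R x \<in> S}"
    using t by (auto simp: emeasure_density nn_integral_cmult_indicator emeasure_distr vimage_def)
  finally show ?thesis .
qed

text \<open>Radial laws are infinite measures, so the half-lines that are bounded above are used as
generator: they have finite mass because the measures in question live on the non-negative reals.\<close>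

lemma measure_eqI_atMost:
  fixes M N :: "real measure"
  assumes "sets M = sets borel" "sets N = sets borel"
    and eq: "\<And>t. emeasure M {..t} = emeasure N {..t}" and fin: "\<And>t. emeasure M {..t} \<noteq> \<infinity>"
  shows "M = N"
proof (rule measure_eqI_generator_eq[where E="range atMost" and \<Omega>=UNIV and A="\<lambda>n. {..real n}"])
  show "Int_stable (range (atMost :: real \<Rightarrow> _))"
  proof (rule Int_stableI)
    fix a b assume "a \<in> range (atMost :: real \<Rightarrow> _)" "b \<in> range (atMost :: real \<Rightarrow> _)"
    then obtain x y where "a = {..x}" "b = {..y}" by auto
    then have "a \<inter> b = {..min x y}" by auto
    then show "a \<inter> b \<in> range atMost" by blast
  qed
  have "sets (borel :: real measure) = sigma_sets UNIV (range atMost)"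
    by (subst borel_eq_atMost) auto
  then show "sets M = sigma_sets UNIV (range atMost)" "sets N = sigma_sets UNIV (range atMost)"
    using assms by auto
  show "(\<Union>i. {..real i}) = UNIV"
    by (auto intro: real_arch_simple)
qed (use eq fin in auto)

text \<open>A cone is invariant under dilation, so its part in the ball of radius \<open>t\<close> is the
dilate of its part in the unit ball. The factor \<open>max 0 t\<close> also covers \<open>t \<le> 0\<close>, where the set is
contained in the origin.\<close>

lemma polar_box_scaling:
  assumes [measurable]: "A \<in> sets borel"
  shows "emeasure lborel {x::'a::euclidean_space. sgn x \<in> A \<and> norm x \<le> t} =
    ennreal (max 0 t ^ DIM('a)) * emeasure lborel {x::'a. sgn x \<in> A \<and> norm x \<le> 1}"
proof (cases "t > 0")
  case True
  have "{x::'a. t *\<^sub>R x \<in> {x. sgn x \<in> A \<and> norm x \<le> t}} = {x. sgn x \<in> A \<and> norm x \<le> 1}"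
    using True by (auto simp: sgn_scaleR)
  then show ?thesis
    using True by (subst emeasure_lborel_scaleR[OF _ True]) auto
next
  case False
  have "emeasure lborel {x::'a. sgn x \<in> A \<and> norm x \<le> t} \<le> emeasure lborel {0::'a}"
    using False by (intro emeasure_mono) (auto, metis norm_ge_zero norm_eq_zero order_antisym order_trans not_less)
  then show ?thesis
    using False by (auto simp: power_0_left)
qed

lemma emeasure_norm_atMost:
  "emeasure (distr lborel borel (norm :: 'a::euclidean_space \<Rightarrow> real)) {..t} =
    ennreal (unit_ball_vol DIM('a) * max 0 t ^ DIM('a))"
proof -
  have "norm -` {..t} = cball (0::'a) t" by auto
  moreover have "emeasure lborel (cball (0::'a) t) = ennreal (unit_ball_vol DIM('a) * max 0 t ^ DIM('a))"
    by (cases "t \<ge> 0") (auto simp: emeasure_cball max_def)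
  ultimately show ?thesis
    by (subst emeasure_distr) auto
qed

lemma sigma_finite_norm:
  "sigma_finite_measure (distr lborel borel (norm :: 'a::euclidean_space \<Rightarrow> real))"
  apply (rule sigma_finite_measure.intro, rule exI[of _ "range (\<lambda>n. {..real n})"])
  apply (auto simp: emeasure_norm_atMost real_arch_simple)
  done

text \<open>Polar coordinates without a surface measure on the sphere: for a fixed set \<open>A\<close> of directions, the
distribution of the norm over the cone above \<open>A\<close> and the distribution of the norm over the whole
space both scale like \<open>t ^ n\<close>, hence are proportional. So direction and norm are independent.\<close>

theorem polar_decomposition:
  "(sphere_measure :: 'a measure) \<Otimes>\<^sub>M distr (lborel :: 'a measure) borel norm =
     distr (lborel :: 'a::euclidean_space measure) (borel \<Otimes>\<^sub>M borel) (\<lambda>x. (sgn x, norm x))"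
proof (rule pair_measure_eqI)
  show "sigma_finite_measure (sphere_measure :: 'a measure)" by unfold_locales
  show "sigma_finite_measure (distr lborel borel (norm :: 'a \<Rightarrow> real))" by (rule sigma_finite_norm)
  show "sets ((sphere_measure :: 'a measure) \<Otimes>\<^sub>M distr (lborel :: 'a measure) borel norm) =
    sets (distr (lborel :: 'a measure) (borel \<Otimes>\<^sub>M borel) (\<lambda>x. (sgn x, norm x)))"
    by (simp cong: sets_pair_measure_cong)
  fix A B assume "A \<in> sets (sphere_measure :: 'a measure)" "B \<in> sets (distr (lborel :: 'a measure) borel norm)"
  then have [measurable]: "A \<in> sets borel" and B: "B \<in> sets borel" by auto
  let ?c = "emeasure (sphere_measure :: 'a measure) A"
  let ?N = "distr (restrict_space lborel {x::'a. sgn x \<in> A}) borel norm"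
  have N: "emeasure ?N S = emeasure lborel {x::'a. sgn x \<in> A \<and> norm x \<in> S}" if [measurable]: "S \<in> sets borel" for S
  proof -
    have "norm -` S \<inter> space (restrict_space lborel {x::'a. sgn x \<in> A}) = {x::'a. sgn x \<in> A \<and> norm x \<in> S}"
      by (auto simp: space_restrict_space)
    then show ?thesis
      by (subst emeasure_distr) (auto intro!: emeasure_restrict_space measurable_restrict_space1)
  qed
  have "scale_measure ?c (distr lborel borel (norm :: 'a \<Rightarrow> real)) = ?N"
  proof (rule measure_eqI_atMost)
    fix t
    have v: "unit_ball_vol DIM('a) > 0" by simp
    have fin: "emeasure lborel {x::'a. sgn x \<in> A \<and> norm x \<le> 1} < \<infinity>"
    proof -
      have "emeasure lborel {x::'a. sgn x \<in> A \<and> norm x \<le> 1} \<le> emeasure lborel (cball (0::'a) 1)"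
        by (intro emeasure_mono) auto
      then show ?thesis by (auto simp: emeasure_cball intro: le_less_trans)
    qed
    obtain w where w: "emeasure lborel {x::'a. sgn x \<in> A \<and> norm x \<le> 1} = ennreal w" "w \<ge> 0"
      using fin by (cases "emeasure lborel {x::'a. sgn x \<in> A \<and> norm x \<le> 1}") auto
    show "emeasure (scale_measure ?c (distr lborel borel (norm :: 'a \<Rightarrow> real))) {..t} = emeasure ?N {..t}"
      using v w(2)
      by (auto simp: N emeasure_norm_atMost polar_box_scaling[of A t] emeasure_sphere_measure w
            divide_ennreal ennreal_mult'[symmetric])
    show "emeasure (scale_measure ?c (distr lborel borel (norm :: 'a \<Rightarrow> real))) {..t} \<noteq> \<infinity>"
      using v w(2) by (auto simp: emeasure_norm_atMost emeasure_sphere_measure w divide_ennreal ennreal_mult'[symmetric])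
  qed auto
  then have "?c * emeasure (distr lborel borel (norm :: 'a \<Rightarrow> real)) B = emeasure ?N B"
    using B by (metis emeasure_scale_measure)
  also have "\<dots> = emeasure (distr (lborel :: 'a measure) (borel \<Otimes>\<^sub>M borel) (\<lambda>x. (sgn x, norm x))) (A \<times> B)"
    using B by (subst emeasure_distr) (auto simp: N vimage_def)
  finally show "?c * emeasure (distr lborel borel (norm :: 'a \<Rightarrow> real)) B =
    emeasure (distr (lborel :: 'a measure) (borel \<Otimes>\<^sub>M borel) (\<lambda>x. (sgn x, norm x))) (A \<times> B)" .
qed

theorem norm_density:
  "distr lborel borel (norm :: 'a::euclidean_space \<Rightarrow> real) =
   density lborel (\<lambda>r. ennreal (DIM('a) * unit_ball_vol DIM('a) * r ^ (DIM('a) - 1) * indicator {0..} r))"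
    (is "_ = density lborel ?g")
proof (rule measure_eqI_atMost)
  fix t
  let ?n = "DIM('a)" let ?v = "unit_ball_vol DIM('a)"
  have "emeasure (density lborel ?g) {..t} = (\<integral>\<^sup>+r. ennreal (?n * ?v * r ^ (?n - 1)) * indicator {0..max 0 t} r \<partial>lborel)"
  proof -
    have "AE r in lborel. ?g r * indicator {..t} r = ennreal (?n * ?v * r ^ (?n - 1)) * indicator {0..max 0 t} r"
      using AE_lborel_singleton[of 0] by eventually_elim (auto split: split_indicator)
    then show ?thesis
      by (subst emeasure_density) (auto intro!: nn_integral_cong_AE)
  qed
  also have "\<dots> = ennreal (?v * max 0 t ^ ?n - ?v * 0 ^ ?n)"
    by (rule nn_integral_FTC_Icc) (auto intro!: derivative_eq_intros)
  finally show "emeasure (distr lborel borel (norm :: 'a \<Rightarrow> real)) {..t} = emeasure (density lborel ?g) {..t}"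
    by (simp add: emeasure_norm_atMost power_0_left)
qed (auto simp: emeasure_norm_atMost)

text \<open>The image of Lebesgue measure under the norm, indexed by the type that fixes the dimension.\<close>

abbreviation norm_law :: "'a::euclidean_space itself \<Rightarrow> real measure" where
  "norm_law _ \<equiv> distr (lborel :: 'a measure) borel norm"

lemma polar_lborel:
  "(lborel :: 'a::euclidean_space measure) =
     distr (sphere_measure \<Otimes>\<^sub>M norm_law TYPE('a)) borel (\<lambda>(\<omega>, r). r *\<^sub>R \<omega>)"
  unfolding polar_decomposition
proof (subst distr_distr)
  have *: "(\<lambda>(\<omega>, r). r *\<^sub>R \<omega>) \<circ> (\<lambda>x::'a. (sgn x, norm x)) = (\<lambda>x. x)"
  proof (intro ext)
    fix x :: 'a
    show "((\<lambda>(\<omega>, r). r *\<^sub>R \<omega>) \<circ> (\<lambda>x::'a. (sgn x, norm x))) x = x"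
      by (cases "x = 0") (auto simp: sgn_div_norm)
  qed
  show "lborel = distr lborel borel ((\<lambda>(\<omega>, r). r *\<^sub>R \<omega>) \<circ> (\<lambda>x::'a. (sgn x, norm x)))"
    unfolding * by (rule distr_id2[symmetric]) simp
qed measurable

lemma pair_sigma_finite_polar: "pair_sigma_finite (sphere_measure :: 'a measure) (norm_law TYPE('a::euclidean_space))"
  by (intro pair_sigma_finite.intro sigma_finite_norm) unfold_locales

lemma integrable_polar:
  fixes f :: "'a::euclidean_space \<Rightarrow> 'b::{banach, second_countable_topology}"
  assumes [measurable]: "f \<in> borel_measurable borel"
  shows "integrable lborel f \<longleftrightarrow>
    integrable (sphere_measure \<Otimes>\<^sub>M norm_law TYPE('a)) (\<lambda>(\<omega>, r). f (r *\<^sub>R \<omega>))"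
  by (subst polar_lborel, subst integrable_distr_eq) (auto simp: case_prod_beta')

lemma integral_polar:
  fixes f :: "'a::euclidean_space \<Rightarrow> 'b::{banach, second_countable_topology}"
  assumes [measurable]: "f \<in> borel_measurable borel"
  shows "integral\<^sup>L lborel f =
    integral\<^sup>L (sphere_measure \<Otimes>\<^sub>M norm_law TYPE('a)) (\<lambda>(\<omega>, r). f (r *\<^sub>R \<omega>))"
  by (subst (1) polar_lborel, subst integral_distr) (auto simp: case_prod_beta')

lemma spherical_mean_integrable:
  fixes f :: "'a::euclidean_space \<Rightarrow> 'b::{banach, second_countable_topology}"
  assumes "integrable lborel f"
  shows "integrable lborel (\<lambda>x::'a. \<integral>\<omega>. f (norm x *\<^sub>R \<omega>) \<partial>sphere_measure)"
    and "integral\<^sup>L lborel (\<lambda>x::'a. \<integral>\<omega>. f (norm x *\<^sub>R \<omega>) \<partial>sphere_measure) = integral\<^sup>L lborel f"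
    and "AE x::'a in lborel. integrable sphere_measure (\<lambda>\<omega>. f (norm x *\<^sub>R \<omega>))"
proof -
  interpret pair_sigma_finite "sphere_measure :: 'a measure" "norm_law TYPE('a)"
    by (rule pair_sigma_finite_polar)
  have [measurable]: "f \<in> borel_measurable borel"
    using assms borel_measurable_integrable by fastforce
  have int: "integrable (sphere_measure \<Otimes>\<^sub>M norm_law TYPE('a)) (\<lambda>(\<omega>, r). f (r *\<^sub>R \<omega>))"
    using assms integrable_polar[of f] by simp
  show "integrable lborel (\<lambda>x::'a. \<integral>\<omega>. f (norm x *\<^sub>R \<omega>) \<partial>sphere_measure)"
    using integrable_snd[OF int] by (subst (asm) integrable_distr_eq) auto
  show "integral\<^sup>L lborel (\<lambda>x::'a. \<integral>\<omega>. f (norm x *\<^sub>R \<omega>) \<partial>sphere_measure) = integral\<^sup>L lborel f"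
    using integral_snd[OF int] by (subst (asm) integral_distr) (auto simp: integral_polar[of f])
  show "AE x::'a in lborel. integrable sphere_measure (\<lambda>\<omega>. f (norm x *\<^sub>R \<omega>))"
    using AE_integrable_snd[OF int] by (rule AE_distrD[rotated]) simp
qed

text \<open>Integrals of products of an angular and a radial part. The factorisation is demanded only for
unit vectors and positive radii, so that homogeneous functions qualify.\<close>

lemma polar_product:
  fixes A :: "'a::euclidean_space \<Rightarrow> 'b::{real_normed_field, banach, second_countable_topology}"
  assumes A: "integrable sphere_measure A" and [measurable]: "B \<in> borel_measurable borel"
    and B: "integrable lborel (\<lambda>x::'a. B (norm x))"
    and f[measurable]: "f \<in> borel_measurable borel" and eq: "\<And>\<omega> r. r > 0 \<Longrightarrow> norm \<omega> = 1 \<Longrightarrow> f (r *\<^sub>R \<omega>) = A \<omega> * B r"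
  shows "integrable lborel f"
    and "integral\<^sup>L lborel f = integral\<^sup>L sphere_measure A * integral\<^sup>L lborel (\<lambda>x::'a. B (norm x))"
proof -
  interpret pair_sigma_finite "sphere_measure :: 'a measure" "norm_law TYPE('a)"
    by (rule pair_sigma_finite_polar)
  have [measurable]: "A \<in> borel_measurable borel"
    using borel_measurable_integrable[OF A] by simp
  have B': "integrable (norm_law TYPE('a)) B"
    using B by (subst integrable_distr_eq) auto
  have int: "integrable (sphere_measure \<Otimes>\<^sub>M norm_law TYPE('a)) (\<lambda>(\<omega>, r). A \<omega> * B r)"
    by (rule Fubini_integrable) (use A B' in \<open>auto simp: norm_mult\<close>)
  have ae: "AE x in lborel. f x = A (sgn x) * B (norm x)"
    using AE_lborel_singleton[of 0]
  proof eventually_elim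
    case (elim x)
    have "x = norm x *\<^sub>R sgn x" using elim by (simp add: sgn_div_norm)
    then show ?case using eq[of "norm x" "sgn x"] elim by (simp add: norm_sgn)
  qed
  have m[measurable]: "(\<lambda>x::'a. (sgn x, norm x)) \<in> lborel \<rightarrow>\<^sub>M (borel \<Otimes>\<^sub>M borel)"
    "(\<lambda>(\<omega>, r). A \<omega> * B r) \<in> borel_measurable (borel \<Otimes>\<^sub>M borel)"
    by measurable
  have "integrable lborel (\<lambda>x::'a. (\<lambda>(\<omega>, r). A \<omega> * B r) (sgn x, norm x))"
    using int unfolding polar_decomposition by (subst (asm) integrable_distr_eq[OF m])
  then show "integrable lborel f"
    by (subst integrable_cong_AE[OF _ _ ae]) auto
  have "integral\<^sup>L lborel f = integral\<^sup>L lborel (\<lambda>x::'a. (\<lambda>(\<omega>, r). A \<omega> * B r) (sgn x, norm x))"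
    by (subst integral_cong_AE[OF _ _ ae]) auto
  also have "\<dots> = (\<integral>\<omega>. (\<integral>r. A \<omega> * B r \<partial>norm_law TYPE('a)) \<partial>sphere_measure)"
    by (subst integral_distr[OF m, symmetric], fold polar_decomposition, subst integral_fst'[OF int, symmetric]) simp
  also have "\<dots> = integral\<^sup>L sphere_measure A * integral\<^sup>L lborel (\<lambda>x::'a. B (norm x))"
    by (subst integral_distr) auto
  finally show "integral\<^sup>L lborel f = integral\<^sup>L sphere_measure A * integral\<^sup>L lborel (\<lambda>x::'a. B (norm x))" .
qed

text \<open>The quotient of the surface areas of the unit spheres in dimensions \<open>n\<close> and \<open>m\<close>.\<close>

definition dim_ratio :: "nat \<Rightarrow> nat \<Rightarrow> real" where
  "dim_ratio n m = (n * unit_ball_vol n) / (m * unit_ball_vol m)"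

lemma dim_ratio_pos: "n > 0 \<Longrightarrow> m > 0 \<Longrightarrow> dim_ratio n m > 0"
  by (simp add: dim_ratio_def)

text \<open>The radial density in dimension \<open>n\<close> is a multiple of \<open>r ^ (n - 1)\<close>, so a weight
\<open>r ^ (2 * l)\<close> has the same effect as \<open>2 * l\<close> additional dimensions. This is the elementary half of the
dimension shift; the other half is the Funk-Hecke formula.\<close>

lemma norm_law_shift:
  assumes "DIM('m::euclidean_space) = DIM('n::euclidean_space) + 2 * l"
  shows "density (norm_law TYPE('n)) (\<lambda>r. ennreal (r ^ (2 * l))) =
    density (norm_law TYPE('m)) (\<lambda>r. ennreal (dim_ratio DIM('n) DIM('m)))"
proof -
  let ?g = "\<lambda>n r. ennreal (real n * unit_ball_vol (real n) * r ^ (n - 1) * indicator {0..} r)"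
  have "?g DIM('n) r * ennreal (r ^ (2 * l)) = ?g DIM('m) r * ennreal (dim_ratio DIM('n) DIM('m))" for r
  proof (cases "r \<ge> 0")
    case True
    have "DIM('n) - 1 + 2 * l = DIM('m) - 1"
      using assms DIM_positive[where 'a='n] by linarith
    then show ?thesis
      using True by (auto simp: ennreal_mult'[symmetric] dim_ratio_def simp flip: power_add)
  qed auto
  then show ?thesis
    unfolding norm_density by (subst (1 2) density_density_eq) auto
qed

lemma radial_shift:
  fixes \<phi> :: "real \<Rightarrow> 'b::{banach, second_countable_topology}"
  assumes "DIM('m::euclidean_space) = DIM('n::euclidean_space) + 2 * l"
    and [measurable]: "\<phi> \<in> borel_measurable borel"
  shows "integrable lborel (\<lambda>x::'n. norm x ^ (2 * l) *\<^sub>R \<phi> (norm x)) \<longleftrightarrow> integrable lborel (\<lambda>y::'m. \<phi> (norm y))"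
    and "integral\<^sup>L lborel (\<lambda>x::'n. norm x ^ (2 * l) *\<^sub>R \<phi> (norm x)) =
      dim_ratio DIM('n) DIM('m) *\<^sub>R (integral\<^sup>L lborel (\<lambda>y::'m. \<phi> (norm y)))"
proof -
  let ?\<kappa> = "dim_ratio DIM('n) DIM('m)"
  have k: "?\<kappa> > 0" by (simp add: dim_ratio_pos)
  have "integrable lborel (\<lambda>x::'n. norm x ^ (2 * l) *\<^sub>R \<phi> (norm x)) \<longleftrightarrow>
    integrable (density (norm_law TYPE('n)) (\<lambda>r. ennreal (r ^ (2 * l)))) \<phi>"
    by (subst integrable_density) (auto simp: integrable_distr_eq)
  also have "\<dots> \<longleftrightarrow> integrable lborel (\<lambda>y::'m. ?\<kappa> *\<^sub>R \<phi> (norm y))"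
    unfolding norm_law_shift[OF assms(1)] using k
    by (subst integrable_density) (auto simp: integrable_distr_eq)
  also have "\<dots> \<longleftrightarrow> integrable lborel (\<lambda>y::'m. \<phi> (norm y))"
  proof
    assume "integrable lborel (\<lambda>y::'m. ?\<kappa> *\<^sub>R \<phi> (norm y))"
    then have "integrable lborel (\<lambda>y::'m. (1 / ?\<kappa>) *\<^sub>R ?\<kappa> *\<^sub>R \<phi> (norm y))" by (rule integrable_scaleR_right)
    then show "integrable lborel (\<lambda>y::'m. \<phi> (norm y))" using k by simp
  qed (rule integrable_scaleR_right)
  finally show "integrable lborel (\<lambda>x::'n. norm x ^ (2 * l) *\<^sub>R \<phi> (norm x)) \<longleftrightarrow> integrable lborel (\<lambda>y::'m. \<phi> (norm y))" .
  have "integral\<^sup>L lborel (\<lambda>x::'n. norm x ^ (2 * l) *\<^sub>R \<phi> (norm x)) =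
    integral\<^sup>L (density (norm_law TYPE('n)) (\<lambda>r. ennreal (r ^ (2 * l)))) \<phi>"
    by (subst integral_density) (auto simp: integral_distr)
  also have "\<dots> = ?\<kappa> *\<^sub>R (integral\<^sup>L lborel (\<lambda>y::'m. \<phi> (norm y)))"
    unfolding norm_law_shift[OF assms(1)] using k
    by (subst integral_density) (auto simp: integral_distr)
  finally show "integral\<^sup>L lborel (\<lambda>x::'n. norm x ^ (2 * l) *\<^sub>R \<phi> (norm x)) = ?\<kappa> *\<^sub>R (integral\<^sup>L lborel (\<lambda>y::'m. \<phi> (norm y)))" .
qed

text \<open>The null sets of radii do not depend on the dimension, so exceptional sets of radii can be
carried from one space to another.\<close>

lemma AE_norm_law_iff:
  assumes "{r. R r} \<in> sets borel"
  shows "(AE r in norm_law TYPE('n::euclidean_space). R r) \<longleftrightarrow> (AE r in lborel. r > 0 \<longrightarrow> R r)"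
proof -
  have [measurable]: "Measurable.pred borel R" using assms by (simp add: pred_def)
  have "(AE r in norm_law TYPE('n). R r) \<longleftrightarrow>
    (AE r in lborel. real DIM('n) * unit_ball_vol (real DIM('n)) * r ^ (DIM('n) - 1) * indicator {0..} r > 0 \<longrightarrow> R r)"
    unfolding norm_density by (subst AE_density) auto
  also have "\<dots> \<longleftrightarrow> (AE r in lborel. r > 0 \<longrightarrow> R r)"
  proof -
    have *: "AE r in lborel. r \<noteq> (0::real)" by (rule AE_lborel_singleton)
    show ?thesis
    proof
      assume "AE r in lborel. real DIM('n) * unit_ball_vol (real DIM('n)) * r ^ (DIM('n) - 1) * indicator {0..} r > 0 \<longrightarrow> R r"
      then show "AE r in lborel. r > 0 \<longrightarrow> R r"
        by eventually_elim auto
    next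
      assume "AE r in lborel. r > 0 \<longrightarrow> R r"
      with * show "AE r in lborel. real DIM('n) * unit_ball_vol (real DIM('n)) * r ^ (DIM('n) - 1) * indicator {0..} r > 0 \<longrightarrow> R r"
        by eventually_elim (auto split: split_indicator_asm)
    qed
  qed
  finally show ?thesis .
qed

lemma AE_norm_transfer:
  assumes R: "{r. R r} \<in> sets borel" and AE: "AE y in lborel. R (norm (y::'m::euclidean_space))"
  shows "AE x in lborel. R (norm (x::'n::euclidean_space))"
proof -
  have [measurable]: "Measurable.pred borel R" using R by (simp add: pred_def)
  have "AE r in norm_law TYPE('m). R r"
    using AE by (subst AE_distr_iff) auto
  then have "AE r in norm_law TYPE('n). R r"
    using R by (simp add: AE_norm_law_iff)
  then show ?thesis
    by (subst (asm) AE_distr_iff) auto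
qed

section \<open>Gaussian averages of harmonic polynomials\<close>

lemma real_polynomial_gradient:
  fixes p :: "'a::euclidean_space \<Rightarrow> real"
  assumes "real_polynomial_function p"
  obtains q where "\<And>b. real_polynomial_function (q b)"
    and "\<And>x. (p has_derivative (\<lambda>h. \<Sum>b\<in>Basis. (h \<bullet> b) * q b x)) (at x)"
proof -
  have "\<exists>q. (\<forall>b. real_polynomial_function (q b)) \<and>
      (\<forall>x. (p has_derivative (\<lambda>h. \<Sum>b\<in>Basis. (h \<bullet> b) * q b x)) (at x))"
    using assms
  proof induction
    case (linear f)
    have "f h = (\<Sum>b\<in>Basis. (h \<bullet> b) * f b)" for h
    proof -
      interpret bounded_linear f by fact
      have "f h = f (\<Sum>b\<in>Basis. (h \<bullet> b) *\<^sub>R b)" by (simp add: euclidean_representation)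
      then show ?thesis by (simp add: sum scale)
    qed
    then have "f = (\<lambda>h. \<Sum>b\<in>Basis. (h \<bullet> b) * f b)" by blast
    then show ?case
      using bounded_linear_imp_has_derivative[OF linear] by (intro exI[of _ "\<lambda>b x. f b"]) auto
  next
    case (const c)
    show ?case by (rule exI[of _ "\<lambda>b x. 0"]) auto
  next
    case (add f g)
    then obtain qf qg where q: "\<And>b. real_polynomial_function (qf b)" "\<And>b. real_polynomial_function (qg b)"
      "\<And>x. (f has_derivative (\<lambda>h. \<Sum>b\<in>Basis. (h \<bullet> b) * qf b x)) (at x)"
      "\<And>x. (g has_derivative (\<lambda>h. \<Sum>b\<in>Basis. (h \<bullet> b) * qg b x)) (at x)" by blast
    have eq: "(\<Sum>b\<in>Basis. (h \<bullet> b) * (qf b x + qg b x)) =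
      (\<Sum>b\<in>Basis. (h \<bullet> b) * qf b x) + (\<Sum>b\<in>Basis. (h \<bullet> b) * qg b x)" for h x :: 'a
      by (simp add: sum.distrib algebra_simps)
    show ?case
      by (rule exI[of _ "\<lambda>b x. qf b x + qg b x"]) (auto simp: eq intro!: q has_derivative_add)
  next
    case (mult f g)
    then obtain qf qg where q: "\<And>b. real_polynomial_function (qf b)" "\<And>b. real_polynomial_function (qg b)"
      "\<And>x. (f has_derivative (\<lambda>h. \<Sum>b\<in>Basis. (h \<bullet> b) * qf b x)) (at x)"
      "\<And>x. (g has_derivative (\<lambda>h. \<Sum>b\<in>Basis. (h \<bullet> b) * qg b x)) (at x)" by blast
    have eq: "(\<Sum>b\<in>Basis. (h \<bullet> b) * (f x * qg b x + qf b x * g x)) =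
      f x * (\<Sum>b\<in>Basis. (h \<bullet> b) * qg b x) + (\<Sum>b\<in>Basis. (h \<bullet> b) * qf b x) * g x" for h x :: 'a
      by (simp add: sum.distrib sum_distrib_left sum_distrib_right algebra_simps)
    show ?case
      by (rule exI[of _ "\<lambda>b x. f x * qg b x + qf b x * g x"])
         (auto simp: eq intro!: q has_derivative_mult real_polynomial_function.intros(3,4) mult.hyps)
  qed
  then show ?thesis using that by blast
qed

lemma real_polynomial_measurable:
  fixes p :: "'a::euclidean_space \<Rightarrow> real"
  assumes "real_polynomial_function p"
  shows "p \<in> borel_measurable borel"
  using continuous_on_polymonial_function[of p UNIV] assms
  by (auto simp: real_polynomial_function_eq intro!: borel_measurable_continuous_onI)

text \<open>A growth class that contains the polynomials, is closed under sums, products and affine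
substitution, and consists of functions that are integrable against every Gaussian.\<close>

definition exp_bounded :: "('a::euclidean_space \<Rightarrow> real) \<Rightarrow> bool" where
  "exp_bounded f \<longleftrightarrow> f \<in> borel_measurable borel \<and> (\<exists>C\<ge>0. \<exists>k\<ge>0. \<forall>x. \<bar>f x\<bar> \<le> C * exp (k * norm x))"

lemma exp_boundedI:
  assumes "f \<in> borel_measurable borel" "C \<ge> 0" "k \<ge> 0" "\<And>x. \<bar>f x\<bar> \<le> C * exp (k * norm x)"
  shows "exp_bounded f"
  using assms by (auto simp: exp_bounded_def)

lemma exp_boundedE:
  assumes "exp_bounded f"
  obtains C k where "C \<ge> 0" "k \<ge> 0" "\<And>x. \<bar>f x\<bar> \<le> C * exp (k * norm x)"
  using assms by (auto simp: exp_bounded_def)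

lemma exp_bounded_measurable [measurable_dest]: "exp_bounded f \<Longrightarrow> f \<in> borel_measurable borel"
  by (simp add: exp_bounded_def)

lemma exp_bounded_const: "exp_bounded (\<lambda>x. c)"
  by (rule exp_boundedI[of _ "\<bar>c\<bar>" 0]) auto

lemma exp_bounded_norm: "exp_bounded (\<lambda>x. norm x)"
  by (rule exp_boundedI[of _ 1 1]) (auto intro: order_trans[OF _ exp_ge_add_one_self])

lemma exp_bounded_mono:
  assumes "exp_bounded g" "f \<in> borel_measurable borel" "\<And>x. \<bar>f x\<bar> \<le> \<bar>g x\<bar>"
  shows "exp_bounded f"
proof -
  obtain C k where *: "C \<ge> 0" "k \<ge> 0" "\<And>x. \<bar>g x\<bar> \<le> C * exp (k * norm x)"
    using exp_boundedE[OF assms(1)] by blast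
  show ?thesis
    by (rule exp_boundedI[OF assms(2) *(1,2)]) (rule order_trans[OF assms(3) *(3)])
qed

lemma exp_bounded_add:
  assumes "exp_bounded f" "exp_bounded g" shows "exp_bounded (\<lambda>x. f x + g x)"
proof -
  obtain C k where 1: "C \<ge> 0" "k \<ge> 0" "\<And>x. \<bar>f x\<bar> \<le> C * exp (k * norm x)"
    using exp_boundedE[OF assms(1)] by blast
  obtain D l where 2: "D \<ge> 0" "l \<ge> 0" "\<And>x. \<bar>g x\<bar> \<le> D * exp (l * norm x)"
    using exp_boundedE[OF assms(2)] by blast
  have "\<bar>f x + g x\<bar> \<le> (C + D) * exp ((k + l) * norm x)" for x
  proof -
    have "\<bar>f x + g x\<bar> \<le> C * exp (k * norm x) + D * exp (l * norm x)" using 1(3)[of x] 2(3)[of x] by linarith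
    also have "\<dots> \<le> C * exp ((k + l) * norm x) + D * exp ((k + l) * norm x)"
      using 1 2 by (intro add_mono mult_left_mono) (auto intro!: mult_right_mono)
    finally show ?thesis by (simp add: algebra_simps)
  qed
  then show ?thesis using 1 2 assms by (intro exp_boundedI[of _ "C + D" "k + l"]) auto
qed

lemma exp_bounded_mult:
  assumes "exp_bounded f" "exp_bounded g" shows "exp_bounded (\<lambda>x. f x * g x)"
proof -
  obtain C k where 1: "C \<ge> 0" "k \<ge> 0" "\<And>x. \<bar>f x\<bar> \<le> C * exp (k * norm x)"
    using exp_boundedE[OF assms(1)] by blast
  obtain D l where 2: "D \<ge> 0" "l \<ge> 0" "\<And>x. \<bar>g x\<bar> \<le> D * exp (l * norm x)"
    using exp_boundedE[OF assms(2)] by blast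
  have "\<bar>f x * g x\<bar> \<le> (C * D) * exp ((k + l) * norm x)" for x
    using mult_mono[OF 1(3)[of x] 2(3)[of x]] 1(1)
    by (simp add: abs_mult exp_add algebra_simps)
  then show ?thesis using 1 2 assms by (intro exp_boundedI[of _ "C * D" "k + l"]) auto
qed

lemma exp_bounded_sum:
  "(\<And>i. i \<in> I \<Longrightarrow> exp_bounded (f i)) \<Longrightarrow> exp_bounded (\<lambda>x. \<Sum>i\<in>I. f i x)"
  by (induction I rule: infinite_finite_induct) (auto intro: exp_bounded_const exp_bounded_add)

lemma exp_bounded_abs:
  assumes "exp_bounded f" shows "exp_bounded (\<lambda>x. \<bar>f x\<bar>)"
proof -
  have [measurable]: "f \<in> borel_measurable borel" using assms by (rule exp_bounded_measurable)
  show ?thesis by (rule exp_bounded_mono[OF assms]) auto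
qed

lemma exp_bounded_power: "exp_bounded f \<Longrightarrow> exp_bounded (\<lambda>x. f x ^ n)"
  by (induction n) (auto intro: exp_bounded_const exp_bounded_mult)

lemma exp_bounded_inner: "exp_bounded (\<lambda>x. x \<bullet> b)"
proof (rule exp_bounded_mono)
  show "exp_bounded (\<lambda>x. norm b * norm x)"
    by (intro exp_bounded_mult exp_bounded_const exp_bounded_norm)
  show "\<bar>x \<bullet> b\<bar> \<le> \<bar>norm b * norm x\<bar>" for x
    using Cauchy_Schwarz_ineq2[of x b] by (simp add: mult.commute)
qed auto

lemma exp_bounded_exp_norm: "exp_bounded (\<lambda>x. exp (c * norm x))"
  by (rule exp_boundedI[of _ 1 "\<bar>c\<bar>"]) (auto intro!: mult_right_mono)

lemma exp_bounded_affine: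
  assumes "exp_bounded f" shows "exp_bounded (\<lambda>x. f (a + t *\<^sub>R x))"
proof -
  obtain C k where 1: "C \<ge> 0" "k \<ge> 0" "\<And>x. \<bar>f x\<bar> \<le> C * exp (k * norm x)"
    using exp_boundedE[OF assms(1)] by blast
  have "\<bar>f (a + t *\<^sub>R x)\<bar> \<le> (C * exp (k * norm a)) * exp ((k * \<bar>t\<bar>) * norm x)" for x
  proof -
    have "\<bar>f (a + t *\<^sub>R x)\<bar> \<le> C * exp (k * norm (a + t *\<^sub>R x))" by (rule 1)
    also have "\<dots> \<le> C * exp (k * (norm a + \<bar>t\<bar> * norm x))"
      using 1 norm_triangle_ineq[of a "t *\<^sub>R x"] by (auto intro!: mult_left_mono)
    finally show ?thesis by (simp add: exp_add algebra_simps)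
  qed
  moreover have "(\<lambda>x. f (a + t *\<^sub>R x)) \<in> borel_measurable borel"
    using exp_bounded_measurable[OF assms] by measurable
  ultimately show ?thesis using 1
    by (intro exp_boundedI[of _ "C * exp (k * norm a)" "k * \<bar>t\<bar>"]) auto
qed

lemma exp_bounded_real_polynomial:
  fixes p :: "'a::euclidean_space \<Rightarrow> real"
  assumes "real_polynomial_function p"
  shows "exp_bounded p"
  using assms
proof induction
  case (linear f)
  then obtain K where K: "\<And>x. norm (f x) \<le> norm x * K" using bounded_linear.bounded by blast
  show ?case
  proof (rule exp_bounded_mono)
    show "exp_bounded (\<lambda>x. K * norm x)" by (intro exp_bounded_mult exp_bounded_const exp_bounded_norm)
    show "\<bar>f x\<bar> \<le> \<bar>K * norm x\<bar>" for x using K[of x] by (simp add: mult.commute)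
    show "f \<in> borel_measurable borel" using linear by (intro borel_measurable_continuous_onI linear_continuous_on)
  qed
qed (auto intro: exp_bounded_const exp_bounded_mult exp_bounded_add)

text \<open>The scaling with \<open>pi\<close> makes the total mass equal to 1 in every dimension, so that no
dimensional constants appear in the moment computations.\<close>

definition gaussian :: "'a::euclidean_space \<Rightarrow> real" where
  "gaussian x = exp (- pi * (norm x)\<^sup>2)"

lemma gaussian_measurable [measurable]: "gaussian \<in> borel_measurable borel"
  unfolding gaussian_def[abs_def] by measurable

lemma gaussian_pos [simp]: "gaussian x > 0" by (simp add: gaussian_def)

lemma nn_integral_gaussian_real:
  assumes t: "t > 0"
  shows "(\<integral>\<^sup>+(x::real). ennreal (exp (- pi * t * x\<^sup>2)) \<partial>lborel) = ennreal (1 / sqrt t)"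
proof -
  define \<sigma> where "\<sigma> = 1 / sqrt (2 * pi * t)"
  have s: "\<sigma> > 0" "2 * pi * \<sigma>\<^sup>2 = 1 / t" "2 * \<sigma>\<^sup>2 = 1 / (pi * t)" using t by (auto simp: \<sigma>_def power_divide)
  interpret prob_space "density lborel (normal_density 0 \<sigma>)" using s(1) by (rule prob_space_normal_density)
  have "ennreal (exp (- pi * t * x\<^sup>2)) = ennreal (1 / sqrt t) * ennreal (normal_density 0 \<sigma> x)" for x
    using t unfolding normal_density_def s by (simp add: ennreal_mult'[symmetric] real_sqrt_divide divide_simps mult_ac)
  then have "(\<integral>\<^sup>+(x::real). ennreal (exp (- pi * t * x\<^sup>2)) \<partial>lborel) =
     ennreal (1 / sqrt t) * (\<integral>\<^sup>+x. ennreal (normal_density 0 \<sigma> x) \<partial>lborel)"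
    by (simp add: nn_integral_cmult)
  also have "(\<integral>\<^sup>+x. ennreal (normal_density 0 \<sigma> x) \<partial>lborel) = 1"
    using emeasure_space_1 by (simp add: emeasure_density)
  finally show ?thesis by simp
qed

lemma nn_integral_gaussian:
  assumes t: "t > 0"
  shows "(\<integral>\<^sup>+(x::'a::euclidean_space). ennreal (exp (- pi * t * (norm x)\<^sup>2)) \<partial>lborel) = ennreal (1 / sqrt t ^ DIM('a))"
proof -
  have "ennreal (exp (- pi * t * (norm x)\<^sup>2)) = (\<Prod>b\<in>Basis. ennreal (exp (- pi * t * (x \<bullet> b)\<^sup>2)))" for x :: 'a
  proof -
    have "(norm x)\<^sup>2 = (\<Sum>b\<in>Basis. (x \<bullet> b)\<^sup>2)"
      unfolding power2_norm_eq_inner by (subst euclidean_inner) (simp add: power2_eq_square)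
    then have "exp (- pi * t * (norm x)\<^sup>2) = (\<Prod>b\<in>Basis. exp (- pi * t * (x \<bullet> b)\<^sup>2))"
      by (simp add: exp_sum[symmetric] sum_distrib_left sum_negf)
    then show ?thesis by (simp add: prod_ennreal)
  qed
  then have "(\<integral>\<^sup>+(x::'a). ennreal (exp (- pi * t * (norm x)\<^sup>2)) \<partial>lborel) =
    (\<Prod>b\<in>(Basis::'a set). (\<integral>\<^sup>+x. ennreal (exp (- pi * t * x\<^sup>2)) \<partial>lborel))"
    by (simp only:) (subst nn_integral_lborel_prod, auto)
  also have "\<dots> = ennreal (1 / sqrt t ^ DIM('a))"
    using t by (simp only: nn_integral_gaussian_real[OF t] prod_constant) (simp add: ennreal_power power_divide)
  finally show ?thesis .
qed

lemma integral_gaussian: "integral\<^sup>L lborel (gaussian :: 'a::euclidean_space \<Rightarrow> real) = 1"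
  using nn_integral_gaussian[of 1, where 'a='a]
  by (subst integral_eq_nn_integral) (auto simp: gaussian_def)

lemma exp_bounded_times_gaussian_integrable:
  fixes f :: "'a::euclidean_space \<Rightarrow> real"
  assumes "exp_bounded f"
  shows "integrable lborel (\<lambda>x. f x * gaussian x)"
proof -
  have [measurable]: "f \<in> borel_measurable borel" using assms by (rule exp_bounded_measurable)
  obtain C k where 1: "C \<ge> 0" "k \<ge> 0" "\<And>x. \<bar>f x\<bar> \<le> C * exp (k * norm x)"
    using exp_boundedE[OF assms(1)] by blast
  have int: "integrable lborel (\<lambda>x::'a. exp (- pi * (1/2) * (norm x)\<^sup>2))"
    using nn_integral_gaussian[of "1/2", where 'a='a] by (subst integrable_iff_bounded) auto
  show ?thesis
  proof (rule Bochner_Integration.integrable_bound)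
    show "integrable lborel (\<lambda>x::'a. C * exp (k\<^sup>2 / (2 * pi)) * exp (- pi * (1/2) * (norm x)\<^sup>2))"
      by (intro integrable_mult_right int)
    show "AE x in lborel. norm (f x * gaussian x) \<le> norm (C * exp (k\<^sup>2 / (2 * pi)) * exp (- pi * (1/2) * (norm x)\<^sup>2))"
    proof (rule AE_I2)
      fix x :: 'a
      \<comment> \<open>Completing the square: half of the Gaussian decay absorbs the exponential growth.\<close>
      have "0 \<le> (k - pi * norm x)\<^sup>2 / (2 * pi)" by simp
      also have "\<dots> = k\<^sup>2 / (2 * pi) + pi * (1/2) * (norm x)\<^sup>2 - k * norm x"
        by (simp add: power2_eq_square field_simps)
      finally have "k * norm x - pi * (norm x)\<^sup>2 \<le> k\<^sup>2 / (2 * pi) - pi * (1/2) * (norm x)\<^sup>2"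
        by simp
      then have "exp (k * norm x) * gaussian x \<le> exp (k\<^sup>2 / (2 * pi)) * exp (- pi * (1/2) * (norm x)\<^sup>2)"
        unfolding gaussian_def exp_add[symmetric] by simp
      then have **: "C * (exp (k * norm x) * gaussian x) \<le> C * (exp (k\<^sup>2 / (2 * pi)) * exp (- pi * (1/2) * (norm x)\<^sup>2))"
        using 1 by (intro mult_left_mono)
      have "norm (f x * gaussian x) = \<bar>f x\<bar> * gaussian x"
        by (simp add: abs_mult less_imp_le)
      also have "\<dots> \<le> C * exp (k * norm x) * gaussian x"
        using 1(3)[of x] by (intro mult_right_mono) (auto simp: less_imp_le)
      also have "\<dots> \<le> C * (exp (k\<^sup>2 / (2 * pi)) * exp (- pi * (1/2) * (norm x)\<^sup>2))"
        using ** by (simp only: mult.assoc)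
      finally show "norm (f x * gaussian x) \<le> norm (C * exp (k\<^sup>2 / (2 * pi)) * exp (- pi * (1/2) * (norm x)\<^sup>2))"
        using 1 by (simp add: mult_ac)
    qed
  qed auto
qed

text \<open>Differentiation under the integral sign, from dominated convergence of difference quotients; the
mean value theorem bounds the quotients by the bound of the derivative.\<close>

lemma has_real_derivative_integral:
  fixes f f' :: "real \<Rightarrow> 'a \<Rightarrow> real"
  assumes f: "\<And>t. integrable M (f t)" and f'[measurable]: "f' t0 \<in> borel_measurable M"
    and deriv: "\<And>t x. ((\<lambda>t. f t x) has_real_derivative f' t x) (at t)"
    and w: "integrable M w" and bound: "\<And>t x. \<bar>t - t0\<bar> \<le> 1 \<Longrightarrow> \<bar>f' t x\<bar> \<le> w x"
  shows "((\<lambda>t. \<integral>x. f t x \<partial>M) has_real_derivative (\<integral>x. f' t0 x \<partial>M)) (at t0)"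
  unfolding has_field_derivative_iff tendsto_at_iff_sequentially
proof (intro allI impI)
  fix X :: "nat \<Rightarrow> real" assume X: "\<forall>i. X i \<in> UNIV - {t0}" and lim: "X \<longlonglongrightarrow> t0"
  have m[measurable]: "f t \<in> borel_measurable M" for t using f by auto
  have "\<forall>\<^sub>F n in sequentially. dist (X n) t0 < 1" using lim by (rule tendstoD) simp
  then obtain N where N: "\<And>n. n \<ge> N \<Longrightarrow> \<bar>X n - t0\<bar> < 1" by (auto simp: eventually_sequentially dist_real_def)
  let ?q = "\<lambda>n x. (f (X (n + N)) x - f t0 x) / (X (n + N) - t0)"
  have "(\<lambda>n. \<integral>x. ?q n x \<partial>M) \<longlonglongrightarrow> (\<integral>x. f' t0 x \<partial>M)"
  proof (rule integral_dominated_convergence[where w=w])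
    show "AE x in M. (\<lambda>n. ?q n x) \<longlonglongrightarrow> f' t0 x"
    proof (rule AE_I2)
      fix x
      have "((\<lambda>t. (f t x - f t0 x) / (t - t0)) \<longlongrightarrow> f' t0 x) (at t0)"
        using deriv[of x t0] by (simp add: has_field_derivative_iff)
      then have "((\<lambda>t. (f t x - f t0 x) / (t - t0)) \<circ> X) \<longlonglongrightarrow> f' t0 x"
        using X lim by (auto simp: tendsto_at_iff_sequentially)
      from LIMSEQ_ignore_initial_segment[OF this, of N]
      show "(\<lambda>n. ?q n x) \<longlonglongrightarrow> f' t0 x" by (simp add: o_def)
    qed
    show "AE x in M. norm (?q n x) \<le> w x" for n
    proof (rule AE_I2)
      fix x
      have "norm (f (X (n + N)) x - f t0 x) \<le> w x * norm (X (n + N) - t0)"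
      proof (rule field_differentiable_bound[of "{t0 - 1..t0 + 1}" "\<lambda>t. f t x" "\<lambda>t. f' t x"])
        show "((\<lambda>t. f t x) has_field_derivative f' z x) (at z within {t0 - 1..t0 + 1})" for z
          by (rule has_field_derivative_at_within[OF deriv])
        show "norm (f' z x) \<le> w x" if "z \<in> {t0 - 1..t0 + 1}" for z
          using bound[of z x] that by (auto simp: abs_le_iff)
      qed (use N[of "n + N"] in auto)
      moreover have "X (n + N) - t0 \<noteq> 0" using X by auto
      ultimately show "norm (?q n x) \<le> w x"
        by (simp add: abs_mult field_simps)
    qed
  qed (use w in auto)
  moreover have "(\<integral>x. ?q n x \<partial>M) = ((\<integral>x. f (X (n + N)) x \<partial>M) - (\<integral>x. f t0 x \<partial>M)) / (X (n + N) - t0)" for n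
    using f by (subst integral_divide_zero, subst Bochner_Integration.integral_diff) auto
  ultimately have "(\<lambda>n. ((\<lambda>t. ((\<integral>x. f t x \<partial>M) - (\<integral>x. f t0 x \<partial>M)) / (t - t0)) \<circ> X) (n + N)) \<longlonglongrightarrow> (\<integral>x. f' t0 x \<partial>M)"
    by (simp only: o_def)
  then show "((\<lambda>t. ((\<integral>x. f t x \<partial>M) - (\<integral>x. f t0 x \<partial>M)) / (t - t0)) \<circ> X) \<longlonglongrightarrow> (\<integral>x. f' t0 x \<partial>M)"
    by (rule LIMSEQ_offset)
qed

lemma gaussian_shift_bound:
  fixes x b :: "'a::euclidean_space"
  assumes "norm b \<le> 1"
  shows "gaussian (x + b) \<le> exp (2 * pi * norm x) * gaussian x"
proof -
  have "(norm x)\<^sup>2 - 2 * norm x \<le> (norm (x + b))\<^sup>2"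
  proof -
    have "\<bar>x \<bullet> b\<bar> \<le> norm x * 1"
      using Cauchy_Schwarz_ineq2[of x b] mult_left_mono[OF assms, of "norm x"] by simp
    then have "- norm x \<le> x \<bullet> b" by linarith
    moreover have "(norm (x + b))\<^sup>2 = (norm x)\<^sup>2 + 2 * (x \<bullet> b) + (norm b)\<^sup>2"
      by (simp add: power2_norm_eq_inner inner_add_left inner_add_right inner_commute)
    moreover have "(norm b)\<^sup>2 \<ge> 0" by simp
    ultimately show ?thesis by linarith
  qed
  then have "pi * ((norm x)\<^sup>2 - 2 * norm x) \<le> pi * (norm (x + b))\<^sup>2"
    by (intro mult_left_mono) auto
  then show ?thesis
    by (simp add: gaussian_def exp_add[symmetric] algebra_simps)
qed

lemma lborel_integral_translate:
  fixes f :: "'a::euclidean_space \<Rightarrow> 'b::{banach, second_countable_topology}"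
  assumes [measurable]: "f \<in> borel_measurable borel"
  shows "(\<integral>x. f (a + x) \<partial>lborel) = integral\<^sup>L lborel f"
    and "integrable lborel (\<lambda>x. f (a + x)) \<longleftrightarrow> integrable lborel f"
proof -
  show "(\<integral>x. f (a + x) \<partial>lborel) = integral\<^sup>L lborel f"
    by (subst (2) lborel_distr_plus[of a, symmetric], subst integral_distr) auto
  show "integrable lborel (\<lambda>x. f (a + x)) \<longleftrightarrow> integrable lborel f"
    by (subst (2) lborel_distr_plus[of a, symmetric], subst integrable_distr_eq) auto
qed

text \<open>The integral of \<open>p * gaussian\<close> does not change under translation along \<open>b\<close>; differentiating in the
translation parameter gives the identity. No boundary terms or iterated integrals are needed.\<close>

lemma gaussian_integration_by_parts:
  fixes p q :: "'a::euclidean_space \<Rightarrow> real"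
  assumes p: "exp_bounded p" and q: "exp_bounded q" and b: "norm b = 1"
    and deriv: "\<And>x t. ((\<lambda>t. p (x + t *\<^sub>R b)) has_real_derivative q (x + t *\<^sub>R b)) (at t)"
  shows "(\<integral>x. q x * gaussian x \<partial>lborel) = 2 * pi * (\<integral>x. (x \<bullet> b) * p x * gaussian x \<partial>lborel)"
proof -
  define G where "G x = q x - 2 * pi * ((x \<bullet> b) * p x)" for x
  have xp: "exp_bounded (\<lambda>x. (x \<bullet> b) * p x)"
    by (intro exp_bounded_mult exp_bounded_inner p)
  have G_eq: "G = (\<lambda>x. q x + (- 2 * pi) * ((x \<bullet> b) * p x))" by (auto simp: G_def)
  have G: "exp_bounded G"
    unfolding G_eq by (intro exp_bounded_add q exp_bounded_mult[OF exp_bounded_const] xp)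
  have [measurable]: "p \<in> borel_measurable borel" "q \<in> borel_measurable borel" "G \<in> borel_measurable borel"
    using p q G by measurable
  obtain C k where C: "C \<ge> 0" "k \<ge> 0" "\<And>x. \<bar>G x\<bar> \<le> C * exp (k * norm x)"
    using exp_boundedE[OF G] by blast
  let ?f = "\<lambda>t x. p (x + t *\<^sub>R b) * gaussian (x + t *\<^sub>R b)"
  let ?f' = "\<lambda>t x. G (x + t *\<^sub>R b) * gaussian (x + t *\<^sub>R b)"
  have const: "(\<integral>x. ?f t x \<partial>lborel) = (\<integral>x. p x * gaussian x \<partial>lborel)" for t
    using lborel_integral_translate(1)[of "\<lambda>x. p x * gaussian x" "t *\<^sub>R b"] by (simp add: add.commute)
  have "((\<lambda>t. \<integral>x. ?f t x \<partial>lborel) has_real_derivative (\<integral>x. ?f' 0 x \<partial>lborel)) (at 0)"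
  proof (rule has_real_derivative_integral)
    show "integrable lborel (?f t)" for t
      using lborel_integral_translate(2)[of "\<lambda>x. p x * gaussian x" "t *\<^sub>R b"]
        exp_bounded_times_gaussian_integrable[OF p] by (simp add: add.commute)
    show "((\<lambda>t. ?f t x) has_real_derivative ?f' t x) (at t)" for t x
    proof -
      have n: "(norm (x + t *\<^sub>R b))\<^sup>2 = (norm x)\<^sup>2 + 2 * t * (x \<bullet> b) + t\<^sup>2" for t
        using b unfolding power2_norm_eq_inner
        by (simp add: inner_add_left inner_add_right inner_commute algebra_simps power2_eq_square norm_eq_1)
      have i: "(x + t *\<^sub>R b) \<bullet> b = x \<bullet> b + t"
        using b by (simp add: inner_add_left norm_eq_1)
      have "((\<lambda>t. gaussian (x + t *\<^sub>R b)) has_real_derivative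
          - 2 * pi * ((x + t *\<^sub>R b) \<bullet> b) * gaussian (x + t *\<^sub>R b)) (at t)"
        unfolding gaussian_def n i by (auto intro!: derivative_eq_intros simp: algebra_simps)
      from DERIV_mult[OF deriv[of x t] this] show ?thesis
        by (simp add: G_def algebra_simps)
    qed
    show "integrable lborel (\<lambda>x. (C * exp k * exp ((k + 2 * pi) * norm x)) * gaussian x)"
      by (intro exp_bounded_times_gaussian_integrable exp_bounded_mult exp_bounded_const exp_bounded_exp_norm)
    show "\<bar>?f' t x\<bar> \<le> (C * exp k * exp ((k + 2 * pi) * norm x)) * gaussian x" if "\<bar>t - 0\<bar> \<le> 1" for t x
    proof -
      have nt: "norm (t *\<^sub>R b) \<le> 1" using that b by simp
      have "\<bar>G (x + t *\<^sub>R b)\<bar> \<le> C * exp (k * norm (x + t *\<^sub>R b))" by (rule C)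
      also have "\<dots> \<le> C * exp (k * (norm x + 1))"
        using C norm_triangle_ineq[of x "t *\<^sub>R b"] nt by (auto intro!: mult_left_mono)
      finally have "\<bar>G (x + t *\<^sub>R b)\<bar> * gaussian (x + t *\<^sub>R b) \<le>
          C * exp (k * (norm x + 1)) * (exp (2 * pi * norm x) * gaussian x)"
        using gaussian_shift_bound[OF nt, of x] C by (intro mult_mono) (auto simp: less_imp_le)
      then show ?thesis
        by (simp add: abs_mult less_imp_le exp_add algebra_simps)
    qed
  qed auto
  then have "(\<integral>x. ?f' 0 x \<partial>lborel) = 0"
    unfolding const using DERIV_const DERIV_unique by blast
  moreover have "(\<integral>x. ?f' 0 x \<partial>lborel) = (\<integral>x. q x * gaussian x - 2 * pi * ((x \<bullet> b) * p x * gaussian x) \<partial>lborel)"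
    by (intro Bochner_Integration.integral_cong) (auto simp: G_def algebra_simps)
  moreover have "\<dots> = (\<integral>x. q x * gaussian x \<partial>lborel) - 2 * pi * (\<integral>x. (x \<bullet> b) * p x * gaussian x \<partial>lborel)"
    using exp_bounded_times_gaussian_integrable[OF q] exp_bounded_times_gaussian_integrable[OF xp]
    by (subst Bochner_Integration.integral_diff) auto
  ultimately show ?thesis by simp
qed

lemma directional_derivative:
  assumes "\<And>x. (p has_derivative (\<lambda>h. \<Sum>b\<in>Basis. (h \<bullet> b) * q b x)) (at (x::'a::euclidean_space))"
  shows "((\<lambda>t. p (x + t *\<^sub>R h)) has_real_derivative (\<Sum>b\<in>Basis. (h \<bullet> b) * q b (x + t *\<^sub>R h))) (at t)"
proof -
  have "((\<lambda>t. x + t *\<^sub>R h) has_derivative (\<lambda>s. s *\<^sub>R h)) (at t)"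
    by (auto intro!: derivative_eq_intros)
  from has_derivative_compose[OF this assms]
  have "((\<lambda>t. p (x + t *\<^sub>R h)) has_derivative (\<lambda>s. \<Sum>b\<in>Basis. ((s *\<^sub>R h) \<bullet> b) * q b (x + t *\<^sub>R h))) (at t)" .
  then show ?thesis
    unfolding has_field_derivative_def
    by (rule has_derivative_eq_rhs) (auto simp: sum_distrib_left mult_ac)
qed

lemma directional_derivative_Basis:
  assumes "\<And>x. (p has_derivative (\<lambda>h. \<Sum>b\<in>Basis. (h \<bullet> b) * q b x)) (at (x::'a::euclidean_space))"
    and b: "b \<in> Basis"
  shows "((\<lambda>t. p (x + t *\<^sub>R b)) has_real_derivative q b (x + t *\<^sub>R b)) (at t)"
  using directional_derivative[OF assms(1), of x b t] b
  by (simp add: inner_Basis sum.delta if_distrib[of "\<lambda>c. c * _"] cong: if_cong)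

text \<open>Along \<open>H (\<xi> + t *\<^sub>R x)\<close> the \<open>t\<close>-derivative of the Gaussian average is, after integrating by parts in
each coordinate, a multiple of the average of the Laplacian of \<open>H\<close>. It vanishes, so the averages at
\<open>t = 1\<close> and \<open>t = 0\<close> agree.\<close>

theorem gaussian_mean_value:
  fixes H :: "'a::euclidean_space \<Rightarrow> real"
  assumes H: "real_polynomial_function H" and harm: "\<And>x. laplacian H x = 0"
  shows "(\<integral>x. H (\<xi> + x) * gaussian x \<partial>lborel) = H \<xi>"
proof -
  obtain q where q: "\<And>b. real_polynomial_function (q b)"
    and dH: "\<And>x. (H has_derivative (\<lambda>h. \<Sum>b\<in>Basis. (h \<bullet> b) * q b x)) (at x)"
    using real_polynomial_gradient[OF H] by blast
  have "\<exists>qq. real_polynomial_function qq \<and> (\<forall>x t. ((\<lambda>t. q b (x + t *\<^sub>R b)) has_real_derivative qq (x + t *\<^sub>R b)) (at t))"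
    if "b \<in> Basis" for b
  proof -
    obtain q' where "\<And>b. real_polynomial_function (q' b)"
      and "\<And>x. (q b has_derivative (\<lambda>h. \<Sum>b\<in>Basis. (h \<bullet> b) * q' b x)) (at x)"
      using real_polynomial_gradient[OF q[of b]] by blast
    then show ?thesis
      using directional_derivative_Basis[of "q b" q' b] that by blast
  qed
  then obtain qq where qq: "\<And>b. b \<in> Basis \<Longrightarrow> real_polynomial_function (qq b)"
    and dq: "\<And>b x t. b \<in> Basis \<Longrightarrow> ((\<lambda>t. q b (x + t *\<^sub>R b)) has_real_derivative qq b (x + t *\<^sub>R b)) (at t)"
    by metis
  have lap: "(\<Sum>b\<in>Basis. qq b x) = 0" for x
  proof -
    have "(deriv ^^ 2) (\<lambda>t. H (x + t *\<^sub>R b)) 0 = qq b x" if b: "b \<in> Basis" for b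
    proof -
      have "deriv (\<lambda>t. H (x + t *\<^sub>R b)) = (\<lambda>t. q b (x + t *\<^sub>R b))"
        using directional_derivative_Basis[OF dH b] by (intro ext DERIV_imp_deriv)
      then show ?thesis
        using DERIV_imp_deriv[OF dq[OF b, of x 0]] by (simp add: numeral_2_eq_2)
    qed
    then show ?thesis using harm[of x] by (simp add: laplacian_def)
  qed
  have ebH: "exp_bounded H" and ebq: "exp_bounded (q b)" and ebqq: "b \<in> Basis \<Longrightarrow> exp_bounded (qq b)" for b
    using H q qq by (auto intro: exp_bounded_real_polynomial)
  have [measurable]: "H \<in> borel_measurable borel" "q b \<in> borel_measurable borel" for b
    using ebH ebq by measurable
  let ?f = "\<lambda>t x. H (\<xi> + t *\<^sub>R x) * gaussian x"
  let ?f' = "\<lambda>t x. (\<Sum>b\<in>Basis. (x \<bullet> b) * q b (\<xi> + t *\<^sub>R x)) * gaussian x"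
  have ebS: "exp_bounded (\<lambda>x. \<Sum>b\<in>Basis. \<bar>q b x\<bar>)"
    by (intro exp_bounded_sum exp_bounded_abs ebq)
  obtain C k where C: "C \<ge> 0" "k \<ge> 0" "\<And>x. \<bar>\<Sum>b\<in>Basis. \<bar>q b x\<bar>\<bar> \<le> C * exp (k * norm x)"
    using exp_boundedE[OF ebS] by blast
  have "((\<lambda>t. \<integral>x. ?f t x \<partial>lborel) has_real_derivative 0) (at t)" for t
  proof -
    have "((\<lambda>t. \<integral>x. ?f t x \<partial>lborel) has_real_derivative (\<integral>x. ?f' t x \<partial>lborel)) (at t)"
    proof (rule has_real_derivative_integral)
      show "integrable lborel (?f t)" for t
        by (intro exp_bounded_times_gaussian_integrable exp_bounded_affine ebH)
      show "((\<lambda>t. ?f t x) has_real_derivative ?f' t x) (at t)" for t x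
        using DERIV_mult[OF directional_derivative[OF dH, of \<xi> x t] DERIV_const[of "gaussian x"]] by simp
      let ?w = "\<lambda>x. (norm x * (C * exp (k * norm \<xi>)) * exp (k * (\<bar>t\<bar> + 1) * norm x)) * gaussian x"
      show "integrable lborel ?w"
        by (intro exp_bounded_times_gaussian_integrable exp_bounded_mult exp_bounded_const exp_bounded_norm exp_bounded_exp_norm)
      show "\<bar>?f' s x\<bar> \<le> ?w x" if s: "\<bar>s - t\<bar> \<le> 1" for s x
      proof -
        have "\<bar>\<Sum>b\<in>Basis. (x \<bullet> b) * q b (\<xi> + s *\<^sub>R x)\<bar> \<le> (\<Sum>b\<in>Basis. norm x * \<bar>q b (\<xi> + s *\<^sub>R x)\<bar>)"
          by (rule sum_abs[THEN order_trans], rule sum_mono) (auto simp: abs_mult intro!: mult_right_mono Basis_le_norm)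
        also have "\<dots> = norm x * (\<Sum>b\<in>Basis. \<bar>q b (\<xi> + s *\<^sub>R x)\<bar>)"
          by (simp add: sum_distrib_left)
        also have "\<dots> \<le> norm x * (C * exp (k * norm (\<xi> + s *\<^sub>R x)))"
          using C(3)[of "\<xi> + s *\<^sub>R x"] by (intro mult_left_mono) auto
        also have "\<dots> \<le> norm x * (C * exp (k * (norm \<xi> + (\<bar>t\<bar> + 1) * norm x)))"
        proof -
          have "norm (\<xi> + s *\<^sub>R x) \<le> norm \<xi> + (\<bar>t\<bar> + 1) * norm x"
            using s by (intro norm_triangle_le add_left_mono) (auto intro!: mult_right_mono)
          then show ?thesis using C by (intro mult_left_mono) (auto intro!: mult_left_mono)
        qed
        also have "\<dots> = norm x * (C * exp (k * norm \<xi>)) * exp (k * (\<bar>t\<bar> + 1) * norm x)"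
          by (simp add: exp_add algebra_simps)
        finally show ?thesis by (simp add: abs_mult less_imp_le)
      qed
    qed measurable
    moreover have "(\<integral>x. ?f' t x \<partial>lborel) = 0"
    proof -
      have eb: "exp_bounded (\<lambda>x. q b (\<xi> + t *\<^sub>R x))" "b \<in> Basis \<Longrightarrow> exp_bounded (\<lambda>x. t * qq b (\<xi> + t *\<^sub>R x))" for b
        by (intro exp_bounded_mult exp_bounded_const exp_bounded_affine ebq ebqq; assumption)+
      have ibp: "(\<integral>x. t * qq b (\<xi> + t *\<^sub>R x) * gaussian x \<partial>lborel) =
          2 * pi * (\<integral>x. (x \<bullet> b) * q b (\<xi> + t *\<^sub>R x) * gaussian x \<partial>lborel)" if b: "b \<in> Basis" for b
      proof (rule gaussian_integration_by_parts[OF eb(1) eb(2)[OF b]])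
        fix x s
        have "((\<lambda>s. q b ((\<xi> + t *\<^sub>R x) + (t * s) *\<^sub>R b)) has_real_derivative
            qq b ((\<xi> + t *\<^sub>R x) + (t * s) *\<^sub>R b) * t) (at s)"
          by (rule DERIV_chain2[OF dq[OF b]]) (auto intro!: derivative_eq_intros)
        then show "((\<lambda>s. q b (\<xi> + t *\<^sub>R (x + s *\<^sub>R b))) has_real_derivative
            t * qq b (\<xi> + t *\<^sub>R (x + s *\<^sub>R b))) (at s)"
          by (simp add: scaleR_add_right add.assoc mult.commute)
      qed (use b in auto)
      have int: "integrable lborel (\<lambda>x. (x \<bullet> b) * q b (\<xi> + t *\<^sub>R x) * gaussian x)" for b
        by (intro exp_bounded_times_gaussian_integrable exp_bounded_mult exp_bounded_inner eb)
      have int2: "b \<in> Basis \<Longrightarrow> integrable lborel (\<lambda>x. t * qq b (\<xi> + t *\<^sub>R x) * gaussian x)" for b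
        by (intro exp_bounded_times_gaussian_integrable eb)
      have "2 * pi * (\<integral>x. ?f' t x \<partial>lborel) = (\<Sum>b\<in>Basis. 2 * pi * (\<integral>x. (x \<bullet> b) * q b (\<xi> + t *\<^sub>R x) * gaussian x \<partial>lborel))"
        using int by (simp add: sum_distrib_right Bochner_Integration.integral_sum sum_distrib_left)
      also have "\<dots> = (\<Sum>b\<in>Basis. (\<integral>x. t * qq b (\<xi> + t *\<^sub>R x) * gaussian x \<partial>lborel))"
        by (intro sum.cong refl ibp[symmetric])
      also have "\<dots> = (\<integral>x. (\<Sum>b\<in>Basis. t * qq b (\<xi> + t *\<^sub>R x) * gaussian x) \<partial>lborel)"
        using int2 by (simp add: Bochner_Integration.integral_sum)
      also have "\<dots> = 0"
        by (simp add: sum_distrib_right[symmetric] sum_distrib_left[symmetric] lap)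
      finally show ?thesis by simp
    qed
    ultimately show ?thesis by simp
  qed
  then have "(\<integral>x. ?f 1 x \<partial>lborel) = (\<integral>x. ?f 0 x \<partial>lborel)"
    by (intro DERIV_isconst_all allI)
  then show ?thesis by (simp add: integral_gaussian)
qed

text \<open>Shifting the variable by \<open>t *\<^sub>R \<xi>\<close> completes the square in the exponent and leaves an average of
\<open>H (t *\<^sub>R \<xi> + x)\<close>, which the mean value property evaluates. Expanded in powers of \<open>t\<close>, both sides
determine the Gaussian moments of \<open>H\<close> against powers of \<open>x \<bullet> \<xi>\<close>.\<close>

lemma gaussian_generating_function:
  fixes H :: "'a::euclidean_space \<Rightarrow> real"
  assumes H: "homogeneous_harmonic_polynomial l H"
  shows "(\<integral>x. H x * exp (t * (2 * pi * (x \<bullet> \<xi>))) * gaussian x \<partial>lborel) =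
    t ^ l * H \<xi> * exp (pi * t\<^sup>2 * (norm \<xi>)\<^sup>2)"
proof -
  have H': "real_polynomial_function H" "\<And>c x. H (c *\<^sub>R x) = c ^ l * H x" "\<And>x. laplacian H x = 0"
    using H by (auto simp: homogeneous_harmonic_polynomial_def)
  have [measurable]: "H \<in> borel_measurable borel" using H'(1) by (rule real_polynomial_measurable)
  have "(\<integral>x. H x * exp (t * (2 * pi * (x \<bullet> \<xi>))) * gaussian x \<partial>lborel) =
    (\<integral>x. H (t *\<^sub>R \<xi> + x) * exp (t * (2 * pi * ((t *\<^sub>R \<xi> + x) \<bullet> \<xi>))) * gaussian (t *\<^sub>R \<xi> + x) \<partial>lborel)"
    by (rule lborel_integral_translate(1)[symmetric]) measurable
  also have "\<dots> = (\<integral>x. exp (pi * t\<^sup>2 * (norm \<xi>)\<^sup>2) * (H (t *\<^sub>R \<xi> + x) * gaussian x) \<partial>lborel)"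
  proof (intro Bochner_Integration.integral_cong refl)
    fix x
    have "exp (t * (2 * pi * ((t *\<^sub>R \<xi> + x) \<bullet> \<xi>))) * gaussian (t *\<^sub>R \<xi> + x) =
        exp (pi * t\<^sup>2 * (norm \<xi>)\<^sup>2) * gaussian x"
      unfolding gaussian_def exp_add[symmetric] power2_norm_eq_inner
      by (simp add: inner_add_left inner_add_right inner_commute algebra_simps power2_eq_square)
    then show "H (t *\<^sub>R \<xi> + x) * exp (t * (2 * pi * ((t *\<^sub>R \<xi> + x) \<bullet> \<xi>))) * gaussian (t *\<^sub>R \<xi> + x) =
        exp (pi * t\<^sup>2 * (norm \<xi>)\<^sup>2) * (H (t *\<^sub>R \<xi> + x) * gaussian x)"
      by (simp add: mult_ac)
  qed
  also have "\<dots> = t ^ l * H \<xi> * exp (pi * t\<^sup>2 * (norm \<xi>)\<^sup>2)"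
    using gaussian_mean_value[OF H'(1,3), of "t *\<^sub>R \<xi>"] by (simp add: H'(2))
  finally show ?thesis .
qed

section \<open>The Funk-Hecke formula\<close>

lemma powser_coeff_unique:
  fixes a b :: "nat \<Rightarrow> real"
  assumes a: "\<And>t. (\<lambda>n. a n * t ^ n) sums f t" and b: "\<And>t. (\<lambda>n. b n * t ^ n) sums f t"
  shows "a n = b n"
proof (rule ccontr)
  assume n: "a n \<noteq> b n"
  define c where "c n = a n - b n" for n
  have s: "(\<lambda>n. c n * t ^ n) sums 0" for t
    using sums_diff[OF a[of t] b[of t]] by (simp add: c_def algebra_simps)
  have "c 0 = 0" using s[of 0] by simp
  with n have "n > 0" "c n \<noteq> 0" by (auto simp: c_def intro: gr0I)
  then obtain r :: real where r: "0 < r" "\<And>z::real. z \<in> cball 0 r - {0} \<Longrightarrow> (0::real) \<noteq> 0"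
    using powser_0_nonzero[of 1 0 c "\<lambda>_. 0" n] s by auto
  have "r \<in> cball 0 r - {0}" using r(1) by simp
  from r(2)[OF this] show False by simp
qed

text \<open>Termwise integration of an exponential series; the integrable majorant dominates all partial
sums. Used for Gaussian integrals, for spherical integrals and for compactly supported functions.\<close>

lemma exp_series_integral:
  fixes h a :: "'a \<Rightarrow> 'b::{real_normed_field, banach, second_countable_topology}"
  assumes [measurable]: "h \<in> borel_measurable M" "a \<in> borel_measurable M"
    and int: "integrable M (\<lambda>x. norm (h x) * exp (norm (a x)))"
  shows "(\<lambda>k. \<integral>x. h x * a x ^ k / fact k \<partial>M) sums (\<integral>x. h x * exp (a x) \<partial>M)"
    and "integrable M (\<lambda>x. h x * exp (a x))"
    and "integrable M (\<lambda>x. h x * a x ^ k)"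
proof -
  have m[measurable]: "(\<lambda>x. exp (a x)) \<in> borel_measurable M"
    by (rule measurable_compose[OF assms(2)]) (intro borel_measurable_continuous_onI continuous_intros)
  have bound: "(\<Sum>k<n. norm (a x) ^ k / fact k) \<le> exp (norm (a x))" for n x
    using sum_le_suminf[of "\<lambda>k. norm (a x) ^ k / fact k" "{..<n}"] summable_exp[of "norm (a x)"]
    by (auto simp: exp_def divide_inverse mult.commute)
  have term_le: "norm (a x) ^ k / fact k \<le> exp (norm (a x))" for k x
    using order_trans[OF member_le_sum[of k "{..<Suc k}" "\<lambda>k. norm (a x) ^ k / fact k"] bound[of x "Suc k"]] by auto
  have ik: "integrable M (\<lambda>x. h x * a x ^ k / fact k)" for k
  proof (rule Bochner_Integration.integrable_bound[OF int])
    show "AE x in M. norm (h x * a x ^ k / fact k) \<le> norm (norm (h x) * exp (norm (a x)))"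
      using term_le[where k=k] mult_left_mono[OF term_le[where k=k], of "norm (h x)" for x]
      by (auto simp: norm_mult norm_divide norm_power)
  qed measurable
  show "integrable M (\<lambda>x. h x * a x ^ k)"
    using integrable_mult_left[OF ik[of k], of "fact k"] by simp
  show "integrable M (\<lambda>x. h x * exp (a x))"
    by (rule Bochner_Integration.integrable_bound[OF int])
       (auto simp: norm_mult intro!: mult_left_mono norm_exp)
  have "(\<lambda>n. \<integral>x. (\<Sum>k<n. h x * a x ^ k / fact k) \<partial>M) \<longlonglongrightarrow> (\<integral>x. h x * exp (a x) \<partial>M)"
  proof (rule integral_dominated_convergence[OF _ _ int])
    show "AE x in M. (\<lambda>n. \<Sum>k<n. h x * a x ^ k / fact k) \<longlonglongrightarrow> h x * exp (a x)"
    proof (rule AE_I2)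
      fix x
      have "(\<lambda>k. h x * (a x ^ k /\<^sub>R fact k)) sums (h x * exp (a x))"
        by (intro sums_mult exp_converges)
      then show "(\<lambda>n. \<Sum>k<n. h x * a x ^ k / fact k) \<longlonglongrightarrow> h x * exp (a x)"
        by (simp add: sums_def scaleR_conv_of_real divide_inverse mult_ac)
    qed
    show "AE x in M. norm (\<Sum>k<n. h x * a x ^ k / fact k) \<le> norm (h x) * exp (norm (a x))" for n
    proof (rule AE_I2)
      fix x
      have "norm (\<Sum>k<n. h x * a x ^ k / fact k) \<le> (\<Sum>k<n. norm (h x) * (norm (a x) ^ k / fact k))"
        by (rule norm_sum[THEN order_trans]) (simp add: norm_mult norm_divide norm_power)
      also have "\<dots> \<le> norm (h x) * exp (norm (a x))"
        unfolding sum_distrib_left[symmetric] by (intro mult_left_mono bound) auto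
      finally show "norm (\<Sum>k<n. h x * a x ^ k / fact k) \<le> norm (h x) * exp (norm (a x))" .
    qed
  qed auto
  then show "(\<lambda>k. \<integral>x. h x * a x ^ k / fact k \<partial>M) sums (\<integral>x. h x * exp (a x) \<partial>M)"
    unfolding sums_def using ik by (simp add: Bochner_Integration.integral_sum)
qed

lemma AE_sphere_measure: "AE \<omega> in (sphere_measure :: 'a::euclidean_space measure). norm \<omega> = 1"
proof -
  have "AE x::'a in uniform_measure lborel (cball 0 1). norm (sgn x) = 1"
    using AE_lborel_singleton[of "0::'a"]
    by (intro AE_uniform_measureI) (auto elim!: eventually_mono simp: norm_sgn)
  then show ?thesis
    unfolding sphere_measure_def by (subst AE_distr_iff) auto
qed

lemma sphere_integrable_continuous:
  fixes h :: "'a::euclidean_space \<Rightarrow> 'b::{banach, second_countable_topology}"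
  assumes h: "continuous_on UNIV h"
  shows "integrable sphere_measure h"
proof -
  have "compact (h ` cball 0 1)"
    by (intro compact_continuous_image continuous_on_subset[OF h]) auto
  then have "bounded (h ` cball 0 1)" by (rule compact_imp_bounded)
  then obtain B where "\<forall>y\<in>h ` cball 0 1. norm y \<le> B" unfolding bounded_iff by blast
  then have B: "norm (h x) \<le> B" if "norm x \<le> 1" for x using that by auto
  have [measurable]: "h \<in> borel_measurable borel"
    using h by (rule borel_measurable_continuous_onI)
  show ?thesis
    by (rule sphere.integrable_const_bound[of _ B])
       (use AE_sphere_measure B in \<open>auto elim!: eventually_mono\<close>)
qed

lemma homogeneous_harmonicD:
  fixes H :: "'a::euclidean_space \<Rightarrow> real"
  assumes "homogeneous_harmonic_polynomial l H"
  shows "real_polynomial_function H" "continuous_on UNIV H" "H \<in> borel_measurable borel"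
    "H (c *\<^sub>R x) = c ^ l * H x" "exp_bounded H"
proof -
  show p: "real_polynomial_function H" and "H (c *\<^sub>R x) = c ^ l * H x"
    using assms by (auto simp: homogeneous_harmonic_polynomial_def)
  show "continuous_on UNIV H"
    using p continuous_on_polymonial_function by (auto simp: real_polynomial_function_eq)
  show "H \<in> borel_measurable borel" "exp_bounded H"
    using p real_polynomial_measurable exp_bounded_real_polynomial by auto
qed

definition gaussian_moment :: "'a::euclidean_space itself \<Rightarrow> nat \<Rightarrow> real" where
  "gaussian_moment _ k = (\<integral>(x::'a). norm x ^ k * gaussian x \<partial>lborel)"

lemma gaussian_moment_integrable: "integrable lborel (\<lambda>x::'a::euclidean_space. norm x ^ k * gaussian x)"
  by (intro exp_bounded_times_gaussian_integrable exp_bounded_power exp_bounded_norm)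

text \<open>Positivity allows division by the radial moments when spherical moments are recovered from
Gaussian ones.\<close>

lemma gaussian_moment_pos: "gaussian_moment TYPE('a::euclidean_space) k > 0"
proof -
  have "gaussian_moment TYPE('a) k \<noteq> 0"
  proof
    assume "gaussian_moment TYPE('a) k = 0"
    then have "AE x::'a in lborel. norm x ^ k * gaussian x = 0"
      unfolding gaussian_moment_def
      by (subst (asm) integral_nonneg_eq_0_iff_AE[OF gaussian_moment_integrable]) (auto simp: less_imp_le)
    with AE_lborel_singleton[of "0::'a"] have "AE x::'a in lborel. False"
      by eventually_elim (auto simp: gaussian_def)
    then show False
      by (simp add: eventually_False ae_filter_eq_bot_iff)
  qed
  moreover have "gaussian_moment TYPE('a) k \<ge> 0"
    unfolding gaussian_moment_def by (intro Bochner_Integration.integral_nonneg) (auto simp: less_imp_le)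
  ultimately show ?thesis by linarith
qed

lemma gaussian_moment_shift:
  assumes "DIM('m::euclidean_space) = DIM('n::euclidean_space) + 2 * l"
  shows "gaussian_moment TYPE('n) (2 * l + k) = dim_ratio DIM('n) DIM('m) * gaussian_moment TYPE('m) k"
  using radial_shift(2)[OF assms, of "\<lambda>r. r ^ k * exp (- pi * r\<^sup>2)"]
  by (simp add: gaussian_moment_def gaussian_def power_add mult_ac)

text \<open>In polar coordinates a Gaussian moment is the spherical moment times a purely radial moment.
The Gaussian moments are the Taylor coefficients of the generating function: only the powers
\<open>l + 2 * j\<close> survive, and each coefficient depends on the direction of \<open>\<xi>\<close> only through \<open>H \<xi>\<close>.\<close>

lemma spherical_moments:
  fixes H :: "'a::euclidean_space \<Rightarrow> real"
  assumes H: "homogeneous_harmonic_polynomial l H"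
  shows "(\<integral>\<omega>. H \<omega> * (2 * pi * (\<omega> \<bullet> \<xi>)) ^ k / fact k \<partial>sphere_measure) =
    (if k \<in> range (\<lambda>j. l + 2 * j)
     then H \<xi> * (pi * (norm \<xi>)\<^sup>2) ^ ((k - l) div 2) / fact ((k - l) div 2) / gaussian_moment TYPE('a) (l + k) else 0)"
proof -
  note HD = homogeneous_harmonicD[OF H]
  have [measurable]: "H \<in> borel_measurable borel" by (rule HD)
  define c where "c k = (if k \<in> range (\<lambda>j. l + 2 * j)
     then H \<xi> * (pi * (norm \<xi>)\<^sup>2) ^ ((k - l) div 2) / fact ((k - l) div 2) else 0)" for k
  define M where "M k = (\<integral>x. H x * (2 * pi * (x \<bullet> \<xi>)) ^ k / fact k * gaussian x \<partial>lborel)" for k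
  let ?F = "\<lambda>t. t ^ l * H \<xi> * exp (pi * t\<^sup>2 * (norm \<xi>)\<^sup>2)"
  have "(\<lambda>k. M k * t ^ k) sums ?F t" for t
  proof -
    have i: "integrable lborel (\<lambda>x. norm (H x * gaussian x) * exp (norm (t * (2 * pi * (x \<bullet> \<xi>)))))"
    proof -
      have "exp_bounded (\<lambda>x. \<bar>H x\<bar> * exp (\<bar>t\<bar> * (2 * pi * \<bar>x \<bullet> \<xi>\<bar>)))"
      proof (rule exp_bounded_mult[OF exp_bounded_abs[OF HD(5)]], rule exp_bounded_mono)
        show "exp_bounded (\<lambda>x. exp ((\<bar>t\<bar> * 2 * pi * norm \<xi>) * norm x))" by (rule exp_bounded_exp_norm)
        show "\<bar>exp (\<bar>t\<bar> * (2 * pi * \<bar>x \<bullet> \<xi>\<bar>))\<bar> \<le> \<bar>exp ((\<bar>t\<bar> * 2 * pi * norm \<xi>) * norm x)\<bar>" for x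
          using mult_left_mono[OF Cauchy_Schwarz_ineq2[of x \<xi>], of "\<bar>t\<bar> * (2 * pi)"] by (simp add: mult_ac)
      qed measurable
      from exp_bounded_times_gaussian_integrable[OF this] show ?thesis
        by (simp add: abs_mult mult_ac less_imp_le)
    qed
    have "(\<lambda>k. \<integral>x. H x * gaussian x * (t * (2 * pi * (x \<bullet> \<xi>))) ^ k / fact k \<partial>lborel) sums
      (\<integral>x. H x * gaussian x * exp (t * (2 * pi * (x \<bullet> \<xi>))) \<partial>lborel)"
      by (rule exp_series_integral(1)[OF _ _ i]) auto
    also have "(\<lambda>k. \<integral>x. H x * gaussian x * (t * (2 * pi * (x \<bullet> \<xi>))) ^ k / fact k \<partial>lborel) = (\<lambda>k. M k * t ^ k)"
    proof
      fix k
      have "(\<integral>x. H x * gaussian x * (t * (2 * pi * (x \<bullet> \<xi>))) ^ k / fact k \<partial>lborel) =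
        (\<integral>x. t ^ k * (H x * (2 * pi * (x \<bullet> \<xi>)) ^ k / fact k * gaussian x) \<partial>lborel)"
        by (intro Bochner_Integration.integral_cong refl) (simp add: power_mult_distrib mult_ac)
      then show "(\<integral>x. H x * gaussian x * (t * (2 * pi * (x \<bullet> \<xi>))) ^ k / fact k \<partial>lborel) = M k * t ^ k"
        by (simp add: M_def)
    qed
    also have "(\<integral>x. H x * gaussian x * exp (t * (2 * pi * (x \<bullet> \<xi>))) \<partial>lborel) = ?F t"
      using gaussian_generating_function[OF H, of t \<xi>] by (simp add: mult_ac)
    finally show ?thesis .
  qed
  moreover have "(\<lambda>k. c k * t ^ k) sums ?F t" for t
  proof -
    have tj: "(t\<^sup>2) ^ j = (t ^ j)\<^sup>2" for j
      by (simp flip: power_mult add: mult.commute)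
    have "(\<lambda>j. t ^ l * H \<xi> * ((pi * t\<^sup>2 * (norm \<xi>)\<^sup>2) ^ j /\<^sub>R fact j)) sums ?F t"
      by (intro sums_mult exp_converges)
    also have "(\<lambda>j. t ^ l * H \<xi> * ((pi * t\<^sup>2 * (norm \<xi>)\<^sup>2) ^ j /\<^sub>R fact j)) = (\<lambda>j. c (l + 2 * j) * t ^ (l + 2 * j))"
      by (auto simp: fun_eq_iff c_def power_add power_mult power_mult_distrib tj field_simps)
    also have "\<dots> sums ?F t \<longleftrightarrow> ?thesis"
      by (rule sums_mono_reindex[where f="\<lambda>k. c k * t ^ k"]) (auto simp: strict_mono_def c_def)
    finally show ?thesis .
  qed
  ultimately have Mc: "M k = c k" for k by (rule powser_coeff_unique)
  have "M k = (\<integral>\<omega>. H \<omega> * (2 * pi * (\<omega> \<bullet> \<xi>)) ^ k / fact k \<partial>sphere_measure) *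
      integral\<^sup>L lborel (\<lambda>x::'a. norm x ^ (l + k) * exp (- pi * (norm x)\<^sup>2))"
    unfolding M_def
  proof (rule polar_product(2)[where B="\<lambda>r. r ^ (l + k) * exp (- pi * r\<^sup>2)"])
    show "integrable sphere_measure (\<lambda>\<omega>. H \<omega> * (2 * pi * (\<omega> \<bullet> \<xi>)) ^ k / fact k)"
      by (intro sphere_integrable_continuous continuous_intros HD) auto
    show "integrable lborel (\<lambda>x::'a. norm x ^ (l + k) * exp (- pi * (norm x)\<^sup>2))"
      using gaussian_moment_integrable[of "l + k", where 'a='a] by (simp add: gaussian_def)
    show "H (r *\<^sub>R \<omega>) * (2 * pi * ((r *\<^sub>R \<omega>) \<bullet> \<xi>)) ^ k / fact k * gaussian (r *\<^sub>R \<omega>) =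
        H \<omega> * (2 * pi * (\<omega> \<bullet> \<xi>)) ^ k / fact k * (r ^ (l + k) * exp (- pi * r\<^sup>2))"
      if "r > 0" "norm \<omega> = 1" for \<omega> r
      using that by (simp add: HD(4) gaussian_def power_mult_distrib power_add)
  qed measurable
  also have "integral\<^sup>L lborel (\<lambda>x::'a. norm x ^ (l + k) * exp (- pi * (norm x)\<^sup>2)) = gaussian_moment TYPE('a) (l + k)"
    by (simp add: gaussian_moment_def gaussian_def)
  finally show ?thesis
    using gaussian_moment_pos[of "l + k", where 'a='a] unfolding Mc c_def by (auto simp: field_simps)
qed

lemma spherical_exp_series:
  fixes H :: "'a::euclidean_space \<Rightarrow> real" and z :: complex
  assumes H: "homogeneous_harmonic_polynomial l H"
  shows "(\<lambda>j. z ^ (l + 2 * j) * of_real (H \<xi> * ((pi * (norm \<xi>)\<^sup>2) ^ j / fact j / gaussian_moment TYPE('a) (2 * l + 2 * j)))) sums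
    (\<integral>\<omega>. of_real (H \<omega>) * exp (z * of_real (2 * pi * (\<omega> \<bullet> \<xi>))) \<partial>sphere_measure)"
proof -
  note HD = homogeneous_harmonicD[OF H]
  have [measurable]: "H \<in> borel_measurable borel" by (rule HD)
  let ?a = "\<lambda>k. \<integral>\<omega>. H \<omega> * (2 * pi * (\<omega> \<bullet> \<xi>)) ^ k / fact k \<partial>sphere_measure"
  have "(\<lambda>k. \<integral>\<omega>. of_real (H \<omega>) * (z * of_real (2 * pi * (\<omega> \<bullet> \<xi>))) ^ k / fact k \<partial>sphere_measure) sums
    (\<integral>\<omega>. of_real (H \<omega>) * exp (z * of_real (2 * pi * (\<omega> \<bullet> \<xi>))) \<partial>sphere_measure)"
  proof (rule exp_series_integral(1))
    show "integrable sphere_measure (\<lambda>\<omega>. cmod (of_real (H \<omega>)) * exp (cmod (z * of_real (2 * pi * (\<omega> \<bullet> \<xi>)))))"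
      by (intro sphere_integrable_continuous continuous_intros HD)
  qed measurable
  also have "(\<lambda>k. \<integral>\<omega>. of_real (H \<omega>) * (z * of_real (2 * pi * (\<omega> \<bullet> \<xi>))) ^ k / fact k \<partial>sphere_measure) =
    (\<lambda>k. z ^ k * of_real (?a k))"
  proof
    fix k
    have "(\<integral>\<omega>. of_real (H \<omega>) * (z * of_real (2 * pi * (\<omega> \<bullet> \<xi>))) ^ k / fact k \<partial>sphere_measure) =
      (\<integral>\<omega>. z ^ k * complex_of_real (H \<omega> * (2 * pi * (\<omega> \<bullet> \<xi>)) ^ k / fact k) \<partial>sphere_measure)"
      by (intro Bochner_Integration.integral_cong refl) (simp add: power_mult_distrib mult_ac)
    also have "\<dots> = z ^ k * (\<integral>\<omega>. complex_of_real (H \<omega> * (2 * pi * (\<omega> \<bullet> \<xi>)) ^ k / fact k) \<partial>sphere_measure)"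
      by (rule integral_mult_right_zero)
    also have "\<dots> = z ^ k * of_real (?a k)"
      by (subst integral_complex_of_real) simp
    finally show "(\<integral>\<omega>. of_real (H \<omega>) * (z * of_real (2 * pi * (\<omega> \<bullet> \<xi>))) ^ k / fact k \<partial>sphere_measure) =
      z ^ k * of_real (?a k)" .
  qed
  finally have s: "(\<lambda>k. z ^ k * of_real (?a k)) sums
    (\<integral>\<omega>. of_real (H \<omega>) * exp (z * of_real (2 * pi * (\<omega> \<bullet> \<xi>))) \<partial>sphere_measure)" .
  have "(\<lambda>j. z ^ (l + 2 * j) * of_real (?a (l + 2 * j))) sums
    (\<integral>\<omega>. of_real (H \<omega>) * exp (z * of_real (2 * pi * (\<omega> \<bullet> \<xi>))) \<partial>sphere_measure)"
  proof (subst sums_mono_reindex[where f="\<lambda>k. z ^ k * of_real (?a k)"])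
    show "z ^ k * of_real (?a k) = 0" if "k \<notin> range (\<lambda>j. l + 2 * j)" for k
      by (subst spherical_moments[OF H]) (use that in simp)
  qed (use s in \<open>auto simp: strict_mono_def\<close>)
  moreover have "?a (l + 2 * j) = H \<xi> * ((pi * (norm \<xi>)\<^sup>2) ^ j / fact j / gaussian_moment TYPE('a) (2 * l + 2 * j))" for j
    by (subst spherical_moments[OF H]) (auto simp: mult_2 add.assoc)
  ultimately show ?thesis by (simp only:)
qed

text \<open>The character \<open>exp (- 2 \<pi> \<i> t)\<close> in the normalisation of the Fourier transform.\<close>

definition wave :: "real \<Rightarrow> complex" where
  "wave t = exp (- 2 * of_real pi * \<i> * of_real t)"

lemma wave_continuous [continuous_intros]: "continuous_on S f \<Longrightarrow> continuous_on S (\<lambda>x. wave (f x))"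
  unfolding wave_def by (intro continuous_intros)

lemma wave_measurable [measurable]: "wave \<in> borel_measurable borel"
  by (intro borel_measurable_continuous_onI continuous_intros)

lemma norm_wave [simp]: "norm (wave t) = 1"
  by (simp add: wave_def norm_exp_eq_Re)

text \<open>The Fourier transform of the normalised surface measure in the dimension of \<open>'m\<close>, as a function of
the radius. Up to scaling this is a Bessel function of the first kind divided by a power of its
argument; only its series is needed.\<close>

definition bessel_kernel :: "'m::euclidean_space itself \<Rightarrow> real \<Rightarrow> real" where
  "bessel_kernel _ w = (\<Sum>j. (- pi * w\<^sup>2) ^ j / fact j / gaussian_moment TYPE('m) (2 * j))"

lemma homogeneous_harmonic_one: "homogeneous_harmonic_polynomial 0 (\<lambda>x::'a::euclidean_space. 1)"
  by (auto simp: homogeneous_harmonic_polynomial_def laplacian_def numeral_2_eq_2)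

lemma spherical_wave_series:
  "(\<lambda>j. complex_of_real ((- pi * (\<rho> * norm \<eta>)\<^sup>2) ^ j / fact j / gaussian_moment TYPE('m) (2 * j))) sums
    (\<integral>\<omega>. wave (\<rho> * (\<omega> \<bullet> \<eta>)) \<partial>(sphere_measure :: 'm::euclidean_space measure))"
proof -
  have "(\<lambda>j. (- \<i> * of_real \<rho>) ^ (0 + 2 * j) * of_real (1 * ((pi * (norm \<eta>)\<^sup>2) ^ j / fact j / gaussian_moment TYPE('m) (2 * 0 + 2 * j)))) sums
    (\<integral>\<omega>. of_real 1 * exp ((- \<i> * of_real \<rho>) * of_real (2 * pi * (\<omega> \<bullet> \<eta>))) \<partial>(sphere_measure :: 'm measure))"
    by (rule spherical_exp_series[OF homogeneous_harmonic_one])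
  also have "(\<lambda>j. (- \<i> * of_real \<rho>) ^ (0 + 2 * j) * of_real (1 * ((pi * (norm \<eta>)\<^sup>2) ^ j / fact j / gaussian_moment TYPE('m) (2 * 0 + 2 * j)))) =
    (\<lambda>j. complex_of_real ((- pi * (\<rho> * norm \<eta>)\<^sup>2) ^ j / fact j / gaussian_moment TYPE('m) (2 * j)))"
  proof
    fix j
    have "(- \<i> * complex_of_real \<rho>) ^ (0 + 2 * j) = of_real ((- (\<rho>\<^sup>2)) ^ j)"
      by (simp add: power_mult power_mult_distrib)
    moreover have "(- pi * (\<rho> * norm \<eta>)\<^sup>2) ^ j = (- (\<rho>\<^sup>2)) ^ j * (pi * (norm \<eta>)\<^sup>2) ^ j"
      unfolding power_mult_distrib[symmetric] by (simp add: algebra_simps power_mult_distrib)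
    ultimately show "(- \<i> * of_real \<rho>) ^ (0 + 2 * j) * of_real (1 * ((pi * (norm \<eta>)\<^sup>2) ^ j / fact j / gaussian_moment TYPE('m) (2 * 0 + 2 * j))) =
      complex_of_real ((- pi * (\<rho> * norm \<eta>)\<^sup>2) ^ j / fact j / gaussian_moment TYPE('m) (2 * j))"
      by simp
  qed
  finally show ?thesis
    by (simp add: wave_def mult_ac)
qed

lemma bessel_kernel_series:
  "(\<lambda>j. (- pi * w\<^sup>2) ^ j / fact j / gaussian_moment TYPE('m::euclidean_space) (2 * j)) sums bessel_kernel TYPE('m) w"
proof -
  obtain e :: 'm where e: "norm e = 1" using vector_choose_size[of 1] by auto
  have "summable (\<lambda>j. complex_of_real ((- pi * w\<^sup>2) ^ j / fact j / gaussian_moment TYPE('m) (2 * j)))"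
    using sums_summable[OF spherical_wave_series[of w e]] e by simp
  then have "summable (\<lambda>j. (- pi * w\<^sup>2) ^ j / fact j / gaussian_moment TYPE('m) (2 * j))"
    by (subst (asm) summable_of_real_iff)
  then show ?thesis
    unfolding bessel_kernel_def by (rule summable_sums)
qed

lemma spherical_wave_mean:
  "(\<integral>\<omega>. wave (\<rho> * (\<omega> \<bullet> \<eta>)) \<partial>(sphere_measure :: 'm::euclidean_space measure)) =
    of_real (bessel_kernel TYPE('m) (\<rho> * norm \<eta>))"
  using sums_unique2[OF spherical_wave_series sums_of_real[OF bessel_kernel_series]] .

lemma bessel_kernel_le_1: "\<bar>bessel_kernel TYPE('m::euclidean_space) w\<bar> \<le> 1"
proof -
  obtain e :: 'm where e: "norm e = 1" using vector_choose_size[of 1] by auto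
  have "cmod (\<integral>\<omega>. wave (w * (\<omega> \<bullet> e)) \<partial>(sphere_measure :: 'm measure)) \<le> (\<integral>\<omega>. norm (wave (w * (\<omega> \<bullet> e))) \<partial>(sphere_measure :: 'm measure))"
    by (rule integral_norm_bound)
  then show ?thesis using sphere.prob_space[where 'a='m] by (simp add: spherical_wave_mean e)
qed

lemma bessel_kernel_measurable [measurable]: "bessel_kernel TYPE('m::euclidean_space) \<in> borel_measurable borel"
  unfolding bessel_kernel_def[abs_def] by measurable

text \<open>Term by term, the series for \<open>H\<close> in dimension \<open>n\<close> is \<open>H \<xi>\<close> times the series of the kernel in dimension
\<open>n + 2 * l\<close>, because the radial moments of orders \<open>2 * l + 2 * j\<close> and \<open>2 * j\<close> in these two
dimensions are proportional. This is where the dimension shift happens.\<close>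

theorem funk_hecke:
  fixes H :: "'n::euclidean_space \<Rightarrow> real"
  assumes H: "homogeneous_harmonic_polynomial l H" and dim: "DIM('m::euclidean_space) = DIM('n) + 2 * l"
  shows "(\<integral>\<omega>. of_real (H \<omega>) * wave (\<rho> * (\<omega> \<bullet> \<xi>)) \<partial>sphere_measure) =
    (- \<i>) ^ l * of_real (\<rho> ^ l * H \<xi> * bessel_kernel TYPE('m) (\<rho> * norm \<xi>) / dim_ratio DIM('n) DIM('m))"
proof -
  let ?\<kappa> = "dim_ratio DIM('n) DIM('m)"
  let ?s = "\<lambda>j. (- pi * (\<rho> * norm \<xi>)\<^sup>2) ^ j / fact j / gaussian_moment TYPE('m) (2 * j)"
  let ?t = "\<lambda>j. (- \<i> * of_real \<rho>) ^ (l + 2 * j) * of_real (H \<xi> * ((pi * (norm \<xi>)\<^sup>2) ^ j / fact j / gaussian_moment TYPE('n) (2 * l + 2 * j)))"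
  have k: "?\<kappa> > 0" by (simp add: dim_ratio_pos)
  have 1: "?t sums (\<integral>\<omega>. of_real (H \<omega>) * exp ((- \<i> * of_real \<rho>) * of_real (2 * pi * (\<omega> \<bullet> \<xi>))) \<partial>sphere_measure)"
    by (rule spherical_exp_series[OF H])
  have "(\<lambda>j. (- \<i>) ^ l * complex_of_real (\<rho> ^ l * H \<xi> * ?s j / ?\<kappa>)) sums
    ((- \<i>) ^ l * of_real (\<rho> ^ l * H \<xi> * bessel_kernel TYPE('m) (\<rho> * norm \<xi>) / ?\<kappa>))"
    by (intro sums_mult sums_of_real sums_divide bessel_kernel_series)
  moreover have "(- \<i>) ^ l * complex_of_real (\<rho> ^ l * H \<xi> * ?s j / ?\<kappa>) = ?t j" for j
  proof -
    have "(- \<i> * complex_of_real \<rho>) ^ (2 * j) = of_real ((- (\<rho>\<^sup>2)) ^ j)"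
      by (simp add: power_mult power_mult_distrib)
    then have "(- \<i> * complex_of_real \<rho>) ^ (l + 2 * j) = (- \<i>) ^ l * of_real (\<rho> ^ l * (- (\<rho>\<^sup>2)) ^ j)"
      unfolding power_add power_mult_distrib[of "- \<i>" "complex_of_real \<rho>" l] by simp
    moreover have "(- pi * (\<rho> * norm \<xi>)\<^sup>2) ^ j = (- (\<rho>\<^sup>2)) ^ j * (pi * (norm \<xi>)\<^sup>2) ^ j"
      unfolding power_mult_distrib[symmetric] by (simp add: algebra_simps power_mult_distrib)
    ultimately show ?thesis
      by (simp add: gaussian_moment_shift[OF dim] divide_simps)
  qed
  ultimately have "?t sums ((- \<i>) ^ l * of_real (\<rho> ^ l * H \<xi> * bessel_kernel TYPE('m) (\<rho> * norm \<xi>) / ?\<kappa>))"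
    by simp
  from sums_unique2[OF 1 this] show ?thesis
    by (simp add: wave_def mult_ac)
qed

section \<open>Bochner's relation and the projection onto a harmonic polynomial\<close>

lemma fourier_eq_lborel:
  assumes [measurable]: "f \<in> borel_measurable borel"
  shows "fourier f \<xi> = (\<integral>x. wave (x \<bullet> \<xi>) * f x \<partial>lborel)"
  unfolding fourier_def wave_def[symmetric]
  by (rule integral_completion) measurable

lemma wave_mult_integrable:
  fixes f :: "'a \<Rightarrow> complex"
  assumes f: "integrable M f" and [measurable]: "u \<in> borel_measurable M"
  shows "integrable M (\<lambda>x. wave (u x) * f x)"
  by (rule Bochner_Integration.integrable_bound[OF f]) (use f in \<open>auto simp: norm_mult\<close>)

lemma fourier_continuous:
  fixes f :: "'a::euclidean_space \<Rightarrow> complex"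
  assumes f: "integrable lborel f"
  shows "continuous_on UNIV (fourier f)"
  unfolding continuous_on_sequentially
proof (intro allI impI ballI, elim conjE)
  fix X :: "nat \<Rightarrow> 'a" and \<xi> assume lim: "X \<longlonglongrightarrow> \<xi>"
  have m[measurable]: "f \<in> borel_measurable borel" using f borel_measurable_integrable by fastforce
  have "(\<lambda>n. \<integral>x. wave (x \<bullet> X n) * f x \<partial>lborel) \<longlonglongrightarrow> (\<integral>x. wave (x \<bullet> \<xi>) * f x \<partial>lborel)"
  proof (rule integral_dominated_convergence[where w="\<lambda>x. norm (f x)"])
    show "AE x in lborel. (\<lambda>n. wave (x \<bullet> X n) * f x) \<longlonglongrightarrow> wave (x \<bullet> \<xi>) * f x"
      unfolding wave_def by (intro AE_I2 tendsto_intros lim)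
  qed (use f in \<open>auto simp: norm_mult\<close>)
  then show "(fourier f \<circ> X) \<longlonglongrightarrow> fourier f \<xi>"
    by (simp add: o_def fourier_eq_lborel)
qed

lemma homogeneous_bound:
  fixes H :: "'a::euclidean_space \<Rightarrow> real"
  assumes H: "homogeneous_harmonic_polynomial l H"
  obtains C where "C \<ge> 0" "\<And>x. \<bar>H x\<bar> \<le> C * norm x ^ l"
proof -
  note HD = homogeneous_harmonicD[OF H]
  have "compact (H ` cball 0 1)"
    by (intro compact_continuous_image continuous_on_subset[OF HD(2)]) auto
  then have "bounded (H ` cball 0 1)" by (rule compact_imp_bounded)
  then obtain C where C: "\<forall>y\<in>H ` cball 0 1. norm y \<le> C" unfolding bounded_iff by blast
  have "\<bar>H x\<bar> \<le> C * norm x ^ l" for x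
  proof -
    have "H x = norm x ^ l * H (sgn x)"
      by (cases "x = 0") (use HD(4)[of 0 0] HD(4)[of "norm x" "sgn x"] in \<open>auto simp: sgn_div_norm\<close>)
    moreover have "\<bar>H (sgn x)\<bar> \<le> C" using C by (auto simp: norm_sgn)
    ultimately show ?thesis
      using mult_left_mono[of "\<bar>H (sgn x)\<bar>" C "norm x ^ l"] by (simp add: abs_mult mult.commute)
  qed
  moreover have "C \<ge> 0" using C by (intro order_trans[OF norm_ge_zero[of "H 0"]]) auto
  ultimately show thesis using that by blast
qed

lemma integral_sphere_cong:
  fixes f g :: "'a::euclidean_space \<Rightarrow> 'b::{banach, second_countable_topology}"
  assumes "f \<in> borel_measurable borel" "g \<in> borel_measurable borel" "\<And>\<omega>. norm \<omega> = 1 \<Longrightarrow> f \<omega> = g \<omega>"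
  shows "integral\<^sup>L sphere_measure f = integral\<^sup>L sphere_measure g"
  using assms by (intro integral_cong_AE) (auto intro: AE_mp[OF AE_sphere_measure])

text \<open>Bochner's relation. Integrating over spheres first replaces the character by the kernel of dimension
\<open>n + 2 * l\<close>; the powers of the radius left over turn the radial integral into one over the
larger space.\<close>

theorem fourier_harmonic_times_radial:
  fixes H :: "'n::euclidean_space \<Rightarrow> real" and f0 :: "real \<Rightarrow> real"
  assumes H: "homogeneous_harmonic_polynomial l H" and dim: "DIM('m::euclidean_space) = DIM('n) + 2 * l"
    and f0[measurable]: "f0 \<in> borel_measurable borel"
    and g: "integrable lborel (\<lambda>x. H x * f0 (norm x))"
  shows "fourier (\<lambda>x. of_real (H x * f0 (norm x))) \<xi> =
    (- \<i>) ^ l * of_real (H \<xi> * integral\<^sup>L lborel (\<lambda>y::'m. f0 (norm y) * bessel_kernel TYPE('m) (norm y * norm \<xi>)))"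
proof -
  note HD = homogeneous_harmonicD[OF H]
  have [measurable]: "H \<in> borel_measurable borel" by (rule HD)
  let ?\<kappa> = "dim_ratio DIM('n) DIM('m)"
  have k: "?\<kappa> > 0" by (simp add: dim_ratio_pos)
  let ?\<phi> = "\<lambda>x. wave (x \<bullet> \<xi>) * complex_of_real (H x * f0 (norm x))"
  define \<psi> where "\<psi> r = H \<xi> / ?\<kappa> * (f0 r * bessel_kernel TYPE('m) (r * norm \<xi>))" for r
  have [measurable]: "\<psi> \<in> borel_measurable borel" unfolding \<psi>_def[abs_def] by measurable
  have int: "integrable lborel ?\<phi>"
    by (intro wave_mult_integrable integrable_of_real g) measurable
  have mean: "(\<integral>\<omega>. ?\<phi> (norm x *\<^sub>R \<omega>) \<partial>sphere_measure) = (- \<i>) ^ l * of_real (norm x ^ (2 * l) *\<^sub>R \<psi> (norm x))" for x :: 'n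
  proof -
    let ?r = "norm x"
    have r2: "complex_of_real ?r ^ (l * 2) = of_real ?r ^ l * of_real ?r ^ l" by (simp add: mult_2_right power_add)
    have "(\<integral>\<omega>. ?\<phi> (?r *\<^sub>R \<omega>) \<partial>sphere_measure) =
      (\<integral>\<omega>. of_real (?r ^ l * f0 ?r) * (of_real (H \<omega>) * wave (?r * (\<omega> \<bullet> \<xi>))) \<partial>sphere_measure)"
      by (rule integral_sphere_cong) (auto simp: HD(4))
    also have "\<dots> = of_real (?r ^ l * f0 ?r) * (\<integral>\<omega>. of_real (H \<omega>) * wave (?r * (\<omega> \<bullet> \<xi>)) \<partial>sphere_measure)"
      by (rule integral_mult_right_zero)
    also have "\<dots> = (- \<i>) ^ l * of_real (?r ^ (2 * l) *\<^sub>R \<psi> ?r)"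
      by (simp add: funk_hecke[OF H dim] \<psi>_def r2 mult_ac)
    finally show ?thesis .
  qed
  have "fourier (\<lambda>x. of_real (H x * f0 (norm x))) \<xi> = integral\<^sup>L lborel ?\<phi>"
    by (rule fourier_eq_lborel) measurable
  also have "\<dots> = integral\<^sup>L lborel (\<lambda>x::'n. (- \<i>) ^ l * complex_of_real (norm x ^ (2 * l) *\<^sub>R \<psi> (norm x)))"
    by (subst spherical_mean_integrable(2)[OF int, symmetric]) (simp only: mean)
  also have "\<dots> = (- \<i>) ^ l * of_real (integral\<^sup>L lborel (\<lambda>x::'n. norm x ^ (2 * l) *\<^sub>R \<psi> (norm x)))"
    by (subst integral_mult_right_zero, subst integral_complex_of_real) simp
  also have "integral\<^sup>L lborel (\<lambda>x::'n. norm x ^ (2 * l) *\<^sub>R \<psi> (norm x)) =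
      ?\<kappa> *\<^sub>R integral\<^sup>L lborel (\<lambda>y::'m. \<psi> (norm y))"
    by (rule radial_shift(2)[OF dim]) measurable
  also have "\<dots> = H \<xi> * integral\<^sup>L lborel (\<lambda>y::'m. f0 (norm y) * bessel_kernel TYPE('m) (norm y * norm \<xi>))"
    using k by (simp add: \<psi>_def)
  finally show ?thesis .
qed

corollary fourier_radial:
  fixes f0 :: "real \<Rightarrow> real"
  assumes "f0 \<in> borel_measurable borel" "integrable lborel (\<lambda>y::'m::euclidean_space. f0 (norm y))"
  shows "fourier (\<lambda>y::'m. of_real (f0 (norm y))) \<eta> =
    of_real (integral\<^sup>L lborel (\<lambda>y::'m. f0 (norm y) * bessel_kernel TYPE('m) (norm y * norm \<eta>)))"
  using fourier_harmonic_times_radial[OF homogeneous_harmonic_one, where 'm='m, of f0 \<eta>] assms by simp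

text \<open>Near the origin the continuous profile is bounded; away from it \<open>norm x ^ l\<close> is at most
\<open>norm x ^ (2 * l)\<close>, which is the weight that integrability in the larger space provides.\<close>

lemma harmonic_lift_integrable:
  fixes H :: "'n::euclidean_space \<Rightarrow> real" and f0 :: "real \<Rightarrow> real"
  assumes H: "homogeneous_harmonic_polynomial l H" and dim: "DIM('m::euclidean_space) = DIM('n) + 2 * l"
    and f0: "continuous_on UNIV f0" and F: "integrable lborel (\<lambda>y::'m. f0 (norm y))"
  shows "integrable lborel (\<lambda>x. H x * f0 (norm x))"
proof -
  note HD = homogeneous_harmonicD[OF H]
  have [measurable]: "H \<in> borel_measurable borel" by (rule HD)
  have [measurable]: "f0 \<in> borel_measurable borel" using f0 by (rule borel_measurable_continuous_onI)
  obtain C where C: "C \<ge> 0" "\<And>x. \<bar>H x\<bar> \<le> C * norm x ^ l" using homogeneous_bound[OF H] by blast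
  have "compact (f0 ` {0..1})" by (intro compact_continuous_image continuous_on_subset[OF f0]) auto
  then have "bounded (f0 ` {0..1})" by (rule compact_imp_bounded)
  then obtain B where B: "\<forall>y\<in>f0 ` {0..1}. norm y \<le> B" unfolding bounded_iff by blast
  show ?thesis
  proof (rule Bochner_Integration.integrable_bound)
    have "integrable lborel (\<lambda>x::'n. norm x ^ (2 * l) *\<^sub>R \<bar>f0 (norm x)\<bar>)"
      by (subst radial_shift(1)[OF dim, of "\<lambda>r. \<bar>f0 r\<bar>"]) (use F in auto)
    moreover have "integrable lborel (\<lambda>x::'n. B * indicator (cball 0 1) x)"
      by (auto simp: emeasure_cball)
    ultimately show "integrable lborel (\<lambda>x::'n. C * (B * indicator (cball 0 1) x + norm x ^ (2 * l) *\<^sub>R \<bar>f0 (norm x)\<bar>))"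
      by (rule integrable_mult_right[OF Bochner_Integration.integrable_add, rotated])
    show "AE x in lborel. norm (H x * f0 (norm x)) \<le> norm (C * (B * indicator (cball 0 1) x + norm x ^ (2 * l) *\<^sub>R \<bar>f0 (norm x)\<bar>))"
    proof (rule AE_I2)
      fix x :: 'n
      have "norm x ^ l * \<bar>f0 (norm x)\<bar> \<le> B * indicator (cball 0 1) x + norm x ^ (2 * l) * \<bar>f0 (norm x)\<bar>"
      proof (cases "norm x \<le> 1")
        case True
        then have "norm x ^ l \<le> 1" "\<bar>f0 (norm x)\<bar> \<le> B" using B by (auto intro: power_le_one)
        then have "norm x ^ l * \<bar>f0 (norm x)\<bar> \<le> 1 * B" by (intro mult_mono) auto
        then show ?thesis using True by (auto intro: add_increasing2)
      next
        case False
        then have "norm x ^ l \<le> norm x ^ (2 * l)" by (intro power_increasing) auto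
        then show ?thesis using False by (auto intro: mult_right_mono)
      qed
      then have "C * (norm x ^ l * \<bar>f0 (norm x)\<bar>) \<le> C * (B * indicator (cball 0 1) x + norm x ^ (2 * l) * \<bar>f0 (norm x)\<bar>)"
        using C(1) by (rule mult_left_mono)
      moreover have "\<bar>H x\<bar> * \<bar>f0 (norm x)\<bar> \<le> C * norm x ^ l * \<bar>f0 (norm x)\<bar>"
        by (intro mult_right_mono C) auto
      ultimately have "\<bar>H x\<bar> * \<bar>f0 (norm x)\<bar> \<le> C * (B * indicator (cball 0 1) x + norm x ^ (2 * l) * \<bar>f0 (norm x)\<bar>)"
        by (simp only: mult.assoc)
      then show "norm (H x * f0 (norm x)) \<le> norm (C * (B * indicator (cball 0 1) x + norm x ^ (2 * l) *\<^sub>R \<bar>f0 (norm x)\<bar>))"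
        by (simp add: abs_mult[symmetric])
    qed
  qed measurable
qed

theorem harmonic_lift:
  fixes H :: "'n::euclidean_space \<Rightarrow> real" and f0 :: "real \<Rightarrow> real"
  assumes H: "homogeneous_harmonic_polynomial l H" and dim: "DIM('m::euclidean_space) = DIM('n) + 2 * l"
    and f0: "continuous_on UNIV f0" and F: "integrable lborel (\<lambda>y::'m. f0 (norm y))"
    and eig: "\<And>\<eta>::'m. fourier (\<lambda>y::'m. of_real (f0 (norm y))) \<eta> = of_real (s * f0 (norm \<eta>))"
  shows "fourier (\<lambda>x. of_real (H x * f0 (norm x))) \<xi> = (- \<i>) ^ l * of_real (s * (H \<xi> * f0 (norm \<xi>)))"
proof -
  have [measurable]: "f0 \<in> borel_measurable borel" using f0 by (rule borel_measurable_continuous_onI)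
  obtain \<eta> :: 'm where \<eta>: "norm \<eta> = norm \<xi>" using vector_choose_size[of "norm \<xi>"] by auto
  have "integral\<^sup>L lborel (\<lambda>y::'m. f0 (norm y) * bessel_kernel TYPE('m) (norm y * norm \<xi>)) = s * f0 (norm \<xi>)"
    using eig[of \<eta>] fourier_radial[OF _ F, of \<eta>] by (simp add: \<eta> flip: of_real_mult)
  then show ?thesis
    using fourier_harmonic_times_radial[OF H dim _ harmonic_lift_integrable[OF H dim f0 F], of \<xi>] by simp
qed

text \<open>The radial function on the larger space that corresponds to the component of \<open>g\<close> along \<open>H\<close>.
It inverts the map that sends a profile \<open>f0\<close> to \<open>H x * f0 (norm x)\<close>, up to the square mean of \<open>H\<close> on
the sphere. For \<open>H = 1\<close> it is the spherical mean.\<close>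

definition harmonic_profile :: "nat \<Rightarrow> ('n::euclidean_space \<Rightarrow> real) \<Rightarrow> ('n \<Rightarrow> real) \<Rightarrow> real \<Rightarrow> real" where
  "harmonic_profile l H g r = (\<integral>\<omega>. H \<omega> * g (r *\<^sub>R \<omega>) \<partial>sphere_measure) / r ^ l"

lemma harmonic_profile_measurable [measurable]:
  fixes H g :: "'n::euclidean_space \<Rightarrow> real"
  assumes [measurable]: "H \<in> borel_measurable borel" "g \<in> borel_measurable borel"
  shows "harmonic_profile l H g \<in> borel_measurable borel"
  unfolding harmonic_profile_def[abs_def] by measurable

lemma harmonic_profile_integral:
  fixes H g :: "'n::euclidean_space \<Rightarrow> real" and \<phi> :: "real \<Rightarrow> real"
  assumes H: "homogeneous_harmonic_polynomial l H" and dim: "DIM('m::euclidean_space) = DIM('n) + 2 * l"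
    and [measurable]: "g \<in> borel_measurable borel" "\<phi> \<in> borel_measurable borel"
    and int: "integrable lborel (\<lambda>x. H x * g x * \<phi> (norm x))"
  shows "integrable lborel (\<lambda>y::'m. harmonic_profile l H g (norm y) * \<phi> (norm y))"
    and "(\<integral>x. H x * g x * \<phi> (norm x) \<partial>lborel) =
      dim_ratio DIM('n) DIM('m) * integral\<^sup>L lborel (\<lambda>y::'m. harmonic_profile l H g (norm y) * \<phi> (norm y))"
proof -
  note HD = homogeneous_harmonicD[OF H]
  have [measurable]: "H \<in> borel_measurable borel" by (rule HD)
  let ?\<psi> = "\<lambda>r. harmonic_profile l H g r * \<phi> r"
  have mean: "(\<integral>\<omega>. H (norm x *\<^sub>R \<omega>) * g (norm x *\<^sub>R \<omega>) * \<phi> (norm (norm x *\<^sub>R \<omega>)) \<partial>sphere_measure) =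
    norm x ^ (2 * l) *\<^sub>R ?\<psi> (norm x)" for x :: 'n
  proof -
    let ?r = "norm x"
    have "(\<integral>\<omega>. H (?r *\<^sub>R \<omega>) * g (?r *\<^sub>R \<omega>) * \<phi> (norm (?r *\<^sub>R \<omega>)) \<partial>sphere_measure) =
      (\<integral>\<omega>. ?r ^ l * \<phi> ?r * (H \<omega> * g (?r *\<^sub>R \<omega>)) \<partial>sphere_measure)"
      by (rule integral_sphere_cong) (auto simp: HD(4))
    also have "\<dots> = ?r ^ l * \<phi> ?r * (\<integral>\<omega>. H \<omega> * g (?r *\<^sub>R \<omega>) \<partial>sphere_measure)"
      by (rule integral_mult_right_zero)
    also have "\<dots> = norm x ^ (2 * l) *\<^sub>R ?\<psi> (norm x)"
      by (cases "x = 0"; cases "l = 0") (auto simp: harmonic_profile_def mult_2 power_add)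
    finally show ?thesis .
  qed
  have "integrable lborel (\<lambda>x::'n. norm x ^ (2 * l) *\<^sub>R ?\<psi> (norm x))"
    using spherical_mean_integrable(1)[OF int] by (simp only: mean)
  then show "integrable lborel (\<lambda>y::'m. ?\<psi> (norm y))"
    by (subst (asm) radial_shift(1)[OF dim, of ?\<psi>]) auto
  have "(\<integral>x. H x * g x * \<phi> (norm x) \<partial>lborel) = integral\<^sup>L lborel (\<lambda>x::'n. norm x ^ (2 * l) *\<^sub>R ?\<psi> (norm x))"
    by (subst spherical_mean_integrable(2)[OF int, symmetric]) (simp only: mean)
  also have "\<dots> = dim_ratio DIM('n) DIM('m) * integral\<^sup>L lborel (\<lambda>y::'m. ?\<psi> (norm y))"
    by (subst radial_shift(2)[OF dim]) auto
  finally show "(\<integral>x. H x * g x * \<phi> (norm x) \<partial>lborel) =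
      dim_ratio DIM('n) DIM('m) * integral\<^sup>L lborel (\<lambda>y::'m. ?\<psi> (norm y))" .
qed

text \<open>Evaluate the spherical integral of \<open>H\<close> times the transform of \<open>g\<close> in two ways: by the eigenvalue
equation it is a multiple of the profile of \<open>g\<close>, and after exchanging integrals the Funk-Hecke formula makes it a
multiple of the transform of the profile. The powers of the radius are cancelled at the end, which
requires \<open>\<eta> \<noteq> 0\<close>.\<close>

theorem fourier_harmonic_profile:
  fixes H g :: "'n::euclidean_space \<Rightarrow> real"
  assumes H: "homogeneous_harmonic_polynomial l H" and dim: "DIM('m::euclidean_space) = DIM('n) + 2 * l"
    and g: "integrable lborel g" and Hg: "integrable lborel (\<lambda>x. H x * g x)"
    and eig: "\<And>\<xi>. fourier (\<lambda>x. of_real (g x)) \<xi> = (- \<i>) ^ l * of_real (s * g \<xi>)"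
    and \<eta>: "\<eta> \<noteq> (0::'m)"
  shows "fourier (\<lambda>y::'m. of_real (harmonic_profile l H g (norm y))) \<eta> = of_real (s * harmonic_profile l H g (norm \<eta>))"
proof -
  note HD = homogeneous_harmonicD[OF H]
  have [measurable]: "H \<in> borel_measurable borel" by (rule HD)
  have [measurable]: "g \<in> borel_measurable borel" using g borel_measurable_integrable by fastforce
  let ?\<tau> = "norm \<eta>" let ?\<kappa> = "dim_ratio DIM('n) DIM('m)"
  let ?k = "\<lambda>r. bessel_kernel TYPE('m) (r * ?\<tau>)"
  have k: "?\<kappa> > 0" by (simp add: dim_ratio_pos)
  have F: "integrable lborel (\<lambda>y::'m. harmonic_profile l H g (norm y))"
    using harmonic_profile_integral(1)[OF H dim, of g "\<lambda>_. 1"] Hg by simp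
  have Hgk: "integrable lborel (\<lambda>x. H x * g x * ?k (norm x))"
  proof (rule Bochner_Integration.integrable_bound[OF Hg])
    show "AE x in lborel. norm (H x * g x * ?k (norm x)) \<le> norm (H x * g x)"
      using bessel_kernel_le_1[where 'm='m] by (intro AE_I2) (simp add: abs_mult mult_left_le)
  qed measurable
  let ?I = "integral\<^sup>L lborel (\<lambda>y::'m. harmonic_profile l H g (norm y) * ?k (norm y))"
  interpret L: pair_sigma_finite "sphere_measure :: 'n measure" "lborel :: 'n measure" ..
  let ?\<Phi> = "\<lambda>\<omega> x. complex_of_real (H \<omega>) * (wave (x \<bullet> (?\<tau> *\<^sub>R \<omega>)) * of_real (g x))"
  have iH: "integrable sphere_measure (\<lambda>\<omega>. norm (H \<omega>))"
    by (intro sphere_integrable_continuous continuous_intros HD)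
  have fub: "integrable (sphere_measure \<Otimes>\<^sub>M lborel) (\<lambda>(\<omega>, x). ?\<Phi> \<omega> x)"
  proof (rule L.Fubini_integrable)
    show "integrable sphere_measure (\<lambda>\<omega>. \<integral>x. norm (case (\<omega>, x) of (\<omega>, x) \<Rightarrow> ?\<Phi> \<omega> x) \<partial>lborel)"
      using iH by (simp add: norm_mult)
    show "AE \<omega> in sphere_measure. integrable lborel (\<lambda>x. case (\<omega>, x) of (\<omega>, x) \<Rightarrow> ?\<Phi> \<omega> x)"
    proof (rule AE_I2)
      fix \<omega> :: 'n
      show "integrable lborel (\<lambda>x. case (\<omega>, x) of (\<omega>, x) \<Rightarrow> ?\<Phi> \<omega> x)"
        unfolding prod.case using g by (intro integrable_mult_right wave_mult_integrable integrable_of_real) auto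
    qed
  qed measurable
  have "(- \<i>) ^ l * of_real (s * (\<integral>\<omega>. H \<omega> * g (?\<tau> *\<^sub>R \<omega>) \<partial>sphere_measure)) =
      (\<integral>\<omega>. (- \<i>) ^ l * of_real s * complex_of_real (H \<omega> * g (?\<tau> *\<^sub>R \<omega>)) \<partial>sphere_measure)"
    by (subst integral_mult_right_zero, subst integral_complex_of_real) simp
  also have "\<dots> = (\<integral>\<omega>. of_real (H \<omega>) * fourier (\<lambda>x. of_real (g x)) (?\<tau> *\<^sub>R \<omega>) \<partial>sphere_measure)"
    by (simp add: eig mult_ac)
  also have "\<dots> = (\<integral>\<omega>. (\<integral>x. ?\<Phi> \<omega> x \<partial>lborel) \<partial>sphere_measure)"
    by (subst fourier_eq_lborel) (simp_all only: integral_mult_right_zero, measurable)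
  also have "\<dots> = (\<integral>x. (\<integral>\<omega>. ?\<Phi> \<omega> x \<partial>sphere_measure) \<partial>lborel)"
    by (rule L.Fubini_integral[OF fub, symmetric])
  also have "\<dots> = (\<integral>x. (- \<i>) ^ l * of_real (?\<tau> ^ l / ?\<kappa>) * complex_of_real (H x * g x * ?k (norm x)) \<partial>lborel)"
  proof (intro Bochner_Integration.integral_cong refl)
    fix x
    have "(\<integral>\<omega>. ?\<Phi> \<omega> x \<partial>sphere_measure) = (\<integral>\<omega>. of_real (g x) * (of_real (H \<omega>) * wave (?\<tau> * (\<omega> \<bullet> x))) \<partial>sphere_measure)"
      by (simp add: mult_ac inner_commute)
    also have "\<dots> = of_real (g x) * (\<integral>\<omega>. of_real (H \<omega>) * wave (?\<tau> * (\<omega> \<bullet> x)) \<partial>sphere_measure)"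
      by (rule integral_mult_right_zero)
    also have "\<dots> = (- \<i>) ^ l * of_real (?\<tau> ^ l / ?\<kappa>) * complex_of_real (H x * g x * ?k (norm x))"
      by (simp add: funk_hecke[OF H dim] mult_ac)
    finally show "(\<integral>\<omega>. ?\<Phi> \<omega> x \<partial>sphere_measure) =
      (- \<i>) ^ l * of_real (?\<tau> ^ l / ?\<kappa>) * complex_of_real (H x * g x * ?k (norm x))" .
  qed
  also have "\<dots> = (- \<i>) ^ l * of_real (?\<tau> ^ l / ?\<kappa>) * of_real (\<integral>x. H x * g x * ?k (norm x) \<partial>lborel)"
    by (subst integral_mult_right_zero, subst integral_complex_of_real) simp
  also have "(\<integral>x. H x * g x * ?k (norm x) \<partial>lborel) = ?\<kappa> * ?I"
    by (rule harmonic_profile_integral(2)[OF H dim _ _ Hgk]) measurable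
  finally have "(- \<i>) ^ l * complex_of_real (s * (\<integral>\<omega>. H \<omega> * g (?\<tau> *\<^sub>R \<omega>) \<partial>sphere_measure)) =
      (- \<i>) ^ l * of_real (?\<tau> ^ l * ?I)"
    using k by (simp add: mult.assoc)
  then have "s * (\<integral>\<omega>. H \<omega> * g (?\<tau> *\<^sub>R \<omega>) \<partial>sphere_measure) = ?\<tau> ^ l * ?I"
    by (simp only: mult_cancel_left of_real_eq_iff) auto
  then have "?I = s * harmonic_profile l H g ?\<tau>"
    using \<eta> by (simp add: harmonic_profile_def field_simps)
  then show ?thesis
    using fourier_radial[OF _ F, of \<eta>] by simp
qed

text \<open>The profile itself may be badly behaved at radius 0. But for positive radii it equals \<open>s\<close> times its
own Fourier transform, which is continuous everywhere; taking this as the definition of \<open>f0\<close>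
changes the function only at the origin, a null set, and gives a continuous eigenfunction.\<close>

theorem harmonic_projection:
  fixes H g :: "'n::euclidean_space \<Rightarrow> real"
  assumes H: "homogeneous_harmonic_polynomial l H" and dim: "DIM('m::euclidean_space) = DIM('n) + 2 * l"
    and g: "integrable lborel g" and Hg: "integrable lborel (\<lambda>x. H x * g x)"
    and s: "s * s = 1"
    and eig: "\<And>\<xi>. fourier (\<lambda>x. of_real (g x)) \<xi> = (- \<i>) ^ l * of_real (s * g \<xi>)"
  obtains f0 where "continuous_on UNIV f0" "integrable lborel (\<lambda>y::'m. f0 (norm y))"
    "\<And>\<eta>::'m. fourier (\<lambda>y::'m. of_real (f0 (norm y))) \<eta> = of_real (s * f0 (norm \<eta>))"
    "\<And>r. r > 0 \<Longrightarrow> f0 r = harmonic_profile l H g r"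
proof -
  note HD = homogeneous_harmonicD[OF H]
  have [measurable]: "H \<in> borel_measurable borel" by (rule HD)
  have [measurable]: "g \<in> borel_measurable borel" using g borel_measurable_integrable by fastforce
  let ?p = "harmonic_profile l H g"
  have F: "integrable lborel (\<lambda>y::'m. ?p (norm y))"
    using harmonic_profile_integral(1)[OF H dim, of g "\<lambda>_. 1"] Hg by simp
  let ?F = "\<lambda>y::'m. complex_of_real (?p (norm y))"
  have four: "fourier ?F \<eta> = of_real (s * ?p (norm \<eta>))" if "\<eta> \<noteq> 0" for \<eta>
    by (rule fourier_harmonic_profile[OF H dim g Hg eig that])
  have F0: "fourier ?F 0 = of_real (Re (fourier ?F 0))"
    by (simp add: fourier_radial[OF _ F])
  obtain e :: 'm where e: "norm e = 1" using vector_choose_size[of 1] by auto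
  define f0 where "f0 r = s * Re (fourier ?F (r *\<^sub>R e))" for r
  have pos: "f0 r = ?p r" if "r > 0" for r
    using that e s by (subst f0_def, subst four) (auto simp flip: mult.assoc)
  show thesis
  proof
    show cont: "continuous_on UNIV f0"
      unfolding f0_def by (intro continuous_intros continuous_on_compose2[OF fourier_continuous[of ?F]] integrable_of_real F) auto
    have [measurable]: "f0 \<in> borel_measurable borel" using cont by (rule borel_measurable_continuous_onI)
    have ae: "AE y::'m in lborel. ?p (norm y) = f0 (norm y)"
      using AE_lborel_singleton[of 0] by eventually_elim (auto simp: pos)
    show "integrable lborel (\<lambda>y::'m. f0 (norm y))"
      using F integrable_cong_AE[OF _ _ ae] by simp
    show "fourier (\<lambda>y::'m. of_real (f0 (norm y))) \<eta> = of_real (s * f0 (norm \<eta>))" for \<eta> :: 'm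
    proof -
      have "fourier (\<lambda>y::'m. of_real (f0 (norm y))) \<eta> = fourier ?F \<eta>"
        using ae by (subst (1 2) fourier_eq_lborel) (auto intro!: integral_cong_AE elim!: eventually_mono)
      also have "\<dots> = of_real (s * f0 (norm \<eta>))"
      proof (cases "\<eta> = 0")
        case True
        have "s * f0 0 = Re (fourier ?F 0)" using s by (simp add: f0_def flip: mult.assoc)
        then show ?thesis using True F0 by simp
      qed (simp add: four pos)
      finally show ?thesis .
    qed
  qed (rule pos)
qed

text \<open>The transform of a compactly supported function extends to an entire function along the complex
line through \<open>\<xi>\<close>. An eigenfunction has the support of its transform, so this entire function vanishes
on a half-line and therefore everywhere.\<close>

lemma compactly_supported_eigenfunction_zero:
  fixes g :: "'n::euclidean_space \<Rightarrow> real"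
  assumes g: "integrable lborel g" and c: "c \<noteq> 0"
    and eig: "\<And>\<xi>. fourier (\<lambda>x. of_real (g x)) \<xi> = c * of_real (g \<xi>)"
    and supp: "\<And>x. norm x \<ge> R \<Longrightarrow> g x = 0"
    and \<xi>: "\<xi> \<noteq> 0"
  shows "g \<xi> = 0"
proof -
  have [measurable]: "g \<in> borel_measurable borel" using g borel_measurable_integrable by fastforce
  let ?a = "\<lambda>x. - 2 * of_real pi * \<i> * of_real (x \<bullet> \<xi>)"
  define h where "h z = (\<integral>x. of_real (g x) * exp (z * ?a x) \<partial>lborel)" for z
  define m where "m k = (\<integral>x. of_real (g x) * ?a x ^ k / fact k \<partial>lborel)" for k
  have sums: "(\<lambda>k. m k * (z - 0) ^ k) sums h z" for z
  proof -
    have "(\<lambda>k. \<integral>x. of_real (g x) * (z * ?a x) ^ k / fact k \<partial>lborel) sums h z"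
      unfolding h_def
    proof (rule exp_series_integral(1))
      show "integrable lborel (\<lambda>x. cmod (of_real (g x)) * exp (cmod (z * ?a x)))"
      proof (rule Bochner_Integration.integrable_bound)
        show "integrable lborel (\<lambda>x. exp (cmod z * (2 * pi * (\<bar>R\<bar> * norm \<xi>))) * g x)" by (intro integrable_mult_right g)
        show "AE x in lborel. norm (cmod (of_real (g x)) * exp (cmod (z * ?a x))) \<le> norm (exp (cmod z * (2 * pi * (\<bar>R\<bar> * norm \<xi>))) * g x)"
        proof (rule AE_I2)
          fix x
          show "norm (cmod (of_real (g x)) * exp (cmod (z * ?a x))) \<le> norm (exp (cmod z * (2 * pi * (\<bar>R\<bar> * norm \<xi>))) * g x)"
          proof (cases "norm x \<ge> R")
            case False
            then have "\<bar>x \<bullet> \<xi>\<bar> \<le> \<bar>R\<bar> * norm \<xi>"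
              by (intro order_trans[OF Cauchy_Schwarz_ineq2[of x \<xi>] mult_right_mono[of "norm x" "\<bar>R\<bar>" "norm \<xi>"]]) auto
            then have "cmod (z * ?a x) \<le> cmod z * (2 * pi * (\<bar>R\<bar> * norm \<xi>))"
              using mult_left_mono[of "\<bar>x \<bullet> \<xi>\<bar>" "\<bar>R\<bar> * norm \<xi>" "cmod z * (2 * pi)"] by (simp add: norm_mult mult_ac)
            then show ?thesis by (simp add: abs_mult mult.commute mult_left_mono)
          qed (simp add: supp)
        qed
      qed measurable
    qed measurable
    also have "(\<lambda>k. \<integral>x. of_real (g x) * (z * ?a x) ^ k / fact k \<partial>lborel) = (\<lambda>k. m k * (z - 0) ^ k)"
    proof
      fix k
      have "(\<integral>x. of_real (g x) * (z * ?a x) ^ k / fact k \<partial>lborel) = (\<integral>x. z ^ k * (of_real (g x) * ?a x ^ k / fact k) \<partial>lborel)"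
        by (intro Bochner_Integration.integral_cong refl) (simp only: power_mult_distrib, simp add: mult_ac)
      also have "\<dots> = z ^ k * m k" unfolding m_def by (rule integral_mult_right_zero)
      finally show "(\<integral>x. of_real (g x) * (z * ?a x) ^ k / fact k \<partial>lborel) = m k * (z - 0) ^ k"
        by (simp add: mult.commute)
    qed
    finally show ?thesis .
  qed
  have hreal: "h (of_real t) = c * of_real (g (t *\<^sub>R \<xi>))" for t
    unfolding eig[symmetric] h_def
    by (subst fourier_eq_lborel) (auto simp: wave_def mult_ac)
  \<comment> \<open>From this parameter on, the points of the line lie outside the support.\<close>
  define T where "T = max 1 (R / norm \<xi>)"
  have zero: "h (of_real t) = 0" if "t \<ge> T" for t
  proof -
    have "R \<le> norm (t *\<^sub>R \<xi>)" using that \<xi> by (auto simp: T_def field_simps)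
    then show ?thesis by (simp add: hreal supp)
  qed
  have "h 1 = 0"
  proof (rule analytic_continuation[of h "ball 0 (T + 2)" "of_real ` {T..T + 1}" "of_real T"])
    show "h holomorphic_on ball 0 (T + 2)"
      using sums by (intro power_series_holomorphic)
    show "complex_of_real T islimpt complex_of_real ` {T..T + 1}"
    proof -
      have "T islimpt {T..T + 1}" by (simp add: islimpt_Icc)
      then show ?thesis
        unfolding islimpt_sequential
        by (elim exE conjE, intro exI[of _ "\<lambda>n. of_real (_ n)"]) (auto intro!: tendsto_of_real)
    qed
    show "h z = 0" if "z \<in> of_real ` {T..T + 1}" for z using that zero by auto
  qed (auto simp: T_def)
  then have "c * of_real (g (1 *\<^sub>R \<xi>)) = 0" using hreal[of 1] by simp
  then show ?thesis using c by simp
qed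

section \<open>Weights\<close>

lemma lebesgue_measurable_AE:
  fixes h h' :: "'a::euclidean_space \<Rightarrow> real"
  assumes h': "h' \<in> borel_measurable borel" and ae: "AE x in lborel. h x = h' x"
  shows "h \<in> borel_measurable lebesgue"
proof (rule measurableI)
  fix S :: "real set" assume S: "S \<in> sets borel"
  show "h -` S \<inter> space lebesgue \<in> sets lebesgue"
  proof (rule completion.in_sets_AE)
    have "AE x in lebesgue. h x = h' x" using ae by (rule AE_completion)
    then show "AE x in lebesgue. (x \<in> h' -` S \<inter> space lebesgue) = (x \<in> h -` S \<inter> space lebesgue)"
      by eventually_elim auto
    have "h' \<in> borel_measurable lebesgue"
      by (rule measurable_completion) (use h' in simp)
    then show "h' -` S \<inter> space lebesgue \<in> sets lebesgue" using S by (rule measurable_sets)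
  qed auto
qed auto

text \<open>Weights are Lebesgue measurable, whereas polar coordinates are available for Borel functions.
Here integrals are moved to a Borel version.\<close>

lemma lebesgue_integral_AE:
  fixes h h' :: "'a::euclidean_space \<Rightarrow> real"
  assumes h': "h' \<in> borel_measurable borel" and ae: "AE x in lborel. h x = h' x"
  shows "integrable lebesgue h \<longleftrightarrow> integrable lborel h'"
    and "integral\<^sup>L lebesgue h = integral\<^sup>L lborel h'"
proof -
  have m: "h \<in> borel_measurable lebesgue" "h' \<in> borel_measurable lborel" "h' \<in> borel_measurable lebesgue"
    using lebesgue_measurable_AE[OF h' ae] h' by (auto intro: measurable_completion)
  have ae': "AE x in lebesgue. h x = h' x" using ae by (rule AE_completion)
  show "integrable lebesgue h \<longleftrightarrow> integrable lborel h'"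
    using integrable_cong_AE[OF m(1,3) ae'] integrable_completion[OF m(2)] by simp
  show "integral\<^sup>L lebesgue h = integral\<^sup>L lborel h'"
    using integral_cong_AE[OF m(1,3) ae'] integral_completion[OF m(2)] by simp
qed

lemma polar_AE:
  assumes "AE x in (lborel :: 'a::euclidean_space measure). R x"
  shows "AE \<omega> in sphere_measure. AE r in norm_law TYPE('a). R (r *\<^sub>R \<omega>)"
    and "AE r in norm_law TYPE('a). AE \<omega> in sphere_measure. R (r *\<^sub>R \<omega>)"
proof -
  interpret pair_sigma_finite "sphere_measure :: 'a measure" "norm_law TYPE('a)"
    by (rule pair_sigma_finite_polar)
  obtain N where N: "N \<in> null_sets lborel" "{x. \<not> R x} \<subseteq> N"
    using assms by (auto simp: eventually_ae_filter)
  then have [measurable]: "N \<in> sets borel" by auto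
  have "AE x in distr (sphere_measure \<Otimes>\<^sub>M norm_law TYPE('a)) borel (\<lambda>(\<omega>, r). r *\<^sub>R \<omega>). x \<notin> N"
    unfolding polar_lborel[symmetric] using N(1) by (rule AE_not_in)
  then have pair: "AE z in sphere_measure \<Otimes>\<^sub>M norm_law TYPE('a). snd z *\<^sub>R fst z \<notin> N"
    by (rule AE_mp[OF AE_distrD[rotated]]) (auto simp: split_beta)
  from AE_pair[OF this] have 1: "AE \<omega> in sphere_measure. AE r in norm_law TYPE('a). r *\<^sub>R \<omega> \<notin> N" by simp
  then show "AE \<omega> in sphere_measure. AE r in norm_law TYPE('a). R (r *\<^sub>R \<omega>)"
    by eventually_elim (use N(2) in \<open>auto elim!: eventually_mono\<close>)
  have "AE r in norm_law TYPE('a). AE \<omega> in sphere_measure. r *\<^sub>R \<omega> \<notin> N"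
  proof (subst AE_commute[symmetric])
    show "{z \<in> space (sphere_measure \<Otimes>\<^sub>M norm_law TYPE('a)). snd z *\<^sub>R fst z \<notin> N} \<in>
        sets (sphere_measure \<Otimes>\<^sub>M norm_law TYPE('a))"
      by measurable
  qed (rule 1)
  then show "AE r in norm_law TYPE('a). AE \<omega> in sphere_measure. R (r *\<^sub>R \<omega>)"
    by eventually_elim (use N(2) in \<open>auto elim!: eventually_mono\<close>)
qed

lemma sphere_AE_ex:
  fixes R :: "'a::euclidean_space \<Rightarrow> bool"
  assumes "AE \<omega> in sphere_measure. R \<omega>"
  obtains \<omega> where "R \<omega>"
proof (rule ccontr)
  assume "\<not> thesis"
  then have "\<not> R \<omega>" for \<omega> using that by blast
  then have "AE \<omega> in (sphere_measure :: 'a measure). False" using assms by simp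
  then show False by simp
qed

lemma sphere_AE_lborel:
  assumes "AE \<omega> in (sphere_measure :: 'a::euclidean_space measure). R \<omega>"
  shows "AE x in (lborel :: 'a measure). R (sgn x)"
proof -
  obtain N where N: "N \<in> null_sets (sphere_measure :: 'a measure)" "{x. \<not> R x} \<subseteq> N"
    using assms by (auto simp: eventually_ae_filter)
  then have [measurable]: "N \<in> sets borel" by auto
  have "emeasure lborel {x::'a. sgn x \<in> N \<and> norm x \<le> 1} / ennreal (unit_ball_vol DIM('a)) = 0"
    using N emeasure_sphere_measure[of N] by auto
  then have "emeasure lborel {x::'a. sgn x \<in> N \<and> norm x \<le> 1} = 0"
    by (simp add: ennreal_divide_eq_0_iff)
  then have "AE x::'a in lborel. \<not> (sgn x \<in> N \<and> norm x \<le> real n)" for n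
    by (intro AE_I[of _ _ "{x::'a. sgn x \<in> N \<and> norm x \<le> real n}"])
       (auto simp: polar_box_scaling[of N "real n"])
  then have "AE x::'a in lborel. \<forall>n::nat. \<not> (sgn x \<in> N \<and> norm x \<le> real n)"
    unfolding AE_all_countable by blast
  then show ?thesis
  proof eventually_elim
    case (elim x)
    obtain n :: nat where "norm x \<le> real n" using real_arch_simple by blast
    with elim have "sgn x \<notin> N" by blast
    then show ?case using N(2) by blast
  qed
qed

text \<open>The surface measure charges every relatively open part of the sphere.\<close>

lemma sphere_integral_zero_imp:
  fixes h :: "'a::euclidean_space \<Rightarrow> real"
  assumes h: "continuous_on UNIV h" and nn: "\<And>\<omega>. norm \<omega> = 1 \<Longrightarrow> h \<omega> \<ge> 0"
    and zero: "(\<integral>\<omega>. h \<omega> \<partial>sphere_measure) = 0" and \<omega>: "norm \<omega> = 1"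
  shows "h \<omega> = 0"
proof (rule ccontr)
  assume ne: "h \<omega> \<noteq> 0"
  have "AE \<omega> in sphere_measure. h \<omega> = 0"
    using zero AE_sphere_measure nn
    by (subst (asm) integral_nonneg_eq_0_iff_AE) (auto intro!: sphere_integrable_continuous h elim!: eventually_mono)
  then have ae: "AE x::'a in lborel. h (sgn x) = 0" by (rule sphere_AE_lborel)
  have "continuous_on (- {0}) (\<lambda>x::'a. h (sgn x))"
    by (rule continuous_on_compose2[OF h]) (auto intro!: continuous_intros)
  then have "open (- {0} \<inter> (\<lambda>x::'a. h (sgn x)) -` (- {0}))"
    by (intro continuous_open_preimage) auto
  moreover have "\<omega> \<in> - {0} \<inter> (\<lambda>x::'a. h (sgn x)) -` (- {0})"
    using ne \<omega> by (auto simp: sgn_div_norm)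
  ultimately obtain e where e: "e > 0" "ball \<omega> e \<subseteq> - {0} \<inter> (\<lambda>x::'a. h (sgn x)) -` (- {0})"
    unfolding open_contains_ball by blast
  have "AE x in lborel. x \<notin> ball \<omega> e"
    using ae by eventually_elim (use e in auto)
  then have "emeasure lborel (ball \<omega> e) = 0"
    by (subst (asm) AE_iff_measurable[of "ball \<omega> e"]) auto
  then show False using e by (simp add: emeasure_ball)
qed

text \<open>Restricting a Borel version of \<open>P\<close> to a generic ray gives a Borel version of the profile. Its
exceptional set is a set of radii, so the same version serves in all dimensions.\<close>

lemma radial_borel_version:
  fixes P :: "'m::euclidean_space \<Rightarrow> real"
  assumes P: "P \<in> borel_measurable lebesgue" and rad: "\<And>y. P y = P0 (norm y)"
  obtains p N where "p \<in> borel_measurable borel" "N \<in> sets borel" "\<And>r. r \<notin> N \<Longrightarrow> P0 r = p r"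
    "AE y::'m in lborel. norm y \<notin> N"
proof -
  obtain P' where P'[measurable]: "P' \<in> borel_measurable borel" and eq: "AE y in lborel. P y = P' y"
    using completion_ex_borel_measurable_real[OF P] by auto
  obtain N' where N': "N' \<in> null_sets lborel" "{y. P y \<noteq> P' y} \<subseteq> N'"
    using eq by (auto simp: eventually_ae_filter)
  have [measurable]: "N' \<in> sets borel" using N' by auto
  have "AE y in lborel. y \<notin> N'" using N'(1) by (rule AE_not_in)
  from polar_AE(1)[OF this] AE_sphere_measure
  have "AE \<omega> in (sphere_measure :: 'm measure). norm \<omega> = 1 \<and> (AE r in norm_law TYPE('m). r *\<^sub>R \<omega> \<notin> N')"
    by eventually_elim auto
  then obtain \<omega> :: 'm where \<omega>: "norm \<omega> = 1" "AE r in norm_law TYPE('m). r *\<^sub>R \<omega> \<notin> N'"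
    by (rule sphere_AE_ex) blast
  define N where "N = {r. r *\<^sub>R \<omega> \<in> N'} \<union> {..<0}"
  show thesis
  proof
    show "(\<lambda>r. P' (r *\<^sub>R \<omega>)) \<in> borel_measurable borel" by measurable
    show "N \<in> sets borel" unfolding N_def by measurable
    show "P0 r = P' (r *\<^sub>R \<omega>)" if "r \<notin> N" for r
    proof -
      have "r \<ge> 0" "r *\<^sub>R \<omega> \<notin> N'" using that by (auto simp: N_def)
      then have "P (r *\<^sub>R \<omega>) = P' (r *\<^sub>R \<omega>)" using N'(2) by blast
      then show ?thesis using \<open>r \<ge> 0\<close> rad[of "r *\<^sub>R \<omega>"] \<omega> by simp
    qed
    have "AE y in (lborel::'m measure). norm y *\<^sub>R \<omega> \<notin> N'"
      using \<omega>(2) by (subst (asm) AE_distr_iff) auto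
    then show "AE y in (lborel::'m measure). norm y \<notin> N"
      by eventually_elim (auto simp: N_def)
  qed
qed

lemma AE_norm_notin_transfer:
  assumes N: "N \<in> sets borel" and AE: "AE y in lborel. norm (y::'m::euclidean_space) \<notin> N"
  shows "AE x in lborel. norm (x::'n::euclidean_space) \<notin> N"
proof (rule AE_norm_transfer[OF _ AE])
  have "{r. r \<notin> N} = - N" by auto
  then show "{r. r \<notin> N} \<in> sets borel" using N by auto
qed

text \<open>With \<open>c\<close> the value of the radial weight on the sphere of radius \<open>r\<close>, the profile times \<open>c\<close> is an
average of values of the weighted function on that sphere, scaled by a positive factor.\<close>

lemma sphere_scaling_sign:
  fixes H g :: "'n::euclidean_space \<Rightarrow> real"
  assumes H: "homogeneous_harmonic_polynomial l H" and g: "continuous_on UNIV g"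
    and r: "r > 0" and nn: "\<And>x. norm x = r \<Longrightarrow> H x * c * g x \<ge> 0"
  shows "c * harmonic_profile l H g r \<ge> 0"
    and "c * harmonic_profile l H g r = 0 \<Longrightarrow> norm x = r \<Longrightarrow> H x * c * g x = 0"
proof -
  note HD = homogeneous_harmonicD[OF H]
  let ?h = "\<lambda>\<omega>. H \<omega> * c * g (r *\<^sub>R \<omega>)"
  have cont: "continuous_on UNIV ?h"
    by (intro continuous_intros HD continuous_on_compose2[OF g]) auto
  have h: "?h \<omega> = H (r *\<^sub>R \<omega>) * c * g (r *\<^sub>R \<omega>) / r ^ l" for \<omega>
    using r by (simp add: HD(4))
  have h_nn: "?h \<omega> \<ge> 0" if "norm \<omega> = 1" for \<omega>
    unfolding h using r that by (intro divide_nonneg_pos nn) auto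
  have "(\<integral>\<omega>. ?h \<omega> \<partial>sphere_measure) = c * (\<integral>\<omega>. H \<omega> * g (r *\<^sub>R \<omega>) \<partial>sphere_measure)"
    by (subst integral_mult_right_zero[symmetric]) (simp add: mult_ac)
  then have eq: "(\<integral>\<omega>. ?h \<omega> \<partial>sphere_measure) = c * harmonic_profile l H g r * r ^ l"
    using r by (simp add: harmonic_profile_def)
  have "(\<integral>\<omega>. ?h \<omega> \<partial>sphere_measure) \<ge> 0"
    using AE_sphere_measure h_nn by (intro integral_nonneg_AE) (auto elim!: eventually_mono)
  then show "c * harmonic_profile l H g r \<ge> 0"
    unfolding eq using r mult_neg_pos[of "c * harmonic_profile l H g r" "r ^ l"] by (meson not_le zero_less_power)
  assume "c * harmonic_profile l H g r = 0" and x: "norm x = r"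
  then have "(\<integral>\<omega>. ?h \<omega> \<partial>sphere_measure) = 0" by (simp add: eq)
  from sphere_integral_zero_imp[OF cont h_nn this, of "sgn x"] x r
  have "?h (sgn x) = 0" by (auto simp: norm_sgn)
  moreover have "r *\<^sub>R sgn x = x" using x r by (auto simp: sgn_div_norm)
  ultimately show "H x * c * g x = 0" unfolding h using r by simp
qed

text \<open>All requirements on the weighted function \<open>H * P0 * g\<close> pass to the profile because they survive
spherical averaging. The only danger is that the average vanishes; on large spheres the weighted
function is non-negative, so its average vanishes only if the function does, and the last hypothesis
provides a large sphere on which it does not. With \<open>H = 1\<close> and \<open>l = 0\<close> this is radialisation.\<close>

theorem weighted_projection:
  fixes H g :: "'n::euclidean_space \<Rightarrow> real" and P :: "'m::euclidean_space \<Rightarrow> real"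
  assumes H: "homogeneous_harmonic_polynomial l H" and dim: "DIM('m) = DIM('n) + 2 * l"
    and P: "P \<in> borel_measurable lebesgue" "\<And>y. P y = P0 (norm y)"
    and g: "continuous_on UNIV g" "integrable lborel g" and Hg: "integrable lborel (\<lambda>x. H x * g x)"
    and s: "s * s = 1"
    and eig: "\<And>\<xi>. fourier (\<lambda>x. of_real (g x)) \<xi> = (- \<i>) ^ l * of_real (s * g \<xi>)"
    and W: "integrable lebesgue (\<lambda>x. H x * P0 (norm x) * g x)" "(LINT x|lebesgue. H x * P0 (norm x) * g x) \<le> 0"
    and R: "\<And>x. norm x \<ge> R \<Longrightarrow> H x * P0 (norm x) * g x \<ge> 0"
    and nz: "\<And>R'. \<exists>x. norm x \<ge> R' \<and> H x * P0 (norm x) * g x \<noteq> 0"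
  obtains f0 where "continuous_on UNIV f0" "integrable lborel (\<lambda>y::'m. f0 (norm y))"
    "\<And>\<eta>::'m. fourier (\<lambda>y::'m. of_real (f0 (norm y))) \<eta> = of_real (s * f0 (norm \<eta>))"
    "(\<lambda>y::'m. f0 (norm y)) \<noteq> (\<lambda>y. 0)"
    "integrable lebesgue (\<lambda>y::'m. P y * f0 (norm y))" "(LINT y|lebesgue. P y * f0 (norm (y::'m))) \<le> 0"
    "\<forall>r>0. (\<forall>x. norm x \<ge> r \<longrightarrow> H x * P0 (norm x) * g x \<ge> 0) \<longrightarrow> (\<forall>y::'m. norm y \<ge> r \<longrightarrow> P y * f0 (norm y) \<ge> 0)"
proof -
  note HD = homogeneous_harmonicD[OF H]
  have [measurable]: "H \<in> borel_measurable borel" by (rule HD)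
  have [measurable]: "g \<in> borel_measurable borel" using g(1) by (rule borel_measurable_continuous_onI)
  obtain f0 where f0: "continuous_on UNIV f0" "integrable lborel (\<lambda>y::'m. f0 (norm y))"
    "\<And>\<eta>::'m. fourier (\<lambda>y::'m. of_real (f0 (norm y))) \<eta> = of_real (s * f0 (norm \<eta>))"
    and prof: "\<And>r. r > 0 \<Longrightarrow> f0 r = harmonic_profile l H g r"
    using harmonic_projection[OF H dim g(2) Hg s eig] by blast
  have [measurable]: "f0 \<in> borel_measurable borel" using f0(1) by (rule borel_measurable_continuous_onI)
  obtain p N where p[measurable]: "p \<in> borel_measurable borel" and N: "N \<in> sets borel" "\<And>r. r \<notin> N \<Longrightarrow> P0 r = p r"
    "AE y::'m in lborel. norm y \<notin> N"
    using radial_borel_version[OF P] by blast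
  have Nn: "AE x::'n in lborel. norm x \<notin> N" by (rule AE_norm_notin_transfer[OF N(1,3)])
  have W1: "AE x in lborel. H x * P0 (norm x) * g x = H x * g x * p (norm x)"
    using Nn by eventually_elim (simp add: N(2))
  have W2: "AE y::'m in lborel. P y * f0 (norm y) = harmonic_profile l H g (norm y) * p (norm y)"
    using N(3) AE_lborel_singleton[of 0] by eventually_elim (simp add: N(2) P(2) prof)
  have int: "integrable lborel (\<lambda>x. H x * g x * p (norm x))"
    using W(1) lebesgue_integral_AE(1)[OF _ W1] by simp
  have le: "(\<integral>x. H x * g x * p (norm x) \<partial>lborel) \<le> 0"
    using W(2) lebesgue_integral_AE(2)[OF _ W1] by simp
  have sign: "P y * f0 (norm y) \<ge> 0"
    if r: "r > 0" "\<And>x. norm x \<ge> r \<Longrightarrow> H x * P0 (norm x) * g x \<ge> 0" and y: "norm y \<ge> r" for r and y :: 'm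
  proof -
    have "P0 (norm y) * harmonic_profile l H g (norm y) \<ge> 0"
    proof (rule sphere_scaling_sign(1)[OF H g(1)])
      show "H x * P0 (norm y) * g x \<ge> 0" if "norm x = norm y" for x
        using r(2)[of x] that y by simp
    qed (use r y in auto)
    moreover have "norm y > 0" using r y by linarith
    ultimately show ?thesis by (simp add: prof P(2))
  qed
  have "(\<lambda>y::'m. f0 (norm y)) \<noteq> (\<lambda>y. 0)"
  proof
    assume zero: "(\<lambda>y::'m. f0 (norm y)) = (\<lambda>y. 0)"
    obtain x where x: "norm x \<ge> max 1 R" "H x * P0 (norm x) * g x \<noteq> 0" using nz by blast
    obtain y :: 'm where y: "norm y = norm x" using vector_choose_size[of "norm x"] by auto
    have "f0 (norm x) = 0" using fun_cong[OF zero, of y] y by simp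
    moreover have xp: "norm x > 0" using x(1) by auto
    ultimately have "P0 (norm x) * harmonic_profile l H g (norm x) = 0" by (simp add: prof)
    then have "H x * P0 (norm x) * g x = 0"
    proof (rule sphere_scaling_sign(2)[OF H g(1) xp, rotated])
      show "H z * P0 (norm x) * g z \<ge> 0" if "norm z = norm x" for z
        using R[of z] that x(1) by simp
    qed auto
    with x(2) show False by simp
  qed
  moreover have "integrable lebesgue (\<lambda>y::'m. P y * f0 (norm y))"
    using harmonic_profile_integral(1)[OF H dim _ _ int] lebesgue_integral_AE(1)[OF _ W2] by simp
  moreover have "(LINT y|lebesgue. P y * f0 (norm (y::'m))) \<le> 0"
  proof -
    have "dim_ratio DIM('n) DIM('m) > 0" by (simp add: dim_ratio_pos)
    moreover have "dim_ratio DIM('n) DIM('m) * (LINT y|lebesgue. P y * f0 (norm (y::'m))) \<le> 0"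
      using harmonic_profile_integral(2)[OF H dim _ _ int] lebesgue_integral_AE(2)[OF _ W2] le by simp
    ultimately show ?thesis by (simp add: mult_le_0_iff)
  qed
  ultimately show thesis
    by (rule that[OF f0]) (use sign in simp)
qed

text \<open>In polar coordinates the weighted lift is the product of the angular part \<open>H * H * Q\<close>, which is
non-negative, and the radial part of \<open>P * f0\<close>, shifted in dimension. So the integral
is a non-negative multiple of the given one. What must be extracted from the local integrability of \<open>Pt\<close>
is that the angular part \<open>H * Q\<close> is measurable and integrable; this is read off on a single generic sphere on
which the radial weight does not vanish. If there is no such sphere, the weighted lift vanishes almost
everywhere.\<close>

theorem weighted_lift:
  fixes H Q Pt :: "'n::euclidean_space \<Rightarrow> real" and P :: "'m::euclidean_space \<Rightarrow> real" and f0 :: "real \<Rightarrow> real"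
  assumes H: "homogeneous_harmonic_polynomial l H" and dim: "DIM('m) = DIM('n) + 2 * l"
    and P: "P \<in> borel_measurable lebesgue" "\<And>y. P y = P0 (norm y)"
    and Pt: "Pt \<in> borel_measurable lebesgue" "P1 Pt" "\<And>x. Pt x = H x * P0 (norm x) * Q x"
    and Q: "\<And>x. Q x \<ge> 0" "\<And>\<delta> x. \<delta> > 0 \<Longrightarrow> Q (\<delta> *\<^sub>R x) = Q x"
    and f0: "continuous_on UNIV f0"
    and PF: "integrable lebesgue (\<lambda>y::'m. P y * f0 (norm y))" "(LINT y|lebesgue. P y * f0 (norm (y::'m))) \<le> 0"
  shows "integrable lebesgue (\<lambda>x. Pt x * (H x * f0 (norm x)))"
    and "(LINT x|lebesgue. Pt x * (H x * f0 (norm x))) \<le> 0"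
proof -
  note HD = homogeneous_harmonicD[OF H]
  have [measurable]: "H \<in> borel_measurable borel" by (rule HD)
  have [measurable]: "f0 \<in> borel_measurable borel" using f0 by (rule borel_measurable_continuous_onI)
  obtain p N where p[measurable]: "p \<in> borel_measurable borel" and N: "N \<in> sets borel" "\<And>r. r \<notin> N \<Longrightarrow> P0 r = p r"
    "AE y::'m in lborel. norm y \<notin> N"
    using radial_borel_version[OF P] by blast
  have [measurable]: "N \<in> sets borel" by (rule N)
  have Nn: "AE x::'n in lborel. norm x \<notin> N" by (rule AE_norm_notin_transfer[OF N(1,3)])
  have Nr: "AE r in norm_law TYPE('n). r \<notin> N" using Nn by (subst AE_distr_iff) auto
  obtain Pt' where [measurable]: "Pt' \<in> borel_measurable borel" and Pt': "AE x in lborel. Pt x = Pt' x"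
    using completion_ex_borel_measurable_real[OF Pt(1)] by auto
  have pos: "AE r in norm_law TYPE('n). r > 0"
    using AE_lborel_singleton[of "0::'n"] by (subst AE_distr_iff) auto
  have goal: "integrable lebesgue (\<lambda>x. Pt x * (H x * f0 (norm x))) \<and> (LINT x|lebesgue. Pt x * (H x * f0 (norm x))) \<le> 0"
  proof (cases "AE r in norm_law TYPE('n). p r = 0")
    case True
    then have "AE x::'n in lborel. p (norm x) = 0" by (subst (asm) AE_distr_iff) auto
    with Nn have "AE x in lborel. Pt x * (H x * f0 (norm x)) = 0"
      by eventually_elim (simp add: Pt(3) N(2))
    from lebesgue_integral_AE[OF _ this] show ?thesis by simp
  next
    case False
    have ball_meas: "(\<lambda>x. Pt' x * indicator (cball 0 (real n)) x) \<in> borel_measurable borel" for n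
      by (intro borel_measurable_times borel_measurable_indicator) auto
    \<comment> \<open>Integrability over the balls of all integer radii descends to almost every sphere by Fubini.\<close>
    have ball_int: "integrable lborel (\<lambda>x. Pt' x * indicator (cball 0 (real n)) x)" for n
    proof -
      have "integrable lebesgue (\<lambda>x. Pt x * indicator (cball 0 (real n)) x)"
        using Pt(2) compact_cball[of "0::'n" "real n"] unfolding P1_def set_integrable_def by (simp add: mult.commute)
      moreover have ae: "AE x in lborel. Pt x * indicator (cball 0 (real n)) x = Pt' x * indicator (cball 0 (real n)) x"
        using Pt' by eventually_elim simp
      have "integrable lebesgue (\<lambda>x. Pt x * indicator (cball 0 (real n)) x) \<longleftrightarrow>
          integrable lborel (\<lambda>x. Pt' x * indicator (cball 0 (real n)) x)"
        by (rule lebesgue_integral_AE(1)[OF _ ae]) (rule ball_meas)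
      ultimately show ?thesis by blast
    qed
    interpret pair_sigma_finite "sphere_measure :: 'n measure" "norm_law TYPE('n)"
      by (rule pair_sigma_finite_polar)
    have "AE r in norm_law TYPE('n). integrable sphere_measure (\<lambda>\<omega>. Pt' (r *\<^sub>R \<omega>) * indicator (cball 0 (real n)) (r *\<^sub>R \<omega>))" for n
    proof -
      have "integrable (sphere_measure \<Otimes>\<^sub>M norm_law TYPE('n)) (\<lambda>(\<omega>, r). Pt' (r *\<^sub>R \<omega>) * indicator (cball 0 (real n)) (r *\<^sub>R \<omega>))"
        using ball_int[of n] by (subst (asm) integrable_polar[OF ball_meas])
      then show ?thesis by (rule AE_integrable_snd)
    qed
    then have "AE r in norm_law TYPE('n). \<forall>n::nat. integrable sphere_measure (\<lambda>\<omega>. Pt' (r *\<^sub>R \<omega>) * indicator (cball 0 (real n)) (r *\<^sub>R \<omega>))"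
      by (simp add: AE_all_countable)
    with Nr pos polar_AE(2)[OF Pt']
    have good: "AE r in norm_law TYPE('n). r \<notin> N \<and> r > 0 \<and> (AE \<omega> in sphere_measure. Pt (r *\<^sub>R \<omega>) = Pt' (r *\<^sub>R \<omega>)) \<and>
        (\<forall>n::nat. integrable sphere_measure (\<lambda>\<omega>. Pt' (r *\<^sub>R \<omega>) * indicator (cball 0 (real n)) (r *\<^sub>R \<omega>)))"
      by eventually_elim auto
    have "\<exists>r. p r \<noteq> 0 \<and> r \<notin> N \<and> r > 0 \<and> (AE \<omega> in sphere_measure. Pt (r *\<^sub>R \<omega>) = Pt' (r *\<^sub>R \<omega>)) \<and>
        (\<forall>n::nat. integrable sphere_measure (\<lambda>\<omega>. Pt' (r *\<^sub>R \<omega>) * indicator (cball 0 (real n)) (r *\<^sub>R \<omega>)))"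
    proof (rule ccontr)
      assume no: "\<nexists>r. p r \<noteq> 0 \<and> r \<notin> N \<and> r > 0 \<and> (AE \<omega> in sphere_measure. Pt (r *\<^sub>R \<omega>) = Pt' (r *\<^sub>R \<omega>)) \<and>
        (\<forall>n::nat. integrable sphere_measure (\<lambda>\<omega>. Pt' (r *\<^sub>R \<omega>) * indicator (cball 0 (real n)) (r *\<^sub>R \<omega>)))"
      from good have "AE r in norm_law TYPE('n). p r = 0"
        by eventually_elim (use no in blast)
      with False show False by simp
    qed
    then obtain r0 where r0: "p r0 \<noteq> 0" "r0 \<notin> N" "r0 > 0" "AE \<omega> in sphere_measure. Pt (r0 *\<^sub>R \<omega>) = Pt' (r0 *\<^sub>R \<omega>)"
      "\<And>n::nat. integrable sphere_measure (\<lambda>\<omega>. Pt' (r0 *\<^sub>R \<omega>) * indicator (cball 0 (real n)) (r0 *\<^sub>R \<omega>))"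
      by blast
    \<comment> \<open>A Borel version of the angular factor \<open>H * Q\<close>, obtained from the sphere of radius \<open>r0\<close>.\<close>
    define q where "q \<omega> = Pt' (r0 *\<^sub>R \<omega>) / (r0 ^ l * p r0)" for \<omega>
    have [measurable]: "q \<in> borel_measurable borel" unfolding q_def by measurable
    have q: "AE \<omega> in sphere_measure. norm \<omega> = 1 \<and> q \<omega> = H \<omega> * Q \<omega>"
      using AE_sphere_measure r0(4)
    proof eventually_elim
      case (elim \<omega>)
      have "Pt' (r0 *\<^sub>R \<omega>) = r0 ^ l * H \<omega> * p r0 * Q \<omega>"
        using elim r0 N(2)[of r0] Pt(3)[of "r0 *\<^sub>R \<omega>"] by (simp add: HD(4) Q(2))
      then show ?case using elim r0 by (simp add: q_def)
    qed
    have q_int: "integrable sphere_measure q"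
    proof -
      obtain n :: nat where n: "r0 \<le> real n" using real_arch_simple by blast
      have ae: "AE \<omega> in (sphere_measure :: 'n measure). Pt' (r0 *\<^sub>R \<omega>) * indicator (cball 0 (real n)) (r0 *\<^sub>R \<omega>) = Pt' (r0 *\<^sub>R \<omega>)"
        using AE_sphere_measure by eventually_elim (use n r0 in auto)
      have "integrable sphere_measure (\<lambda>\<omega>. Pt' (r0 *\<^sub>R \<omega>))"
        using r0(5)[of n] integrable_cong_AE[OF borel_measurable_integrable[OF r0(5)[of n]] _ ae] by simp
      then show ?thesis unfolding q_def by (rule integrable_divide_zero)
    qed
    obtain C where C: "C \<ge> 0" "\<And>x. \<bar>H x\<bar> \<le> C * norm x ^ l" using homogeneous_bound[OF H] by blast
    have A_int: "integrable sphere_measure (\<lambda>\<omega>. H \<omega> * q \<omega>)"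
    proof (rule Bochner_Integration.integrable_bound)
      show "integrable sphere_measure (\<lambda>\<omega>. C * q \<omega>)" by (intro integrable_mult_right q_int)
      show "AE \<omega> in sphere_measure. norm (H \<omega> * q \<omega>) \<le> norm (C * q \<omega>)"
        using AE_sphere_measure
      proof eventually_elim
        case (elim \<omega>)
        show ?case using C(1) C(2)[of \<omega>] elim by (auto simp: abs_mult intro!: mult_right_mono)
      qed
    qed measurable
    have A_nn: "(\<integral>\<omega>. H \<omega> * q \<omega> \<partial>sphere_measure) \<ge> 0"
    proof (rule integral_nonneg_AE)
      show "AE \<omega> in sphere_measure. 0 \<le> H \<omega> * q \<omega>"
        using q
      proof eventually_elim
        case (elim \<omega>)
        have "H \<omega> * q \<omega> = (H \<omega> * H \<omega>) * Q \<omega>" using elim by simp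
        also have "\<dots> \<ge> 0" using mult_nonneg_nonneg[OF zero_le_square Q(1)] .
        finally show ?case .
      qed
    qed
    have PF_ae: "AE y::'m in lborel. P y * f0 (norm y) = p (norm y) * f0 (norm y)"
      using N(3) by eventually_elim (simp add: N(2) P(2))
    have PF_int: "integrable lborel (\<lambda>y::'m. p (norm y) * f0 (norm y))"
      using PF(1) lebesgue_integral_AE(1)[OF _ PF_ae] by simp
    have PF_le: "integral\<^sup>L lborel (\<lambda>y::'m. p (norm y) * f0 (norm y)) \<le> 0"
      using PF(2) lebesgue_integral_AE(2)[OF _ PF_ae] by simp
    let ?B = "\<lambda>r. r ^ (2 * l) *\<^sub>R (p r * f0 r)"
    have B_int: "integrable lborel (\<lambda>x::'n. ?B (norm x))"
      using PF_int by (subst radial_shift(1)[OF dim, of "\<lambda>r. p r * f0 r"]) auto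
    have B_le: "integral\<^sup>L lborel (\<lambda>x::'n. ?B (norm x)) \<le> 0"
    proof -
      have "dim_ratio DIM('n) DIM('m) > 0" by (simp add: dim_ratio_pos)
      then show ?thesis
        using PF_le by (subst radial_shift(2)[OF dim, of "\<lambda>r. p r * f0 r"]) (auto simp: mult_le_0_iff)
    qed
    let ?f = "\<lambda>x::'n. H (sgn x) * q (sgn x) * ?B (norm x)"
    have f: "integrable lborel ?f"
      "integral\<^sup>L lborel ?f = (\<integral>\<omega>. H \<omega> * q \<omega> \<partial>sphere_measure) * integral\<^sup>L lborel (\<lambda>x::'n. ?B (norm x))"
    proof -
      have eq: "?f (r *\<^sub>R \<omega>) = H \<omega> * q \<omega> * ?B r" if "r > 0" "norm \<omega> = 1" for \<omega> r
      proof -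
        have "sgn (r *\<^sub>R \<omega>) = \<omega>" "norm (r *\<^sub>R \<omega>) = r" using that by (auto simp: sgn_scaleR sgn_div_norm)
        then show ?thesis by simp
      qed
      have m: "?B \<in> borel_measurable borel" "?f \<in> borel_measurable borel" by measurable
      show "integrable lborel ?f"
        by (rule polar_product(1)[OF A_int m(1) B_int m(2) eq])
      show "integral\<^sup>L lborel ?f = (\<integral>\<omega>. H \<omega> * q \<omega> \<partial>sphere_measure) * integral\<^sup>L lborel (\<lambda>x::'n. ?B (norm x))"
        by (rule polar_product(2)[OF A_int m(1) B_int m(2) eq])
    qed
    have ae: "AE x in lborel. Pt x * (H x * f0 (norm x)) = ?f x"
      using sphere_AE_lborel[OF q] Nn AE_lborel_singleton[of 0]
    proof eventually_elim
      case (elim x)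
      have x: "norm x *\<^sub>R sgn x = x" using elim by (simp add: sgn_div_norm)
      have Hx: "H x = norm x ^ l * H (sgn x)" using HD(4)[of "norm x" "sgn x"] unfolding x .
      have Qx: "Q x = Q (sgn x)" using elim Q(2)[of "norm x" "sgn x"] unfolding x by simp
      have q': "q (sgn x) = H (sgn x) * Q (sgn x)" and P0: "P0 (norm x) = p (norm x)"
        using elim N(2) by auto
      show ?case unfolding Pt(3) Hx Qx q' P0 by (simp add: mult_2 power_add)
    qed
    show ?thesis
      using lebesgue_integral_AE[OF _ ae] f A_nn B_le by (auto simp: mult_le_0_iff)
  qed
  then show "integrable lebesgue (\<lambda>x. Pt x * (H x * f0 (norm x)))"
    and "(LINT x|lebesgue. Pt x * (H x * f0 (norm x))) \<le> 0" by auto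
qed

section \<open>The extremal classes\<close>

lemma integrable_lebesgue_iff_lborel:
  fixes f :: "'a::euclidean_space \<Rightarrow> real"
  assumes "f \<in> borel_measurable borel"
  shows "integrable lebesgue f \<longleftrightarrow> integrable lborel f"
  using assms by (intro integrable_completion) simp

text \<open>On each line through the centre the polynomial has infinitely many zeros.\<close>

lemma real_polynomial_zero_on_ball:
  fixes H :: "'a::euclidean_space \<Rightarrow> real"
  assumes H: "real_polynomial_function H" and e: "e > 0" and zero: "\<And>x. x \<in> ball a e \<Longrightarrow> H x = 0"
  shows "H z = 0"
proof (cases "z = a")
  case False
  let ?u = "\<lambda>t::real. a + t *\<^sub>R (z - a)"
  have "polynomial_function ?u"
    by (intro polynomial_function_add polynomial_function_const polynomial_function_mult)
       (auto simp: polynomial_function_bounded_linear bounded_linear_scaleR_left)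
  then have "real_polynomial_function (H \<circ> ?u)"
    using H by (intro real_polynomial_function_compose)
  then obtain c n where c: "(H \<circ> ?u) = (\<lambda>t. \<Sum>i\<le>n. c i * t ^ i)"
    using real_polynomial_function_iff_sum by blast
  have "(H \<circ> ?u) 1 = 0"
  proof (rule ccontr)
    assume "(H \<circ> ?u) 1 \<noteq> 0"
    then have "\<exists>i\<le>n. c i \<noteq> 0" unfolding c by (metis (no_types, lifting) atMost_iff mult_zero_left sum.neutral)
    then have "finite {t. (\<Sum>i\<le>n. c i * t ^ i) = 0}" by (subst polyfun_finite_roots) auto
    moreover have "{0..<e / norm (z - a)} \<subseteq> {t. (\<Sum>i\<le>n. c i * t ^ i) = 0}"
    proof
      fix t assume t: "t \<in> {0..<e / norm (z - a)}"
      then have "dist a (?u t) = t * norm (z - a)" by (simp add: dist_norm)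
      then have "?u t \<in> ball a e" using t False by (auto simp: field_simps)
      then show "t \<in> {t. (\<Sum>i\<le>n. c i * t ^ i) = 0}" using zero fun_cong[OF c, of t] by simp
    qed
    ultimately have "finite {0..<e / norm (z - a)}" by (rule rev_finite_subset)
    then show False using e False by (simp add: infinite_Ico)
  qed
  then show ?thesis by simp
qed (use e zero in auto)

lemma weight_parityI:
  assumes "weight W" "has_parity W r"
  shows "weight_parity W = r"
  unfolding weight_parity_def
proof (rule the_equality[where P="has_parity W", OF assms(2)])
  fix r' assume r': "has_parity W r'"
  obtain x where x: "W x \<noteq> 0" using assms(1) by (auto simp: weight_def)
  have "(-1) ^ r' * W x = (-1) ^ r * W x" using r' assms(2) unfolding has_parity_def by metis
  then show "r' = r" using x r' assms(2) by (auto simp: has_parity_def)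
qed

text \<open>Reconciles the eigenvalue \<open>(- \<i>) ^ l\<close> of Bochner's relation with the sign convention of the extremal
classes; it amounts to \<open>\<i> ^ (2 * l) = (- 1) ^ l\<close>.\<close>

lemma sign_factor:
  assumes "r \<in> {0, 1::nat}" "r mod 2 = l mod 2"
  shows "of_real ((-1) ^ ((r + l) div 2)) * \<i> ^ r = (- \<i>) ^ l"
proof -
  define k where "k = l div 2"
  have l: "l = r + 2 * k" using assms by (auto simp: k_def)
  have sq: "(- \<i>) ^ (2 * k) = (- 1) ^ k" by (simp add: power_mult)
  show ?thesis
    using assms(1) unfolding l power_add[of "- \<i>"] sq by auto
qed

lemma last_sign_radius_mono:
  assumes f: "eventually_nonneg f"
    and imp: "\<forall>r>0. (\<forall>x. norm x \<ge> r \<longrightarrow> f x \<ge> 0) \<longrightarrow> (\<forall>y. norm y \<ge> r \<longrightarrow> g y \<ge> 0)"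
  shows "eventually_nonneg g" "last_sign_radius g \<le> last_sign_radius f"
proof -
  obtain R where R: "\<And>x. norm x \<ge> R \<Longrightarrow> f x \<ge> 0" using f by (auto simp: eventually_nonneg_def)
  have mem: "max R 1 > 0 \<and> (\<forall>x. norm x \<ge> max R 1 \<longrightarrow> f x \<ge> 0)" using R by auto
  then show "eventually_nonneg g" unfolding eventually_nonneg_def using imp mem by blast
  show "last_sign_radius g \<le> last_sign_radius f"
    unfolding last_sign_radius_def
  proof (rule cInf_superset_mono)
    show "{r. r > 0 \<and> (\<forall>x. norm x \<ge> r \<longrightarrow> f x \<ge> 0)} \<noteq> {}" using mem by blast
    show "bdd_below {r. r > 0 \<and> (\<forall>x. norm x \<ge> r \<longrightarrow> g x \<ge> 0)}" by (rule bdd_belowI[of _ 0]) auto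
    show "{r. r > 0 \<and> (\<forall>x. norm x \<ge> r \<longrightarrow> f x \<ge> 0)} \<subseteq> {r. r > 0 \<and> (\<forall>x. norm x \<ge> r \<longrightarrow> g x \<ge> 0)}"
      using imp by blast
  qed
qed

text \<open>The profile could be nonzero only at radius 0, where \<open>H\<close> may vanish; continuity moves the point away
from the origin, and homogeneity moves a non-zero of \<open>H\<close> to the right radius.\<close>

lemma harmonic_times_radial_nonzero:
  fixes H :: "'n::euclidean_space \<Rightarrow> real"
  assumes H: "homogeneous_harmonic_polynomial l H" "H \<noteq> (\<lambda>x. 0)"
    and f0: "continuous_on UNIV f0" and nz: "f0 (norm (y::'m::euclidean_space)) \<noteq> 0"
  shows "\<exists>x. H x * f0 (norm x) \<noteq> 0"
proof -
  note HD = homogeneous_harmonicD[OF H(1)]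
  have "\<exists>\<rho>>0. f0 \<rho> \<noteq> 0"
  proof (rule ccontr)
    assume no: "\<not> (\<exists>\<rho>>0. f0 \<rho> \<noteq> 0)"
    have "closed {r. f0 r = 0}"
      by (intro closed_Collect_eq f0 continuous_on_const)
    moreover have "{0<..} \<subseteq> {r. f0 r = 0}" using no by auto
    ultimately have "closure {0<..} \<subseteq> {r. f0 r = 0}" by (intro closure_minimal)
    moreover have "norm y \<in> closure {0<..}" by (simp add: closure_greaterThan)
    ultimately have "f0 (norm y) = 0" by blast
    with nz show False by simp
  qed
  then obtain \<rho> where \<rho>: "\<rho> > 0" "f0 \<rho> \<noteq> 0" by blast
  obtain x0 where x0: "H x0 \<noteq> 0" using H(2) by auto
  obtain e :: 'n where e: "norm e = 1" using vector_choose_size[of 1] by auto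
  have "\<exists>x1. x1 \<noteq> 0 \<and> H x1 \<noteq> 0"
  proof (cases "x0 = 0")
    case True
    then have "H e \<noteq> 0" using x0 HD(4)[of 0 e] by auto
    then show ?thesis using e by (intro exI[of _ e]) auto
  qed (use x0 in blast)
  then obtain x1 where x1: "x1 \<noteq> 0" "H x1 \<noteq> 0" by blast
  have "H ((\<rho> / norm x1) *\<^sub>R x1) * f0 (norm ((\<rho> / norm x1) *\<^sub>R x1)) \<noteq> 0"
    using x1 \<rho> by (simp add: HD(4))
  then show ?thesis by blast
qed

text \<open>Radialise \<open>f\<close>, then multiply the profile by \<open>H\<close>. If the radialisation were zero, \<open>P * f\<close> would be
eventually zero, which \<^const>\<open>P3\<close> forbids. The sign of the new weighted function at \<open>x\<close> is that of
the spherical mean of \<open>P * f\<close> at radius \<open>norm x\<close>, so the last sign change does not move outwards.\<close>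

lemma A_star_lift:
  fixes H Q Pt :: "'n::euclidean_space \<Rightarrow> real" and P :: "'m::euclidean_space \<Rightarrow> real"
  assumes H: "homogeneous_harmonic_polynomial l H" "H \<noteq> (\<lambda>x. 0)" and dim: "DIM('m) = DIM('n) + 2 * l"
    and s: "s * s = 1" and P: "weight P" "P3 P" "\<And>y. P y = P0 (norm y)"
    and Pt: "weight Pt" "P1 Pt" "\<And>x. Pt x = H x * P0 (norm x) * Q x"
    and Q: "\<And>x. Q x \<ge> 0" "\<And>\<delta> x. \<delta> > 0 \<Longrightarrow> Q (\<delta> *\<^sub>R x) = Q x"
    and par: "weight_parity P = 0" and fac: "of_real \<sigma> * \<i> ^ weight_parity Pt = of_real s * (- \<i>) ^ l"
    and f: "f \<in> A_star s P"
  shows "\<exists>g\<in>A_star \<sigma> Pt. last_sign_radius (\<lambda>x. Pt x * g x) \<le> last_sign_radius (\<lambda>x. P x * f x)"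
proof -
  have f_cont: "continuous_on UNIV f" and f_int: "integrable lebesgue f" and f_ne: "f \<noteq> (\<lambda>x. 0)"
    and f_eig: "\<And>\<xi>. fourier (\<lambda>x. of_real (f x)) \<xi> = of_real s * of_real (f \<xi>)"
    and Pf: "integrable lebesgue (\<lambda>x. P x * f x)" "(LINT x|lebesgue. P x * f x) \<le> 0"
    and ev: "eventually_nonneg (\<lambda>x. P x * f x)"
    using f par by (auto simp: A_star_def)
  have [measurable]: "f \<in> borel_measurable borel" using f_cont by (rule borel_measurable_continuous_onI)
  have f_lb: "integrable lborel f" using f_int by (simp add: integrable_lebesgue_iff_lborel)
  have Pm: "P \<in> borel_measurable lebesgue" and Ptm: "Pt \<in> borel_measurable lebesgue"
    using P(1) Pt(1) by (auto simp: weight_def)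
  obtain R where R: "\<And>x. norm x \<ge> R \<Longrightarrow> P x * f x \<ge> 0" using ev by (auto simp: eventually_nonneg_def)
  have nz: "\<exists>x. norm x \<ge> R' \<and> 1 * P0 (norm x) * f x \<noteq> 0" for R'
  proof (rule ccontr)
    assume no: "\<nexists>x. norm x \<ge> R' \<and> 1 * P0 (norm x) * f x \<noteq> 0"
    have ez: "eventually_zero (\<lambda>x. complex_of_real (P x) * complex_of_real (f x))"
      unfolding eventually_zero_def using no by (intro exI[of _ R']) (auto simp: P(3))
    have "(\<lambda>x. complex_of_real (f x)) = (\<lambda>x. 0)"
      using P(2) ez f_int f_cont f_eig unfolding P3_def
      by (intro P(2)[unfolded P3_def, rule_format]) (auto intro!: continuous_intros)
    then have "f x = 0" for x by (metis of_real_eq_0_iff)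
    then show False using f_ne by auto
  qed
  obtain f0 where f0: "continuous_on UNIV f0" "integrable lborel (\<lambda>y::'m. f0 (norm y))"
    "\<And>\<eta>::'m. fourier (\<lambda>y::'m. of_real (f0 (norm y))) \<eta> = of_real (s * f0 (norm \<eta>))"
    and f0_ne: "(\<lambda>y::'m. f0 (norm y)) \<noteq> (\<lambda>y. 0)"
    and PF: "integrable lebesgue (\<lambda>y::'m. P y * f0 (norm y))" "(LINT y|lebesgue. P y * f0 (norm (y::'m))) \<le> 0"
    and sign: "\<forall>r>0. (\<forall>x::'m. norm x \<ge> r \<longrightarrow> 1 * P0 (norm x) * f x \<ge> 0) \<longrightarrow> (\<forall>y::'m. norm y \<ge> r \<longrightarrow> P y * f0 (norm y) \<ge> 0)"
  proof (rule weighted_projection[OF homogeneous_harmonic_one _ Pm P(3) f_cont f_lb _ s, where R=R])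
    show "fourier (\<lambda>x. complex_of_real (f x)) \<xi> = (- \<i>) ^ 0 * complex_of_real (s * f \<xi>)" for \<xi>
      by (simp add: f_eig)
    show "0 \<le> 1 * P0 (norm x) * f x" if "R \<le> norm x" for x
      using R[OF that] by (simp add: P(3))
  qed (use Pf nz f_lb in \<open>auto simp flip: P(3)\<close>)
  let ?g = "\<lambda>x. H x * f0 (norm x)"
  have g_int: "integrable lborel ?g" by (rule harmonic_lift_integrable[OF H(1) dim f0(1,2)])
  have g_cont: "continuous_on UNIV ?g"
    by (intro continuous_intros homogeneous_harmonicD(2)[OF H(1)] continuous_on_compose2[OF f0(1)]) auto
  have [measurable]: "?g \<in> borel_measurable borel" using g_cont by (rule borel_measurable_continuous_onI)
  note Ptg = weighted_lift[OF H(1) dim Pm P(3) Ptm Pt(2,3) Q f0(1) PF]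
  have imp: "Pt x * ?g x \<ge> 0"
    if r: "r > 0" "\<And>y. norm y \<ge> r \<Longrightarrow> P y * f y \<ge> 0" and x: "norm x \<ge> r" for r and x :: 'n
  proof -
    obtain y :: 'm where y: "norm y = norm x" using vector_choose_size[of "norm x"] by auto
    have "P y * f0 (norm y) \<ge> 0" using sign[rule_format, OF r(1), of y] r(2) x y by (simp add: P(3))
    then have "(H x * H x) * Q x * (P0 (norm x) * f0 (norm x)) \<ge> 0"
      using mult_nonneg_nonneg[OF mult_nonneg_nonneg[OF zero_le_square Q(1)]] by (simp add: P(3) y)
    then show ?thesis by (simp add: Pt(3) mult_ac)
  qed
  have "\<forall>r>0. (\<forall>y. norm y \<ge> r \<longrightarrow> P y * f y \<ge> 0) \<longrightarrow> (\<forall>x. norm x \<ge> r \<longrightarrow> Pt x * ?g x \<ge> 0)"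
    using imp by blast
  note rad = last_sign_radius_mono[OF ev this]
  have "?g \<noteq> (\<lambda>x. 0)"
  proof -
    obtain y :: 'm where "f0 (norm y) \<noteq> 0" using f0_ne by blast
    from harmonic_times_radial_nonzero[OF H f0(1) this]
    obtain x where "?g x \<noteq> 0" by blast
    then show ?thesis by (rule contrapos_nn) (rule fun_cong)
  qed
  then have "?g \<in> A_star \<sigma> Pt"
    unfolding A_star_def mem_Collect_eq
    using g_cont g_int Ptg rad(1) harmonic_lift[OF H(1) dim f0]
    by (intro conjI) (auto simp: fac integrable_lebesgue_iff_lborel mult_ac)
  then show ?thesis using rad(2) by (intro bexI)
qed

text \<open>The bounded sub-level set says that the radial weight is bounded away from zero at infinity. This
makes \<open>H * g\<close> integrable, so that \<open>g\<close> can be projected onto \<open>H\<close>, and it ensures that the projection is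
nonzero: otherwise \<open>H * g\<close>, and with it \<open>g\<close>, would vanish outside a ball, and \<open>g\<close> would be a compactly
supported eigenfunction.\<close>

lemma A_star_projection:
  fixes H Pt :: "'n::euclidean_space \<Rightarrow> real" and P :: "'m::euclidean_space \<Rightarrow> real"
  assumes H: "homogeneous_harmonic_polynomial l H" "H \<noteq> (\<lambda>x. 0)" and dim: "DIM('m) = DIM('n) + 2 * l"
    and s: "s * s = 1" and P: "weight P" "\<And>y. P y = P0 (norm y)"
    and Pt: "\<And>x. Pt x = H x * P0 (norm x)"
    and sub: "c > 0" "bounded {y. \<bar>P y\<bar> \<le> c}"
    and par: "weight_parity P = 0" and fac: "of_real \<sigma> * \<i> ^ weight_parity Pt = of_real s * (- \<i>) ^ l"
    and g: "g \<in> A_star \<sigma> Pt"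
  shows "\<exists>f\<in>A_star s P. last_sign_radius (\<lambda>y. P y * f y) \<le> last_sign_radius (\<lambda>x. Pt x * g x)"
proof -
  note HD = homogeneous_harmonicD[OF H(1)]
  have [measurable]: "H \<in> borel_measurable borel" by (rule HD)
  have g_cont: "continuous_on UNIV g" and g_int: "integrable lebesgue g" and g_ne: "g \<noteq> (\<lambda>x. 0)"
    and g_eig: "\<And>\<xi>. fourier (\<lambda>x. of_real (g x)) \<xi> = of_real \<sigma> * \<i> ^ weight_parity Pt * of_real (g \<xi>)"
    and Ptg: "integrable lebesgue (\<lambda>x. Pt x * g x)" "(LINT x|lebesgue. Pt x * g x) \<le> 0"
    and ev: "eventually_nonneg (\<lambda>x. Pt x * g x)"
    using g by (auto simp: A_star_def)
  have [measurable]: "g \<in> borel_measurable borel" using g_cont by (rule borel_measurable_continuous_onI)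
  have g_lb: "integrable lborel g" using g_int by (simp add: integrable_lebesgue_iff_lborel)
  have eig: "fourier (\<lambda>x. of_real (g x)) \<xi> = (- \<i>) ^ l * of_real (s * g \<xi>)" for \<xi>
    unfolding g_eig fac by simp
  have Pm: "P \<in> borel_measurable lebesgue" using P(1) by (auto simp: weight_def)
  obtain B where B: "\<And>y. \<bar>P y\<bar> \<le> c \<Longrightarrow> norm y \<le> B" using sub(2) unfolding bounded_iff by blast
  have large: "\<bar>P0 (norm x)\<bar> > c" if "norm x > B" for x :: 'n
  proof -
    obtain y :: 'm where y: "norm y = norm x" using vector_choose_size[of "norm x"] by auto
    have "\<not> \<bar>P y\<bar> \<le> c" using B[of y] that by (auto simp: y)
    then show ?thesis by (simp add: P(2) y)
  qed
  have Hg: "integrable lborel (\<lambda>x. H x * g x)"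
  proof -
    have "integrable lborel (\<lambda>x. indicator (cball 0 B) x *\<^sub>R (H x * g x))"
      by (intro borel_integrable_compact continuous_intros continuous_on_subset[OF HD(2)] continuous_on_subset[OF g_cont]) auto
    then have "integrable lebesgue (\<lambda>x. indicator (cball 0 B) x *\<^sub>R (H x * g x))"
      by (subst integrable_lebesgue_iff_lborel) auto
    then have "integrable lebesgue (\<lambda>x. \<bar>indicator (cball 0 B) x *\<^sub>R (H x * g x)\<bar> + (1 / c) * \<bar>Pt x * g x\<bar>)"
      using Ptg(1) by (intro Bochner_Integration.integrable_add integrable_mult_right integrable_abs)
    then have "integrable lebesgue (\<lambda>x. H x * g x)"
    proof (rule Bochner_Integration.integrable_bound)
      show "AE x in lebesgue. norm (H x * g x) \<le> norm (\<bar>indicator (cball 0 B) x *\<^sub>R (H x * g x)\<bar> + (1 / c) * \<bar>Pt x * g x\<bar>)"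
      proof (rule AE_I2)
        fix x
        show "norm (H x * g x) \<le> norm (\<bar>indicator (cball 0 B) x *\<^sub>R (H x * g x)\<bar> + (1 / c) * \<bar>Pt x * g x\<bar>)"
        proof (cases "norm x \<le> B")
          case True
          then show ?thesis using sub(1) by (auto simp: abs_mult)
        next
          case False
          have "c * \<bar>H x * g x\<bar> \<le> \<bar>P0 (norm x)\<bar> * \<bar>H x * g x\<bar>"
            using large[of x] False by (intro mult_right_mono) auto
          also have "\<dots> = \<bar>Pt x * g x\<bar>" by (simp add: Pt abs_mult)
          finally show ?thesis using sub(1) False by (simp add: field_simps)
        qed
      qed
    qed (intro measurable_completion, measurable)
    then show ?thesis by (subst (asm) integrable_lebesgue_iff_lborel) auto
  qed
  obtain R where R: "\<And>x. norm x \<ge> R \<Longrightarrow> Pt x * g x \<ge> 0" using ev by (auto simp: eventually_nonneg_def)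
  have nz: "\<exists>x. norm x \<ge> R' \<and> H x * P0 (norm x) * g x \<noteq> 0" for R'
  proof (rule ccontr)
    assume no: "\<nexists>x. norm x \<ge> R' \<and> H x * P0 (norm x) * g x \<noteq> 0"
    define T where "T = max R' B"
    have Hg0: "H x * g x = 0" if "norm x > T" for x
    proof -
      have "norm x \<ge> R'" "norm x > B" using that by (auto simp: T_def)
      then have "H x * P0 (norm x) * g x = 0" "P0 (norm x) \<noteq> 0"
        using no large[of x] sub(1) by auto
      then show ?thesis by simp
    qed
    \<comment> \<open>The zeros of \<open>H\<close> have empty interior, so continuity of \<open>g\<close> removes the factor \<open>H\<close>.\<close>
    have g0: "g x = 0" if "norm x \<ge> T + 1" for x
    proof (rule ccontr)
      assume "g x \<noteq> 0"
      have "open ({x. norm x > T} \<inter> g -` (- {0}))"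
        by (intro open_Int open_Collect_less continuous_intros open_vimage g_cont)
      moreover have "x \<in> {x. norm x > T} \<inter> g -` (- {0})" using that \<open>g x \<noteq> 0\<close> by auto
      ultimately obtain e where e: "e > 0" "ball x e \<subseteq> {x. norm x > T} \<inter> g -` (- {0})"
        unfolding open_contains_ball by blast
      have "H z = 0" for z
      proof (rule real_polynomial_zero_on_ball[OF HD(1) e(1)])
        fix w assume "w \<in> ball x e"
        then have "norm w > T" "g w \<noteq> 0" using e(2) by auto
        then show "H w = 0" using Hg0[of w] by simp
      qed
      then show False using H(2) by auto
    qed
    have c: "(- \<i>) ^ l * complex_of_real s \<noteq> 0" using s by auto
    have zero: "g \<xi> = 0" if "\<xi> \<noteq> 0" for \<xi>
      by (rule compactly_supported_eigenfunction_zero[OF g_lb c _ g0 that]) (auto simp: eig)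
    have "fourier (\<lambda>x. complex_of_real (g x)) 0 = (\<integral>x. wave (x \<bullet> 0) * complex_of_real (g x) \<partial>lborel)"
      by (rule fourier_eq_lborel) measurable
    also have "\<dots> = 0"
    proof (rule integral_eq_zero_AE)
      show "AE x in lborel. wave (x \<bullet> 0) * complex_of_real (g x) = 0"
        using AE_lborel_singleton[of "0::'n"] by eventually_elim (simp add: zero)
    qed
    finally have "g 0 = 0" using c by (simp add: eig)
    with zero have "g x = 0" for x by (cases "x = 0") auto
    then show False using g_ne by auto
  qed
  obtain f0 where f0: "continuous_on UNIV f0" "integrable lborel (\<lambda>y::'m. f0 (norm y))"
    "\<And>\<eta>::'m. fourier (\<lambda>y::'m. of_real (f0 (norm y))) \<eta> = of_real (s * f0 (norm \<eta>))"
    and f0_ne: "(\<lambda>y::'m. f0 (norm y)) \<noteq> (\<lambda>y. 0)"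
    and PF: "integrable lebesgue (\<lambda>y::'m. P y * f0 (norm y))" "(LINT y|lebesgue. P y * f0 (norm (y::'m))) \<le> 0"
    and sign: "\<forall>r>0. (\<forall>x. norm x \<ge> r \<longrightarrow> H x * P0 (norm x) * g x \<ge> 0) \<longrightarrow> (\<forall>y::'m. norm y \<ge> r \<longrightarrow> P y * f0 (norm y) \<ge> 0)"
  proof (rule weighted_projection[OF H(1) dim Pm P(2) g_cont g_lb Hg s eig Ptg[unfolded Pt] _ nz, where R=R])
    show "H x * P0 (norm x) * g x \<ge> 0" if "norm x \<ge> R" for x
      using R[OF that] by (simp add: Pt)
  qed blast
  let ?f = "\<lambda>y::'m. f0 (norm y)"
  have f_cont: "continuous_on UNIV ?f"
    by (intro continuous_intros continuous_on_compose2[OF f0(1)]) auto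
  have [measurable]: "?f \<in> borel_measurable borel" using f_cont by (rule borel_measurable_continuous_onI)
  note rad = last_sign_radius_mono[OF ev[unfolded Pt] sign, folded Pt]
  have "?f \<in> A_star s P"
    unfolding A_star_def mem_Collect_eq
    using f_cont f0 f0_ne PF rad(1) by (intro conjI) (auto simp: par integrable_lebesgue_iff_lborel)
  then show ?thesis using rad(2) by (intro bexI)
qed

theorem theorem4:
  fixes d l r :: nat
    and s :: real
    and coord :: "nat \<Rightarrow> 'n::finite"
    and P :: "real ^ 'm::finite \<Rightarrow> real"
    and P0 :: "real \<Rightarrow> real"
    and Pt H Q :: "real ^ 'n \<Rightarrow> real"
  assumes d: "d \<ge> 1" "CARD('n) = d" "CARD('m) = d + 2 * l"
    and coord: "bij_betw coord {1..d} UNIV"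
    and s: "s \<in> {1, -1}"
    and r: "r \<in> {0, 1}" "r mod 2 = l mod 2"
    and P: "weight P" "P1 P" "P2 P" "P3 P"
    and P_radial: "\<And>x. P x = P0 (norm x)"
    and Pt: "weight Pt" "P1 Pt" "P2 Pt"
    and Pt_form: "\<And>x. Pt x = H x * P0 (norm x) * Q x"
    and H: "H \<noteq> (\<lambda>x. 0)" "homogeneous_harmonic_polynomial l H"
    and Q_even: "\<And>x. Q (- x) = Q x"
    and Q_nonneg: "\<And>x. Q x \<ge> 0"
    and Q_homogeneous: "\<And>\<delta> x. \<delta> > 0 \<Longrightarrow> Q (\<delta> *\<^sub>R x) = Q x"
  shows "(A_star s P \<noteq> {} \<longrightarrow>
            A_star (s * (-1) ^ ((r + l) div 2)) Pt \<noteq> {} \<and>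
            A_inf s P \<ge> A_inf (s * (-1) ^ ((r + l) div 2)) Pt) \<and>
         ((\<exists>c>0. bounded {x. \<bar>P x\<bar> \<le> c}) \<and> Q = (\<lambda>x. 1) \<and> l \<le> d \<and>
            H \<in> orthogonal_orbit (\<lambda>x. \<Prod>j = 1..l. x $ coord j) \<longrightarrow>
            (A_star s P \<noteq> {} \<longleftrightarrow> A_star (s * (-1) ^ ((r + l) div 2)) Pt \<noteq> {}) \<and>
            A_inf s P = A_inf (s * (-1) ^ ((r + l) div 2)) Pt)"
proof -
  define \<sigma> where "\<sigma> = s * (-1) ^ ((r + l) div 2)"
  have dim: "DIM(real ^ 'm) = DIM(real ^ 'n) + 2 * l" using d by simp
  have s2: "s * s = 1" using s by auto
  have parP: "weight_parity P = 0"
    by (rule weight_parityI[OF P(1)]) (simp add: has_parity_def P_radial)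
  have parPt: "weight_parity Pt = r"
  proof (rule weight_parityI[OF Pt(1)])
    have "(-1 :: real) ^ l = (-1) ^ r"
      using r(2) by (simp add: minus_one_power_iff even_iff_mod_2_eq_zero)
    moreover have "H (- x) = (-1) ^ l * H x" for x
      using homogeneous_harmonicD(4)[OF H(2), of "-1" x] by simp
    ultimately show "has_parity Pt r"
      using r(1) by (simp add: has_parity_def Pt_form Q_even)
  qed
  have fac: "complex_of_real \<sigma> * \<i> ^ weight_parity Pt = of_real s * (- \<i>) ^ l"
    unfolding parPt \<sigma>_def sign_factor[OF r, symmetric] by (simp add: mult_ac)
  have lift: "\<exists>g\<in>A_star \<sigma> Pt. last_sign_radius (\<lambda>x. Pt x * g x) \<le> last_sign_radius (\<lambda>x. P x * f x)"
    if "f \<in> A_star s P" for f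
    by (rule A_star_lift[OF H(2,1) dim s2 P(1,4) P_radial Pt(1,2) Pt_form Q_nonneg Q_homogeneous parP fac that])
  have ge: "A_inf \<sigma> Pt \<le> A_inf s P"
    unfolding A_inf_def by (rule INF_mono) (use lift in auto)
  have converse: "(A_star s P \<noteq> {} \<longleftrightarrow> A_star \<sigma> Pt \<noteq> {}) \<and> A_inf s P = A_inf \<sigma> Pt"
    if c: "c > 0" "bounded {x. \<bar>P x\<bar> \<le> c}" and Q1: "Q = (\<lambda>x. 1)" for c
  proof -
    have form: "Pt x = H x * P0 (norm x)" for x using Pt_form by (simp add: Q1)
    have proj: "\<exists>f\<in>A_star s P. last_sign_radius (\<lambda>x. P x * f x) \<le> last_sign_radius (\<lambda>x. Pt x * g x)"
      if "g \<in> A_star \<sigma> Pt" for g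
      by (rule A_star_projection[OF H(2,1) dim s2 P(1) P_radial form c parP fac that])
    have "A_inf s P \<le> A_inf \<sigma> Pt"
      unfolding A_inf_def by (rule INF_mono) (use proj in auto)
    then have "A_inf s P = A_inf \<sigma> Pt" using ge by (rule antisym)
    moreover have "A_star s P \<noteq> {} \<longleftrightarrow> A_star \<sigma> Pt \<noteq> {}" using lift proj by fast
    ultimately show ?thesis by simp
  qed
  show ?thesis
    unfolding \<sigma>_def[symmetric]
  proof (intro conjI[OF _ impI])
    show "A_star s P \<noteq> {} \<longrightarrow> A_star \<sigma> Pt \<noteq> {} \<and> A_inf \<sigma> Pt \<le> A_inf s P"
      using lift ge by fast
  next
    assume "(\<exists>c>0. bounded {x. \<bar>P x\<bar> \<le> c}) \<and> Q = (\<lambda>x. 1) \<and> l \<le> d \<and>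
      H \<in> orthogonal_orbit (\<lambda>x. \<Prod>j = 1..l. x $ coord j)"
    then obtain c where "c > 0" "bounded {x. \<bar>P x\<bar> \<le> c}" "Q = (\<lambda>x. 1)" by blast
    then show "(A_star s P \<noteq> {} \<longleftrightarrow> A_star \<sigma> Pt \<noteq> {}) \<and> A_inf s P = A_inf \<sigma> Pt"
      by (rule converse)
  qed
qed

end
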